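(* Assume $K<\infty$. For every $(u,\gamma)\in BV(a,b)\times\mathcal M(a,b)$ with $\|u\|_{L^\infty}\le K$, $\gamma=D^su+g\mathcal L^1$, $g\in L^1(a,b)$, $u'-g\in L^2(a,b)$, one has $E'(u,\gamma)\ge E(u,\gamma)$.
   Context: Fix $0<a<b<\infty$, $c_0>0$, $K\in(0,\infty)$; $f(t)=c_0\min\{t,1\}$; $I_\varepsilon(x)=(x-\varepsilon,x+\varepsilon)$; $\fint_Bh=\frac1{|B|}\int_Bh$. Flat norm $\|\mu\|_{\rm flat}=\sup\{\int\varphi\,d\mu:\varphi\in W^{1,\infty}_0(a,b),\|\varphi\|_{W^{1,\infty}}\le1\}$. For $u\in BV(a,b)$: $Du=u'\mathcal L^1+D^su$, $D^su=[u]\mathcal H^0\llcorner J_u+D^cu$, $[u](x)=u(x+)-u(x-)$. $E_\varepsilon(u,\gamma)=\int_a^b|u'-g|^2dx+\frac1\varepsilon\int_a^bf\big(\varepsilon\fint_{I_\varepsilon(x)\cap(a,b)}|g|dt\big)dx$ if $u\in W^{1,1}(a,b)$, $\|u\|_{L^\infty}\le K$, $\gamma=g\mathcal L^1$, $g\in L^1$, $u'-g\in L^2$; $+\infty$ otherwise. $E'(u,\gamma)=\inf\{\liminf_{\varepsilon\to0}E_\varepsilon(u_\varepsilon,\gamma_\varepsilon):u_\varepsilon\to u\text{ in }L^1,\ \|\gamma_\varepsilon-\gamma\|_{\rm flat}\to0\}$. $E(u,\gamma)=\int_a^b|u'-g|^2dx+c_0\int_a^b|g|dx+2\sum_{x\in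 J_u}f(\frac12|[u](x)|)+c_0|D^cu|(a,b)$ if $u\in BV(a,b)$, $\|u\|_{L^\infty}\le K$, $\gamma=D^su+g\mathcal L^1$, $g\in L^1$, $u'-g\in L^2$; $+\infty$ otherwise. *)

theory Defs
  imports "HOL-Analysis.Analysis"
begin

text \<open>A finite signed measure on the open interval (a,b) is represented by a pair (P,N)
  of finite Borel measures on the real line, both concentrated on (a,b); it stands for P - N.
  (Finite Borel measures on the line are Radon.)\<close>

type_synonym smeasure = "real measure \<times> real measure"

definition sm :: "real \<Rightarrow> real \<Rightarrow> smeasure \<Rightarrow> bool" where
  "sm a b \<mu> \<longleftrightarrow>
     sets (fst \<mu>) = sets borel \<and> sets (snd \<mu>) = sets borel \<and>
     finite_measure (fst \<mu>) \<and> finite_measure (snd \<mu>) \<and>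
     emeasure (fst \<mu>) (UNIV - {a<..<b}) = 0 \<and> emeasure (snd \<mu>) (UNIV - {a<..<b}) = 0"

definition sm_val :: "smeasure \<Rightarrow> real set \<Rightarrow> real" where
  "sm_val \<mu> A = measure (fst \<mu>) A - measure (snd \<mu>) A"

definition sm_int :: "smeasure \<Rightarrow> (real \<Rightarrow> real) \<Rightarrow> real" where
  "sm_int \<mu> \<phi> = integral\<^sup>L (fst \<mu>) \<phi> - integral\<^sup>L (snd \<mu>) \<phi>"

definition ac_sm :: "real \<Rightarrow> real \<Rightarrow> (real \<Rightarrow> real) \<Rightarrow> smeasure" where
  "ac_sm a b g =
     (density lborel (\<lambda>x. ennreal (g x) * indicator {a<..<b} x),
      density lborel (\<lambda>x. ennreal (- g x) * indicator {a<..<b} x))"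

definition sm_eq :: "real \<Rightarrow> real \<Rightarrow> smeasure \<Rightarrow> smeasure \<Rightarrow> bool" where
  "sm_eq a b \<mu> \<nu> \<longleftrightarrow> (\<forall>A \<in> sets borel. A \<subseteq> {a<..<b} \<longrightarrow> sm_val \<mu> A = sm_val \<nu> A)"

definition tvar :: "real \<Rightarrow> real \<Rightarrow> (real set \<Rightarrow> real) \<Rightarrow> ennreal" where
  "tvar a b \<nu> = (SUP P \<in> {P. finite P \<and> disjoint P \<and> P \<subseteq> sets borel \<and> \<Union>P \<subseteq> {a<..<b}}.
                    \<Sum>A\<in>P. ennreal \<bar>\<nu> A\<bar>)"

text \<open>Flat norm: sup over phi in W^{1,inf}_0(a,b) (extended by zero) with
  max(||phi||_inf, ||phi'||_inf) <= 1.\<close>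
definition flat_test :: "real \<Rightarrow> real \<Rightarrow> (real \<Rightarrow> real) set" where
  "flat_test a b = {\<phi>. (\<forall>x. x \<notin> {a<..<b} \<longrightarrow> \<phi> x = 0) \<and> (\<forall>x. \<bar>\<phi> x\<bar> \<le> 1)
                        \<and> 1-lipschitz_on UNIV \<phi>}"

definition flat_dist :: "real \<Rightarrow> real \<Rightarrow> smeasure \<Rightarrow> smeasure \<Rightarrow> ereal" where
  "flat_dist a b \<mu> \<nu> = (SUP \<phi> \<in> flat_test a b. ereal (sm_int \<mu> \<phi> - sm_int \<nu> \<phi>))"

definition testfun :: "real \<Rightarrow> real \<Rightarrow> (real \<Rightarrow> real) \<Rightarrow> (real \<Rightarrow> real) \<Rightarrow> bool" where
  "testfun a b \<phi> \<phi>' \<longleftrightarrow> (\<forall>x. (\<phi> has_real_derivative \<phi>' x) (at x)) \<and> continuous_on UNIV \<phi>' \<and>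
     (\<exists>c d. a < c \<and> c \<le> d \<and> d < b \<and> (\<forall>x. x \<notin> {c..d} \<longrightarrow> \<phi> x = 0))"

definition weak_deriv :: "real \<Rightarrow> real \<Rightarrow> (real \<Rightarrow> real) \<Rightarrow> (real \<Rightarrow> real) \<Rightarrow> bool" where
  "weak_deriv a b u w \<longleftrightarrow> set_integrable lborel {a<..<b} u \<and> set_integrable lborel {a<..<b} w \<and>
     (\<forall>\<phi> \<phi>'. testfun a b \<phi> \<phi>' \<longrightarrow>
        (LINT x:{a<..<b}|lborel. u x * \<phi>' x) = - (LINT x:{a<..<b}|lborel. w x * \<phi> x))"

definition BV_deriv :: "real \<Rightarrow> real \<Rightarrow> (real \<Rightarrow> real) \<Rightarrow> smeasure \<Rightarrow> bool" where
  "BV_deriv a b u Du \<longleftrightarrow> set_integrable lborel {a<..<b} u \<and> sm a b Du \<and>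
     (\<forall>\<phi> \<phi>'. testfun a b \<phi> \<phi>' \<longrightarrow>
        (LINT x:{a<..<b}|lborel. u x * \<phi>' x) = - sm_int Du \<phi>)"

text \<open>Lebesgue decomposition Du = h L^1 + sigma, sigma singular w.r.t. L^1 (so h = u', sigma = D^s u).\<close>
definition sm_singular :: "real \<Rightarrow> real \<Rightarrow> smeasure \<Rightarrow> bool" where
  "sm_singular a b \<sigma> \<longleftrightarrow> sm a b \<sigma> \<and> (\<exists>N \<in> sets borel. emeasure lborel N = 0 \<and>
     emeasure (fst \<sigma>) (UNIV - N) = 0 \<and> emeasure (snd \<sigma>) (UNIV - N) = 0)"

definition BV_decomp :: "real \<Rightarrow> real \<Rightarrow> smeasure \<Rightarrow> (real \<Rightarrow> real) \<Rightarrow> smeasure \<Rightarrow> bool" where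
  "BV_decomp a b Du h \<sigma> \<longleftrightarrow> set_integrable lborel {a<..<b} h \<and> sm_singular a b \<sigma> \<and>
     (\<forall>A \<in> sets borel. A \<subseteq> {a<..<b} \<longrightarrow>
        sm_val Du A = (LINT x:A|lborel. h x) + sm_val \<sigma> A)"

definition Linf_le :: "real \<Rightarrow> real \<Rightarrow> (real \<Rightarrow> real) \<Rightarrow> real \<Rightarrow> bool" where
  "Linf_le a b u K \<longleftrightarrow> (AE x in lborel. x \<in> {a<..<b} \<longrightarrow> \<bar>u x\<bar> \<le> K)"

definition L2 :: "real \<Rightarrow> real \<Rightarrow> (real \<Rightarrow> real) \<Rightarrow> bool" where
  "L2 a b v \<longleftrightarrow> v \<in> borel_measurable lborel \<and> set_integrable lborel {a<..<b} (\<lambda>x. (v x)\<^sup>2)"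

definition right_alim :: "(real \<Rightarrow> real) \<Rightarrow> real \<Rightarrow> real \<Rightarrow> bool" where
  "right_alim u x L \<longleftrightarrow>
     ((\<lambda>r. (LINT t:{x<..<x+r}|lborel. \<bar>u t - L\<bar>) / r) \<longlongrightarrow> 0) (at_right 0)"

definition left_alim :: "(real \<Rightarrow> real) \<Rightarrow> real \<Rightarrow> real \<Rightarrow> bool" where
  "left_alim u x L \<longleftrightarrow>
     ((\<lambda>r. (LINT t:{x-r<..<x}|lborel. \<bar>u t - L\<bar>) / r) \<longlongrightarrow> 0) (at_right 0)"

definition jump_set :: "real \<Rightarrow> real \<Rightarrow> (real \<Rightarrow> real) \<Rightarrow> real set" where
  "jump_set a b u = {x \<in> {a<..<b}. \<exists>L1 L2. left_alim u x L1 \<and> right_alim u x L2 \<and> L1 \<noteq> L2}"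

definition jump :: "(real \<Rightarrow> real) \<Rightarrow> real \<Rightarrow> real" where
  "jump u x = (THE L. right_alim u x L) - (THE L. left_alim u x L)"

definition fpot :: "real \<Rightarrow> real \<Rightarrow> real" where
  "fpot c0 t = c0 * min t 1"

definition avg_abs :: "real \<Rightarrow> real \<Rightarrow> real \<Rightarrow> (real \<Rightarrow> real) \<Rightarrow> real \<Rightarrow> real" where
  "avg_abs a b \<epsilon> g x =
     (LINT t:({x-\<epsilon><..<x+\<epsilon>} \<inter> {a<..<b})|lborel. \<bar>g t\<bar>) / measure lborel ({x-\<epsilon><..<x+\<epsilon>} \<inter> {a<..<b})"

definition Eeps_adm :: "real \<Rightarrow> real \<Rightarrow> real \<Rightarrow> (real \<Rightarrow> real) \<Rightarrow> smeasure
                         \<Rightarrow> (real \<Rightarrow> real) \<times> (real \<Rightarrow> real) \<Rightarrow> bool" where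
  "Eeps_adm a b K u \<gamma> wg \<longleftrightarrow> weak_deriv a b u (fst wg) \<and> Linf_le a b u K \<and>
     set_integrable lborel {a<..<b} (snd wg) \<and> sm_eq a b \<gamma> (ac_sm a b (snd wg)) \<and>
     L2 a b (\<lambda>x. fst wg x - snd wg x)"

definition Eeps :: "real \<Rightarrow> real \<Rightarrow> real \<Rightarrow> real \<Rightarrow> real \<Rightarrow> (real \<Rightarrow> real) \<Rightarrow> smeasure \<Rightarrow> ennreal" where
  "Eeps a b c0 K \<epsilon> u \<gamma> =
     (if \<exists>wg. Eeps_adm a b K u \<gamma> wg then
        (let w = fst (SOME wg. Eeps_adm a b K u \<gamma> wg); g = snd (SOME wg. Eeps_adm a b K u \<gamma> wg) in
          (\<integral>\<^sup>+ x\<in>{a<..<b}. ennreal ((w x - g x)\<^sup>2) \<partial>lborel)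
          + ennreal (1 / \<epsilon>) * (\<integral>\<^sup>+ x\<in>{a<..<b}. ennreal (fpot c0 (\<epsilon> * avg_abs a b \<epsilon> g x)) \<partial>lborel))
      else top)"

definition Eprime :: "real \<Rightarrow> real \<Rightarrow> real \<Rightarrow> real \<Rightarrow> (real \<Rightarrow> real) \<Rightarrow> smeasure \<Rightarrow> ennreal" where
  "Eprime a b c0 K u \<gamma> =
     (INF s \<in> {(\<epsilon>, U, \<Gamma>). (\<forall>j. \<epsilon> j > 0) \<and> \<epsilon> \<longlonglongrightarrow> 0 \<and>
                (\<forall>j. set_integrable lborel {a<..<b} (U j)) \<and>
                (\<lambda>j. LINT x:{a<..<b}|lborel. \<bar>U j x - u x\<bar>) \<longlonglongrightarrow> 0 \<and>
                (\<forall>j. sm a b (\<Gamma> j)) \<and> (\<lambda>j. flat_dist a b (\<Gamma> j) \<gamma>) \<longlonglongrightarrow> 0}.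
        (case s of (\<epsilon>, U, \<Gamma>) \<Rightarrow> liminf (\<lambda>j. Eeps a b c0 K (\<epsilon> j) (U j) (\<Gamma> j))))"

definition E_adm :: "real \<Rightarrow> real \<Rightarrow> real \<Rightarrow> (real \<Rightarrow> real) \<Rightarrow> smeasure
                     \<Rightarrow> smeasure \<times> (real \<Rightarrow> real) \<times> smeasure \<times> (real \<Rightarrow> real) \<Rightarrow> bool" where
  "E_adm a b K u \<gamma> X \<longleftrightarrow> (case X of (Du, h, \<sigma>, g) \<Rightarrow>
     BV_deriv a b u Du \<and> Linf_le a b u K \<and> BV_decomp a b Du h \<sigma> \<and>
     set_integrable lborel {a<..<b} g \<and>
     (\<forall>A \<in> sets borel. A \<subseteq> {a<..<b} \<longrightarrow> sm_val \<gamma> A = sm_val \<sigma> A + (LINT x:A|lborel. g x)) \<and>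
     L2 a b (\<lambda>x. h x - g x))"

text \<open>E(u,gamma); here h = u', sigma = D^s u and D^c u = D^s u - sum_{J_u} [u] delta_x.\<close>
definition E_val :: "real \<Rightarrow> real \<Rightarrow> real \<Rightarrow> (real \<Rightarrow> real)
                     \<Rightarrow> smeasure \<times> (real \<Rightarrow> real) \<times> smeasure \<times> (real \<Rightarrow> real) \<Rightarrow> ennreal" where
  "E_val a b c0 u X = (case X of (Du, h, \<sigma>, g) \<Rightarrow>
       (\<integral>\<^sup>+ x\<in>{a<..<b}. ennreal ((h x - g x)\<^sup>2) \<partial>lborel)
     + ennreal c0 * (\<integral>\<^sup>+ x\<in>{a<..<b}. ennreal \<bar>g x\<bar> \<partial>lborel)
     + 2 * (\<integral>\<^sup>+ x. ennreal (fpot c0 (\<bar>jump u x\<bar> / 2)) \<partial>count_space (jump_set a b u))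
     + ennreal c0 * tvar a b (\<lambda>A. sm_val \<sigma> A - (\<Sum>\<^sub>\<infinity> x \<in> A \<inter> jump_set a b u. jump u x)))"

definition E :: "real \<Rightarrow> real \<Rightarrow> real \<Rightarrow> real \<Rightarrow> (real \<Rightarrow> real) \<Rightarrow> smeasure \<Rightarrow> ennreal" where
  "E a b c0 K u \<gamma> =
     (if \<exists>X. E_adm a b K u \<gamma> X then E_val a b c0 u (SOME X. E_adm a b K u \<gamma> X) else top)"

end

theory Submission
  imports Defs "HOL-Probability.Distribution_Functions"
begin

text \<open>
  The two terms of the energy are bounded from below separately along an admissible sequence
  \<open>(u\<^sub>j, g\<^sub>j)\<close>. Testing with \<open>C\<^sup>1\<close> functions, \<open>v\<^sub>j = u\<^sub>j' - g\<^sub>j\<close> converges weakly to \<open>Du - \<gamma> = u' - g\<close>,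
  so the \<open>L\<^sup>2\<close> term is lower semicontinuous.

  For the nonlocal term let \<open>\<mu>\<^sub>j = |g\<^sub>j| dx\<close>. Its integrand is at least
  \<open>c\<^sub>0 min (\<mu>\<^sub>j(I\<^sub>\<epsilon>(x)) / 2) 1\<close>, and over an interval \<open>A\<close> this contributes at least \<open>c\<^sub>0 min 2 (\<mu>\<^sub>j(A'))\<close>,
  where \<open>A'\<close> is \<open>A\<close> shrunk by \<open>3 \<epsilon>\<close>. As \<open>g\<^sub>j dx\<close> converges to \<open>\<gamma>\<close> against test functions, the limit is
  at least \<open>c\<^sub>0 \<Sum> min 2 (|\<gamma>|(A\<^sub>i))\<close> for every finite family of disjoint intervals. Refining the
  family, the truncation survives only at the atoms of \<open>\<gamma>\<close>. By the representation
  \<open>u(x) = c + Du(a, x]\<close> these atoms are the jumps of \<open>u\<close>, and the sum becomes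
  \<open>\<integral> |g| + \<Sum> min 2 |[u]| + |D\<^sup>c u|\<close>.
\<close>

section \<open>Sums of measures and signed measures\<close>

text \<open>Flat convergence gives information only through pairings with test functions, and
  cancellation may make the masses of \<open>|g j| dx\<close> much larger than the variation of the
  limit. So the nonlocal term is bounded below through finitely many test functions at a time, one
  per cell and compactly supported in its open cell: for small \<open>\<epsilon>\<close> their
  supports survive the shrinking of the cells. The constants match as follows. A window has length
  at most \<open>2 * \<epsilon>\<close>, so \<open>\<epsilon>\<close> times the average is at least
  half of the mass in it, which reaches the threshold 1 of \<open>f\<close> at mass 2. A jump of
  size \<open>s\<close> costs \<open>2 * f (s / 2) = c0 * min 2 s\<close>, the same truncation at 2.
  Both \<open>Eeps\<close> and \<open>E\<close> pick a representation by \<open>SOME\<close>. Hence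
  the bound is proved for an arbitrary admissible representation of the limit. Along a sequence
  \<open>Eeps\<close> is infinite wherever no representation exists; such indices are removed by
  passing to a subsequence.\<close>

definition sum_measure :: "'a measure \<Rightarrow> 'a measure \<Rightarrow> 'a measure" where
  "sum_measure M N = measure_of (space M) (sets M) (\<lambda>A. emeasure M A + emeasure N A)"

lemma space_sum_measure [simp]: "space (sum_measure M N) = space M"
  and sets_sum_measure [simp, measurable_cong]: "sets (sum_measure M N) = sets M"
  by (auto simp: sum_measure_def)

lemma emeasure_sum_measure:
  assumes "sets N = sets M" "A \<in> sets M"
  shows "emeasure (sum_measure M N) A = emeasure M A + emeasure N A"
  unfolding sum_measure_def
proof (rule emeasure_measure_of_sigma[OF sets.sigma_algebra_axioms])
  show "positive (sets M) (\<lambda>A. emeasure M A + emeasure N A)"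
    by (simp add: positive_def)
  show "countably_additive (sets M) (\<lambda>A. emeasure M A + emeasure N A)"
  proof (rule countably_additiveI)
    fix F :: "nat \<Rightarrow> 'a set"
    assume F: "range F \<subseteq> sets M" "disjoint_family F" "(\<Union>i. F i) \<in> sets M"
    have "(\<Sum>i. emeasure M (F i)) = emeasure M (\<Union>i. F i)"
      using F by (intro suminf_emeasure) auto
    moreover have "(\<Sum>i. emeasure N (F i)) = emeasure N (\<Union>i. F i)"
      using F assms by (intro suminf_emeasure) auto
    ultimately show "(\<Sum>i. emeasure M (F i) + emeasure N (F i)) =
        emeasure M (\<Union>i. F i) + emeasure N (\<Union>i. F i)"
      by (simp add: suminf_add[symmetric])
  qed
qed fact

lemma finite_measure_sum_measure:
  assumes "finite_measure M" "finite_measure N" "sets N = sets M"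
  shows "finite_measure (sum_measure M N)"
proof
  interpret M: finite_measure M by fact
  interpret N: finite_measure N by fact
  have "space N = space M" using assms(3) by (rule sets_eq_imp_space_eq)
  then show "emeasure (sum_measure M N) (space (sum_measure M N)) \<noteq> \<infinity>"
    using assms(3) by (simp add: emeasure_sum_measure M.emeasure_eq_measure N.emeasure_eq_measure)
qed

lemma measure_sum_measure:
  assumes "finite_measure M" "finite_measure N" "sets N = sets M" "A \<in> sets M"
  shows "measure (sum_measure M N) A = measure M A + measure N A"
proof -
  interpret M: finite_measure M by fact
  interpret N: finite_measure N by fact
  show ?thesis
    unfolding measure_def[of "sum_measure M N"]
    using assms by (simp add: emeasure_sum_measure M.emeasure_eq_measure N.emeasure_eq_measure
      flip: ennreal_plus)
qed

lemma nn_integral_sum_measure: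
  assumes [measurable_cong]: "sets N = sets M" and "f \<in> borel_measurable M"
  shows "(\<integral>\<^sup>+x. f x \<partial>sum_measure M N) = (\<integral>\<^sup>+x. f x \<partial>M) + (\<integral>\<^sup>+x. f x \<partial>N)"
  using assms(2)
proof (induction f rule: borel_measurable_induct)
  case (cong f g)
  have "space N = space M" using assms(1) by (rule sets_eq_imp_space_eq)
  then show ?case
    using cong by (metis (mono_tags, lifting) nn_integral_cong space_sum_measure)
next
  case (set A)
  then show ?case using assms(1) by (simp add: emeasure_sum_measure)
next
  case (mult u c)
  note [measurable] = mult(2)
  show ?case using mult(4) by (simp add: nn_integral_cmult distrib_left)
next
  case (add u v)
  have [measurable]: "u \<in> borel_measurable M" "v \<in> borel_measurable M" by fact+
  show ?case using add.IH by (simp add: nn_integral_add ac_simps)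
next
  case (seq U)
  have [measurable]: "U i \<in> borel_measurable M" for i by fact
  have eq: "(\<integral>\<^sup>+x. (SUP i. U i) x \<partial>L) = (SUP i. \<integral>\<^sup>+x. U i x \<partial>L)"
    if [measurable_cong]: "sets L = sets M" for L
    using \<open>incseq U\<close> by (simp add: nn_integral_monotone_convergence_SUP image_comp)
  have inc: "incseq (\<lambda>i. \<integral>\<^sup>+x. U i x \<partial>L)" for L
    using \<open>incseq U\<close> by (auto simp: incseq_def le_fun_def intro!: nn_integral_mono)
  show ?case
    unfolding eq[OF sets_sum_measure] eq[OF refl] eq[OF assms(1)] seq.IH
    by (simp add: ennreal_SUP_add inc)
qed

lemma integral_sum_measure:
  fixes f :: "'a \<Rightarrow> real"
  assumes [measurable_cong]: "sets N = sets M" and M: "integrable M f" and N: "integrable N f"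
  shows "integral\<^sup>L (sum_measure M N) f = integral\<^sup>L M f + integral\<^sup>L N f"
proof -
  note [measurable] = borel_measurable_integrable[OF M]
  have "integrable (sum_measure M N) f"
    using M N by (auto simp: integrable_iff_bounded nn_integral_sum_measure assms(1))
  then show ?thesis
    using M N
    by (simp add: real_lebesgue_integral_def nn_integral_sum_measure assms(1) real_integrable_def
        less_top[symmetric] enn2real_plus)
qed

section \<open>Signed measures represented by pairs of positive measures\<close>

lemma smD:
  assumes "sm a b \<mu>"
  shows "finite_borel_measure (fst \<mu>)" "finite_borel_measure (snd \<mu>)"
    "AE x in fst \<mu>. x \<in> {a<..<b}" "AE x in snd \<mu>. x \<in> {a<..<b}"
    "sets (fst \<mu>) = sets borel" "sets (snd \<mu>) = sets borel"
proof -
  have s: "space (fst \<mu>) = UNIV" "space (snd \<mu>) = UNIV"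
    using assms by (auto simp: sm_def dest: sets_eq_imp_space_eq)
  show "finite_borel_measure (fst \<mu>)" "finite_borel_measure (snd \<mu>)"
    using assms by (auto simp: sm_def finite_borel_measure_def finite_borel_measure_axioms_def)
  show "AE x in fst \<mu>. x \<in> {a<..<b}" "AE x in snd \<mu>. x \<in> {a<..<b}"
    using assms s by (auto simp: sm_def null_sets_def intro!: AE_I[of _ _ "UNIV - {a<..<b}"])
  show "sets (fst \<mu>) = sets borel" "sets (snd \<mu>) = sets borel"
    using assms by (auto simp: sm_def)
qed

definition sm_add :: "smeasure \<Rightarrow> smeasure \<Rightarrow> smeasure" where
  "sm_add \<mu> \<nu> = (sum_measure (fst \<mu>) (fst \<nu>), sum_measure (snd \<mu>) (snd \<nu>))"

lemma sm_sm_add: "sm a b \<mu> \<Longrightarrow> sm a b \<nu> \<Longrightarrow> sm a b (sm_add \<mu> \<nu>)"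
  by (auto simp: sm_def sm_add_def emeasure_sum_measure intro!: finite_measure_sum_measure)

lemma sm_val_sm_add:
  "sm a b \<mu> \<Longrightarrow> sm a b \<nu> \<Longrightarrow> A \<in> sets borel \<Longrightarrow> sm_val (sm_add \<mu> \<nu>) A = sm_val \<mu> A + sm_val \<nu> A"
  by (auto simp: sm_def sm_val_def sm_add_def measure_sum_measure)

lemma integrable_finite_borel_bounded:
  fixes \<phi> :: "real \<Rightarrow> real"
  assumes "finite_borel_measure M" "\<phi> \<in> borel_measurable borel" "\<And>x. \<bar>\<phi> x\<bar> \<le> B"
  shows "integrable M \<phi>"
proof -
  interpret finite_borel_measure M by fact
  show ?thesis
    using assms(2,3) M_is_borel
    by (intro integrable_const_bound[where B=B]) (auto cong: measurable_cong_sets)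
qed

lemma sm_int_sm_add:
  assumes "sm a b \<mu>" "sm a b \<nu>" "\<phi> \<in> borel_measurable borel" "\<And>x. \<bar>\<phi> x\<bar> \<le> B"
  shows "sm_int (sm_add \<mu> \<nu>) \<phi> = sm_int \<mu> \<phi> + sm_int \<nu> \<phi>"
  using smD[OF assms(1)] smD[OF assms(2)] integrable_finite_borel_bounded[OF _ assms(3,4)]
  by (simp add: sm_int_def sm_add_def integral_sum_measure)

lemma sm_val_inter:
  assumes "sm a b \<mu>" "A \<in> sets borel"
  shows "sm_val \<mu> (A \<inter> {a<..<b}) = sm_val \<mu> A"
proof -
  have "measure (fst \<mu>) (A \<inter> {a<..<b}) = measure (fst \<mu>) A"
    using smD[OF assms(1)] assms(2) by (intro measure_eq_AE) auto
  moreover have "measure (snd \<mu>) (A \<inter> {a<..<b}) = measure (snd \<mu>) A"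
    using smD[OF assms(1)] assms(2) by (intro measure_eq_AE) auto
  ultimately show ?thesis by (simp add: sm_val_def)
qed

lemma sm_eq_val:
  assumes "sm a b \<mu>" "sm a b \<nu>" "sm_eq a b \<mu> \<nu>" "A \<in> sets borel"
  shows "sm_val \<mu> A = sm_val \<nu> A"
  using sm_val_inter[OF assms(1,4)] sm_val_inter[OF assms(2,4)] assms(3,4)
  by (auto simp: sm_eq_def)

text \<open>A signed measure has many representing pairs, so equality of values has to be
  transferred to integrals. Moving the negative parts across turns \<open>P - N = P' - N'\<close>
  into \<open>P + N' = P' + N\<close>, an equality of finite positive measures. Values on subsets of
  \<open>{a<..<b}\<close> suffice because all four measures are concentrated there.\<close>

lemma sm_int_cong:
  assumes "sm a b \<mu>" "sm a b \<nu>" "sm_eq a b \<mu> \<nu>" "\<phi> \<in> borel_measurable borel" "\<And>x. \<bar>\<phi> x\<bar> \<le> B"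
  shows "sm_int \<mu> \<phi> = sm_int \<nu> \<phi>"
proof -
  note \<mu> = smD[OF assms(1)] and \<nu> = smD[OF assms(2)]
  interpret a: finite_borel_measure "fst \<mu>" by fact
  interpret b: finite_borel_measure "snd \<mu>" by fact
  interpret c: finite_borel_measure "fst \<nu>" by fact
  interpret d: finite_borel_measure "snd \<nu>" by fact
  have "sum_measure (fst \<mu>) (snd \<nu>) = sum_measure (fst \<nu>) (snd \<mu>)"
  proof (rule measure_eqI)
    fix A assume "A \<in> sets (sum_measure (fst \<mu>) (snd \<nu>))"
    then have A: "A \<in> sets borel" using \<mu> by simp
    from sm_eq_val[OF assms(1-3) A]
    have "measure (fst \<mu>) A + measure (snd \<nu>) A = measure (fst \<nu>) A + measure (snd \<mu>) A"
      by (simp add: sm_val_def)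
    then show "emeasure (sum_measure (fst \<mu>) (snd \<nu>)) A = emeasure (sum_measure (fst \<nu>) (snd \<mu>)) A"
      using \<mu> \<nu> A
      by (simp add: emeasure_sum_measure a.emeasure_eq_measure b.emeasure_eq_measure
          c.emeasure_eq_measure d.emeasure_eq_measure flip: ennreal_plus)
  qed (use \<mu> \<nu> in simp)
  then have "integral\<^sup>L (fst \<mu>) \<phi> + integral\<^sup>L (snd \<nu>) \<phi> = integral\<^sup>L (fst \<nu>) \<phi> + integral\<^sup>L (snd \<mu>) \<phi>"
    using \<mu> \<nu> integrable_finite_borel_bounded[OF _ assms(4,5)]
    by (simp flip: integral_sum_measure)
  then show ?thesis by (simp add: sm_int_def)
qed

text \<open>\<open>ennreal\<close> sends negative reals to 0, so the density is really the positive
  part of \<open>g\<close>. Applied to \<open>g\<close> and to \<open>- g\<close> this describes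
  both components of \<open>ac_sm\<close>.\<close>

lemma set_integrable_density:
  fixes g :: "real \<Rightarrow> real"
  assumes g: "set_integrable lborel {a<..<b} g"
  defines "M \<equiv> density lborel (\<lambda>x. ennreal (g x) * indicator {a<..<b} x)"
  shows "sets M = sets borel" "finite_measure M" "emeasure M (UNIV - {a<..<b}) = 0"
    and "\<phi> \<in> borel_measurable borel \<Longrightarrow> integral\<^sup>L M \<phi> = (LINT x:{a<..<b}|lborel. max 0 (g x) * \<phi> x)"
proof -
  define k where "k x = indicator {a<..<b} x * max 0 (g x)" for x
  have gm [measurable]: "(\<lambda>x. indicator {a<..<b} x * g x) \<in> borel_measurable borel"
    using g by (auto simp: set_integrable_def)
  have "k = (\<lambda>x. max 0 (indicator {a<..<b} x * g x))"
    by (auto simp: k_def indicator_def fun_eq_iff)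
  then have km [measurable]: "k \<in> borel_measurable borel" and ki: "integrable lborel k"
    using g by (auto simp: set_integrable_def)
  have M: "M = density lborel (\<lambda>x. ennreal (k x))"
    unfolding M_def by (intro arg_cong[where f="density lborel"] ext)
      (auto simp: k_def indicator_def ennreal_neg max_def)
  have k0: "k x \<ge> 0" for x by (simp add: k_def)
  show "sets M = sets borel" by (simp add: M)
  show "finite_measure M"
  proof
    have "emeasure M (space M) = (\<integral>\<^sup>+x. ennreal (k x) \<partial>lborel)"
      by (simp add: M emeasure_density)
    also have "\<dots> < \<infinity>"
      using ki k0 by (simp add: real_integrable_def less_top[symmetric])
    finally show "emeasure M (space M) \<noteq> \<infinity>" by simp
  qed
  have "(\<lambda>x. ennreal (k x) * indicator (UNIV - {a<..<b}) x) = (\<lambda>x. 0)"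
    by (auto simp: k_def fun_eq_iff indicator_def)
  then show "emeasure M (UNIV - {a<..<b}) = 0"
    by (simp add: M emeasure_density)
  assume [measurable]: "\<phi> \<in> borel_measurable borel"
  show "integral\<^sup>L M \<phi> = (LINT x:{a<..<b}|lborel. max 0 (g x) * \<phi> x)"
    by (simp add: M integral_density k0 set_lebesgue_integral_def)
      (simp add: k_def mult.assoc)
qed

lemma sm_ac_sm:
  assumes "set_integrable lborel {a<..<b} g"
  shows "sm a b (ac_sm a b g)"
  using set_integrable_density[OF assms] set_integrable_density[of a b "\<lambda>x. - g x"] assms
  by (auto simp: sm_def ac_sm_def set_integrable_def)

lemma set_integrable_mult_bounded:
  fixes g \<phi> :: "real \<Rightarrow> real"
  assumes "set_integrable lborel A g" "\<phi> \<in> borel_measurable borel" "\<And>x. \<bar>\<phi> x\<bar> \<le> B"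
  shows "set_integrable lborel A (\<lambda>x. g x * \<phi> x)"
proof -
  have "integrable lborel (\<lambda>x. (indicator A x * g x) * \<phi> x)"
  proof (rule Bochner_Integration.integrable_bound)
    show "integrable lborel (\<lambda>x. B * (indicator A x * g x))"
      using assms(1) by (simp add: set_integrable_def)
    show "(\<lambda>x. indicator A x * g x * \<phi> x) \<in> borel_measurable lborel"
      using assms(1,2) by (auto simp: set_integrable_def)
    show "AE x in lborel. norm (indicator A x * g x * \<phi> x) \<le> norm (B * (indicator A x * g x))"
    proof (rule AE_I2)
      fix x
      have "\<bar>indicator A x * g x\<bar> * \<bar>\<phi> x\<bar> \<le> \<bar>indicator A x * g x\<bar> * \<bar>B\<bar>"
        using assms(3)[of x] by (intro mult_left_mono) auto
      then show "norm (indicator A x * g x * \<phi> x) \<le> norm (B * (indicator A x * g x))"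
        by (simp add: abs_mult ac_simps)
    qed
  qed
  then show ?thesis by (simp add: set_integrable_def mult.assoc)
qed

lemma sm_int_ac_sm:
  fixes g \<phi> :: "real \<Rightarrow> real"
  assumes g: "set_integrable lborel {a<..<b} g"
    and \<phi>: "\<phi> \<in> borel_measurable borel" "\<And>x. \<bar>\<phi> x\<bar> \<le> B"
  shows "sm_int (ac_sm a b g) \<phi> = (LINT x:{a<..<b}|lborel. g x * \<phi> x)"
proof -
  have g': "set_integrable lborel {a<..<b} (\<lambda>x. - g x)"
    using g by (simp add: set_integrable_def)
  have mx: "set_integrable lborel {a<..<b} (\<lambda>x. max 0 (k x))"
    if "set_integrable lborel {a<..<b} k" for k :: "real \<Rightarrow> real"
  proof -
    have "(\<lambda>x. indicator {a<..<b} x *\<^sub>R max 0 (k x)) = (\<lambda>x. max 0 (indicator {a<..<b} x *\<^sub>R k x))"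
      by (auto simp: fun_eq_iff indicator_def)
    then show ?thesis using that by (simp add: set_integrable_def)
  qed
  have "sm_int (ac_sm a b g) \<phi> = (LINT x:{a<..<b}|lborel. max 0 (g x) * \<phi> x) -
      (LINT x:{a<..<b}|lborel. max 0 (- g x) * \<phi> x)"
    by (simp add: sm_int_def ac_sm_def set_integrable_density(4)[OF g \<phi>(1)]
        set_integrable_density(4)[OF g' \<phi>(1)])
  also have "\<dots> = (LINT x:{a<..<b}|lborel. max 0 (g x) * \<phi> x - max 0 (- g x) * \<phi> x)"
    using set_integrable_mult_bounded[OF mx[OF g] \<phi>] set_integrable_mult_bounded[OF mx[OF g'] \<phi>]
    by (simp add: set_integral_diff)
  also have "\<dots> = (LINT x:{a<..<b}|lborel. g x * \<phi> x)"
    by (intro set_lebesgue_integral_cong) (auto simp: max_def)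
  finally show ?thesis .
qed

lemma sm_int_indicator:
  assumes "sm a b \<mu>" "A \<in> sets borel"
  shows "sm_int \<mu> (indicator A) = sm_val \<mu> A"
  using smD[OF assms(1)] assms(2)
  by (simp add: sm_int_def sm_val_def finite_borel_measure.borel_UNIV)

lemma sm_val_ac_sm:
  fixes g :: "real \<Rightarrow> real"
  assumes g: "set_integrable lborel {a<..<b} g" and A: "A \<in> sets borel" "A \<subseteq> {a<..<b}"
  shows "sm_val (ac_sm a b g) A = (LINT x:A|lborel. g x)"
proof -
  have "sm_val (ac_sm a b g) A = (LINT x:{a<..<b}|lborel. g x * indicator A x)"
    using sm_int_indicator[OF sm_ac_sm[OF g] A(1)]
      sm_int_ac_sm[OF g, of "indicator A" 1] A(1) by (simp add: indicator_def)
  also have "\<dots> = (LINT x:A|lborel. g x)"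
    unfolding set_lebesgue_integral_def using A(2)
    by (intro Bochner_Integration.integral_cong) (auto simp: indicator_def)
  finally show ?thesis .
qed

section \<open>Density of test functions\<close>

text \<open>An intermediate class on the way to continuously differentiable test functions. It is
  stable under composition with Lipschitz maps that fix 0, in particular under clipping at a bound,
  which would destroy differentiability. Approximations are built in this class and smoothed only at
  the end.\<close>

definition lip_test :: "real \<Rightarrow> real \<Rightarrow> (real \<Rightarrow> real) \<Rightarrow> bool" where
  "lip_test a b \<phi> \<longleftrightarrow> (\<exists>L. L-lipschitz_on UNIV \<phi>) \<and>
     (\<exists>c d. a < c \<and> c \<le> d \<and> d < b \<and> (\<forall>x. x \<notin> {c..d} \<longrightarrow> \<phi> x = 0))"

lemma lip_test_zero: "a < b \<Longrightarrow> lip_test a b (\<lambda>x. 0)"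
  unfolding lip_test_def
  using lipschitz_on_constant[of UNIV "0::real"] dense[of a b] by blast

lemma lip_test_add:
  assumes "lip_test a b f" "lip_test a b g"
  shows "lip_test a b (\<lambda>x. f x + g x)"
proof -
  obtain L1 c1 d1 where 1: "L1-lipschitz_on UNIV f" "a < c1" "c1 \<le> d1" "d1 < b"
    "\<And>x. x \<notin> {c1..d1} \<Longrightarrow> f x = 0" using assms(1) unfolding lip_test_def by blast
  obtain L2 c2 d2 where 2: "L2-lipschitz_on UNIV g" "a < c2" "c2 \<le> d2" "d2 < b"
    "\<And>x. x \<notin> {c2..d2} \<Longrightarrow> g x = 0" using assms(2) unfolding lip_test_def by blast
  have "f x + g x = 0" if "x \<notin> {min c1 c2..max d1 d2}" for x
    using that 1(5)[of x] 2(5)[of x] by (auto simp: min_def max_def split: if_splits)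
  moreover have "(L1 + L2)-lipschitz_on UNIV (\<lambda>x. f x + g x)"
    using 1(1) 2(1) by (rule lipschitz_on_add)
  moreover have "a < min c1 c2" "min c1 c2 \<le> max d1 d2" "max d1 d2 < b"
    using 1 2 by auto
  ultimately show ?thesis
    unfolding lip_test_def by blast
qed

lemma lip_test_comp:
  assumes "lip_test a b f" "C-lipschitz_on UNIV r" "r 0 = 0"
  shows "lip_test a b (\<lambda>x. r (f x))"
proof -
  obtain L where "L-lipschitz_on UNIV f" using assms(1) unfolding lip_test_def by blast
  then have "(C * L)-lipschitz_on UNIV (\<lambda>x. r (f x))"
    using assms(2) by (intro lipschitz_on_compose2) (auto intro: lipschitz_on_subset)
  then show ?thesis using assms(1,3) unfolding lip_test_def by metis
qed

lemma lip_test_bounded: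
  assumes "lip_test a b f"
  obtains B where "0 \<le> B" "\<And>x. \<bar>f x\<bar> \<le> B"
proof -
  obtain L c d where 1: "L-lipschitz_on UNIV f" "a < c" "c \<le> d" "d < b"
    "\<And>x. x \<notin> {c..d} \<Longrightarrow> f x = 0" using assms(1) unfolding lip_test_def by blast
  have L: "0 \<le> L" using 1(1) by (rule lipschitz_on_nonneg)
  have "\<bar>f x\<bar> \<le> L * (d - c + 1)" for x
  proof (cases "x \<in> {c..d}")
    case True
    \<comment> \<open>The point \<open>d + 1\<close> lies outside the support and within distance
      \<open>d - c + 1\<close> of every point of \<open>{c..d}\<close>.\<close>
    have "dist (f x) (f (d+1)) \<le> L * dist x (d+1)" using 1(1) by (rule lipschitz_onD) auto
    also have "\<dots> \<le> L * (d - c + 1)" using True L by (intro mult_left_mono) (auto simp: dist_real_def)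
    finally show ?thesis using 1(5)[of "d+1"] by (simp add: dist_real_def)
  qed (use 1 L in simp)
  then show ?thesis using L 1(3) by (intro that[of "L * (d - c + 1)"]) auto
qed

lemma lip_test_borel: "lip_test a b f \<Longrightarrow> f \<in> borel_measurable borel"
  unfolding lip_test_def
  by (elim conjE exE) (intro borel_measurable_continuous_onI lipschitz_on_continuous_on)

lemma lip_test_integrable:
  assumes "finite_borel_measure M" "lip_test a b f"
  shows "integrable M f"
proof -
  obtain B where "\<And>x. \<bar>f x\<bar> \<le> B" using lip_test_bounded[OF assms(2)] by blast
  then show ?thesis by (rule integrable_finite_borel_bounded[OF assms(1) lip_test_borel[OF assms(2)]])
qed

text \<open>The functions \<open>max 0 (1 - n * infdist x K)\<close> converge pointwise to the
  indicator because \<open>K\<close> is closed, and dominated convergence applies because they are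
  bounded by 1. They vanish at distance \<open>1 / n\<close> from \<open>K\<close>, so their
  supports stay in a fixed compact subinterval once \<open>1 / n\<close> is at most half of the
  distance \<open>m\<close> from \<open>K\<close> to the end points.\<close>

lemma lip_test_compact_indicator:
  assumes M: "finite_borel_measure M" and "a < b"
    and K: "compact K" "K \<subseteq> {a<..<b}" and "0 < \<delta>"
  shows "\<exists>\<phi>. lip_test a b \<phi> \<and> (\<integral>x. \<bar>\<phi> x - indicator K x\<bar> \<partial>M) < \<delta>"
proof (cases "K = {}")
  case True
  then show ?thesis using lip_test_zero[OF \<open>a < b\<close>] \<open>0 < \<delta>\<close>
    by (intro exI[of _ "\<lambda>x. 0"]) auto
next
  case False
  interpret finite_borel_measure M by fact
  note [measurable_cong] = M_is_borel
  have cK: "closed K" using K(1) by (rule compact_imp_closed)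
  then have [measurable]: "K \<in> sets borel" by simp
  obtain p where p: "p \<in> K" "\<And>x. x \<in> K \<Longrightarrow> p \<le> x"
    using compact_attains_inf[OF K(1) False] by blast
  obtain q where q: "q \<in> K" "\<And>x. x \<in> K \<Longrightarrow> x \<le> q"
    using compact_attains_sup[OF K(1) False] by blast
  define F where "F n x = max 0 (1 - real n * infdist x K)" for n x
  have lip: "(real n)-lipschitz_on UNIV (F n)" for n
  proof (rule lipschitz_onI)
    fix x y
    have "dist (F n x) (F n y) \<le> \<bar>real n * infdist x K - real n * infdist y K\<bar>"
      by (auto simp: F_def dist_real_def)
    also have "\<dots> = real n * \<bar>infdist x K - infdist y K\<bar>"
      by (simp add: abs_mult flip: right_diff_distrib)
    also have "\<dots> \<le> real n * dist x y"
      by (intro mult_left_mono infdist_triangle_abs) auto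
    finally show "dist (F n x) (F n y) \<le> real n * dist x y" .
  qed simp
  have Fm [measurable]: "F n \<in> borel_measurable borel" for n
    by (rule borel_measurable_continuous_onI lipschitz_on_continuous_on lip)+
  have F01: "0 \<le> F n x" "F n x \<le> 1" for n x
    by (auto simp: F_def infdist_nonneg)
  have F01': "\<bar>F n x - indicator K x\<bar> \<le> 1" for n x
    using F01[of n x] by (simp add: indicator_def)
  have "(\<lambda>n. F n x) \<longlonglongrightarrow> indicator K x" for x
  proof (cases "x \<in> K")
    case True
    then show ?thesis by (simp add: F_def)
  next
    case F: False
    then have pos: "infdist x K > 0"
      using in_closed_iff_infdist_zero[OF cK False] infdist_nonneg[of x K] by fastforce
    have "\<forall>\<^sub>F n in sequentially. 1 / infdist x K < real n"
      using eventually_gt_at_top filterlim_real_sequentially by (auto simp: filterlim_at_top_dense)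
    then have "\<forall>\<^sub>F n in sequentially. F n x = 0"
      by eventually_elim (use pos in \<open>auto simp: F_def field_simps\<close>)
    then show ?thesis using F by (simp add: tendsto_eventually)
  qed
  then have lim: "(\<lambda>n. \<integral>x. \<bar>F n x - indicator K x\<bar> \<partial>M) \<longlonglongrightarrow> (\<integral>x. \<bar>indicator K x - indicator K x :: real\<bar> \<partial>M)"
    using F01'
    by (intro integral_dominated_convergence[where w="\<lambda>x. 1"] AE_I2 tendsto_intros) simp_all
  then have "\<forall>\<^sub>F n in sequentially. (\<integral>x. \<bar>F n x - indicator K x\<bar> \<partial>M) < \<delta>"
    using \<open>0 < \<delta>\<close> by (intro order_tendstoD(2)[OF lim]) simp
  moreover have "\<forall>\<^sub>F n in sequentially. 2 / min (p - a) (b - q) < real n"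
    using eventually_gt_at_top filterlim_real_sequentially by (auto simp: filterlim_at_top_dense)
  ultimately have "\<forall>\<^sub>F n in sequentially. (\<integral>x. \<bar>F n x - indicator K x\<bar> \<partial>M) < \<delta> \<and> 2 / min (p - a) (b - q) < real n"
    by (rule eventually_conj)
  then obtain n where n: "(\<integral>x. \<bar>F n x - indicator K x\<bar> \<partial>M) < \<delta>" "2 / min (p - a) (b - q) < real n"
    using eventually_happens'[OF sequentially_bot] by blast
  define m where "m = min (p - a) (b - q)"
  have m: "0 < m" using K(2) p q by (auto simp: m_def)
  have n0: "real n > 0" using n(2) m unfolding m_def[symmetric] by (smt (verit) divide_pos_pos)
  have nm: "1 / real n \<le> m / 2" using n(2) m n0 unfolding m_def[symmetric] by (simp add: field_simps)
  have "F n x = 0" if "x \<notin> {p - m/2..q + m/2}" for x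
  proof -
    obtain y where y: "y \<in> K" "infdist x K = dist x y"
      using infdist_attains_inf[OF cK False] by blast
    have "m / 2 \<le> infdist x K" using that p(2)[OF y(1)] q(2)[OF y(1)] unfolding y(2) dist_real_def by (simp add: abs_if) linarith
    then have "1 / real n \<le> infdist x K" using nm by simp
    then show ?thesis using n0 by (auto simp: F_def field_simps)
  qed
  moreover have "a < p - m/2" "q + m/2 < b" "p - m/2 \<le> q + m/2"
    using m p(2)[OF q(1)] by (auto simp: m_def min_def field_simps)
  ultimately have "lip_test a b (F n)"
    unfolding lip_test_def using lip by blast
  then show ?thesis using n(1) by blast
qed

lemma lip_test_dense:
  assumes M: "finite_borel_measure M" and "a < b" and AE: "AE x in M. x \<in> {a<..<b}"
    and f: "integrable M f" and "0 < \<delta>"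
  shows "\<exists>\<phi>. lip_test a b \<phi> \<and> (\<integral>x. \<bar>\<phi> x - f x\<bar> \<partial>M) < \<delta>"
proof -
  interpret finite_borel_measure M by fact
  note [measurable_cong] = M_is_borel
  note int = lip_test_integrable[OF M]
  \<comment> \<open>Quantifying over \<open>\<delta>\<close> inside the induction lets the cases of
    sums and limits use their hypotheses at half the error.\<close>
  from f have "\<forall>\<delta>>0. \<exists>\<phi>. lip_test a b \<phi> \<and> (\<integral>x. \<bar>\<phi> x - f x\<bar> \<partial>M) < \<delta>"
  proof induction
    case (base A c)
    show ?case
    proof safe
      fix \<delta> :: real assume "0 < \<delta>"
      have A [measurable]: "A \<in> sets borel" using base M_is_borel by simp
      \<comment> \<open>One \<open>e\<close> is for replacing \<open>A'\<close> by a compact subset,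
        the other for replacing that subset by a Lipschitz function. The summand 1 in the
        denominator covers \<open>c = 0\<close>.\<close>
      define e where "e = \<delta> / (2 * (\<bar>c\<bar> + 1))"
      have e: "0 < e" "\<bar>c\<bar> * (2 * e) < \<delta>"
        using \<open>0 < \<delta>\<close> by (auto simp: e_def field_simps)
      define A' where "A' = A \<inter> {a<..<b}"
      have A' [measurable]: "A' \<in> sets borel" by (simp add: A'_def)
      have "\<exists>K. K \<subseteq> A' \<and> compact K \<and> measure M A' - e < measure M K"
      proof (rule ccontr)
        assume "\<nexists>K. K \<subseteq> A' \<and> compact K \<and> measure M A' - e < measure M K"
        then have le: "measure M K \<le> measure M A' - e" if "K \<subseteq> A'" "compact K" for K
          using that by force
        have "emeasure M A' = (SUP K \<in> {K. K \<subseteq> A' \<and> compact K}. emeasure M K)"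
          by (rule inner_regular) (use M_is_borel A' in \<open>auto simp: emeasure_eq_measure\<close>)
        also have "\<dots> \<le> ennreal (measure M A' - e)"
          by (intro SUP_least) (use le in \<open>auto simp: emeasure_eq_measure intro!: ennreal_leI\<close>)
        \<comment> \<open>If \<open>measure M A' - e\<close> is negative, \<open>ennreal\<close>
          turns it into 0 and only the second alternative follows. The compact set \<open>{}\<close>
          excludes it, since it forces \<open>e \<le> measure M A'\<close>.\<close>
        finally have "measure M A' \<le> measure M A' - e \<or> measure M A' \<le> 0"
          by (auto simp: emeasure_eq_measure ennreal_le_iff2)
        then show False using e(1) le[of "{}"] measure_nonneg[of M A'] by auto
      qed
      then obtain K where K: "K \<subseteq> A'" "compact K" "measure M A' - e < measure M K" by blast
      have Km [measurable]: "K \<in> sets borel" using K(2) by (simp add: compact_imp_closed)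
      obtain \<phi> where \<phi>: "lip_test a b \<phi>" "(\<integral>x. \<bar>\<phi> x - indicator K x\<bar> \<partial>M) < e"
        using lip_test_compact_indicator[OF M \<open>a < b\<close> K(2) _ e(1)] K(1) by (auto simp: A'_def)
      have \<phi>i [simp]: "integrable M \<phi>" using \<phi>(1) by (rule int)
      have [simp]: "integrable M (indicator S :: real \<Rightarrow> real)" if "S \<in> sets borel" for S
        using that M_is_borel by (simp add: integrable_indicator_iff emeasure_eq_measure)
      have "(\<integral>x. \<bar>c * \<phi> x - indicator A x *\<^sub>R c\<bar> \<partial>M) = (\<integral>x. \<bar>c\<bar> * \<bar>\<phi> x - indicator A' x\<bar> \<partial>M)"
      proof (rule integral_cong_AE)
        show "AE x in M. \<bar>c * \<phi> x - indicator A x *\<^sub>R c\<bar> = \<bar>c\<bar> * \<bar>\<phi> x - indicator A' x\<bar>"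
          using AE by eventually_elim
            (simp add: A'_def indicator_def abs_mult right_diff_distrib flip: abs_mult)
      qed (use \<phi>i in measurable)
      also have "\<dots> = \<bar>c\<bar> * (\<integral>x. \<bar>\<phi> x - indicator A' x\<bar> \<partial>M)" by simp
      also have "(\<integral>x. \<bar>\<phi> x - indicator A' x\<bar> \<partial>M) \<le> (\<integral>x. \<bar>\<phi> x - indicator K x\<bar> + (indicator A' x - indicator K x) \<partial>M)"
      proof (rule integral_mono)
        show "\<bar>\<phi> x - indicator A' x\<bar> \<le> \<bar>\<phi> x - indicator K x\<bar> + (indicator A' x - indicator K x)" for x
          using K(1) by (auto simp: indicator_def)
      qed simp_all
      also have "\<dots> = (\<integral>x. \<bar>\<phi> x - indicator K x\<bar> \<partial>M) + (measure M A' - measure M K)"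
        by (simp add: borel_UNIV)
      also have "\<dots> \<le> 2 * e" using K(3) \<phi>(2) by simp
      finally have "(\<integral>x. \<bar>c * \<phi> x - indicator A x *\<^sub>R c\<bar> \<partial>M) \<le> \<bar>c\<bar> * (2 * e)"
        by (simp add: mult_left_mono)
      then show "\<exists>\<phi>. lip_test a b \<phi> \<and> (\<integral>x. \<bar>\<phi> x - indicator A x *\<^sub>R c\<bar> \<partial>M) < \<delta>"
        using e(2) lip_test_comp[OF \<phi>(1) lipschitz_on_cmult_real[OF lipschitz_on_id], of c]
        by (intro exI[of _ "\<lambda>x. c * \<phi> x"]) simp
    qed
  next
    case (add f g)
    show ?case
    proof safe
      fix \<delta> :: real assume "0 < \<delta>"
      then obtain \<phi> \<psi> where \<phi>: "lip_test a b \<phi>" "(\<integral>x. \<bar>\<phi> x - f x\<bar> \<partial>M) < \<delta>/2"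
          and \<psi>: "lip_test a b \<psi>" "(\<integral>x. \<bar>\<psi> x - g x\<bar> \<partial>M) < \<delta>/2"
        using add.IH by (metis half_gt_zero)
      have i: "integrable M \<phi>" "integrable M \<psi>" using \<phi> \<psi> int by auto
      have "(\<integral>x. \<bar>(\<phi> x + \<psi> x) - (f x + g x)\<bar> \<partial>M) \<le> (\<integral>x. \<bar>\<phi> x - f x\<bar> + \<bar>\<psi> x - g x\<bar> \<partial>M)"
        using i add.hyps by (intro integral_mono) auto
      also have "\<dots> = (\<integral>x. \<bar>\<phi> x - f x\<bar> \<partial>M) + (\<integral>x. \<bar>\<psi> x - g x\<bar> \<partial>M)"
        using i add.hyps by (intro Bochner_Integration.integral_add) auto
      also have "\<dots> < \<delta>" using \<phi> \<psi> by simp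
      finally show "\<exists>\<phi>. lip_test a b \<phi> \<and> (\<integral>x. \<bar>\<phi> x - (f x + g x)\<bar> \<partial>M) < \<delta>"
        using lip_test_add[OF \<phi>(1) \<psi>(1)] by blast
    qed
  next
    case (lim f s)
    note si = lim.hyps(1) and fi = \<open>integrable M f\<close>
    have "(\<lambda>i. \<integral>x. \<bar>s i x - f x\<bar> \<partial>M) \<longlonglongrightarrow> (\<integral>x. \<bar>f x - f x\<bar> \<partial>M)"
    proof (rule integral_dominated_convergence[where w="\<lambda>x. 3 * \<bar>f x\<bar>"])
      show "AE x in M. (\<lambda>i. \<bar>s i x - f x\<bar>) \<longlonglongrightarrow> \<bar>f x - f x\<bar>"
        using lim.hyps(2) by (intro AE_I2 tendsto_intros) auto
      show "AE x in M. norm \<bar>s i x - f x\<bar> \<le> 3 * \<bar>f x\<bar>" for i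
      proof (rule AE_I2)
        fix x assume "x \<in> space M"
        from lim.hyps(3)[OF this, of i] show "norm \<bar>s i x - f x\<bar> \<le> 3 * \<bar>f x\<bar>" by auto
      qed
    qed (use si fi in auto)
    then have l0: "(\<lambda>i. \<integral>x. \<bar>s i x - f x\<bar> \<partial>M) \<longlonglongrightarrow> 0" by simp
    show ?case
    proof safe
      fix \<delta> :: real assume "0 < \<delta>"
      then have "\<forall>\<^sub>F i in sequentially. (\<integral>x. \<bar>s i x - f x\<bar> \<partial>M) < \<delta>/2"
        by (intro order_tendstoD(2)[OF l0]) simp
      then obtain i where i: "(\<integral>x. \<bar>s i x - f x\<bar> \<partial>M) < \<delta>/2"
        using eventually_happens'[OF sequentially_bot] by blast
      obtain \<phi> where \<phi>: "lip_test a b \<phi>" "(\<integral>x. \<bar>\<phi> x - s i x\<bar> \<partial>M) < \<delta>/2"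
        using lim.IH \<open>0 < \<delta>\<close> by (metis half_gt_zero)
      have \<phi>i: "integrable M \<phi>" using \<phi> int by auto
      have "(\<integral>x. \<bar>\<phi> x - f x\<bar> \<partial>M) \<le> (\<integral>x. \<bar>\<phi> x - s i x\<bar> + \<bar>s i x - f x\<bar> \<partial>M)"
        using \<phi>i si fi by (intro integral_mono) auto
      also have "\<dots> = (\<integral>x. \<bar>\<phi> x - s i x\<bar> \<partial>M) + (\<integral>x. \<bar>s i x - f x\<bar> \<partial>M)"
        using \<phi>i si fi by (intro Bochner_Integration.integral_add) auto
      also have "\<dots> < \<delta>" using \<phi> i by simp
      finally show "\<exists>\<phi>. lip_test a b \<phi> \<and> (\<integral>x. \<bar>\<phi> x - f x\<bar> \<partial>M) < \<delta>"
        using \<phi>(1) by blast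
    qed
  qed
  then show ?thesis using \<open>0 < \<delta>\<close> by blast
qed

section \<open>Smoothing to continuously differentiable test functions\<close>

lemma antiderivative_exists:
  fixes f :: "real \<Rightarrow> real"
  assumes "continuous_on UNIV f"
  shows "\<exists>F. \<forall>x. (F has_real_derivative f x) (at x)"
  using einterval_antiderivative[of "-\<infinity>" "\<infinity>" f] assms
  by (auto simp: has_real_derivative_iff_has_vector_derivative continuous_on_eq_continuous_at)

text \<open>The sliding average over \<open>{x..x+r}\<close> is a difference quotient of an
  antiderivative, hence continuously differentiable. By the mean value theorem it takes a value of
  \<open>\<phi>\<close> at a point within distance \<open>r\<close>, which preserves the bound
  \<open>B\<close> and gives an error of at most \<open>L * r\<close>.\<close>

lemma lip_test_mollify:
  assumes \<phi>: "lip_test a b \<phi>" "\<And>x. \<bar>\<phi> x\<bar> \<le> B" and "0 < e"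
  shows "\<exists>\<psi> \<psi>'. testfun a b \<psi> \<psi>' \<and> (\<forall>x. \<bar>\<psi> x\<bar> \<le> B) \<and> (\<forall>x. \<bar>\<psi> x - \<phi> x\<bar> \<le> e)"
proof -
  obtain L c d where 1: "L-lipschitz_on UNIV \<phi>" "a < c" "c \<le> d" "d < b"
    "\<And>x. x \<notin> {c..d} \<Longrightarrow> \<phi> x = 0" using \<phi>(1) unfolding lip_test_def by blast
  have L: "0 \<le> L" using 1(1) by (rule lipschitz_on_nonneg)
  have cont: "continuous_on UNIV \<phi>" using 1(1) by (rule lipschitz_on_continuous_on)
  obtain F where F: "\<And>x. (F has_real_derivative \<phi> x) (at x)"
    using antiderivative_exists[OF cont] by blast
  \<comment> \<open>The average looks only to the right, so the support grows only on the left; half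
    of the gap \<open>c - a\<close> leaves it inside the interval.\<close>
  define r where "r = min ((c - a) / 2) (e / (L + 1))"
  have r: "0 < r" "r \<le> (c - a) / 2" "L * r \<le> e"
  proof -
    show "0 < r" using 1(2) L \<open>0 < e\<close> by (auto simp: r_def)
    show "r \<le> (c - a) / 2" unfolding r_def by (rule min.cobounded1)
    have "L * r \<le> L * (e / (L + 1))" using L by (intro mult_left_mono) (auto simp: r_def)
    also have "\<dots> \<le> e" using L \<open>0 < e\<close> by (simp add: field_simps)
    finally show "L * r \<le> e" .
  qed
  define \<psi> where "\<psi> x = (F (x + r) - F x) / r" for x
  define \<psi>' where "\<psi>' x = (\<phi> (x + r) - \<phi> x) / r" for x
  have mv: "\<exists>z. x < z \<and> z < x + r \<and> \<psi> x = \<phi> z" for x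
    using MVT2[of x "x+r" F \<phi>] F r(1) by (fastforce simp: \<psi>_def)
  have "\<psi> x = 0" if "x \<notin> {c - r..d}" for x
  proof -
    obtain z where "x < z" "z < x + r" "\<psi> x = \<phi> z" using mv by blast
    then show ?thesis using that 1(5)[of z] by auto
  qed
  moreover have "a < c - r" "c - r \<le> d" using 1 r by (auto simp: field_simps)
  ultimately have supp: "\<exists>c d. a < c \<and> c \<le> d \<and> d < b \<and> (\<forall>x. x \<notin> {c..d} \<longrightarrow> \<psi> x = 0)"
    using 1(4) by blast
  have "testfun a b \<psi> \<psi>'"
    unfolding testfun_def
  proof (intro conjI allI supp)
    have "((\<lambda>x. F (x + r)) has_real_derivative \<phi> (x + r)) (at x)" for x
      using DERIV_shift[of F "\<phi> (x + r)" x r] F by simp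
    then show "(\<psi> has_real_derivative \<psi>' x) (at x)" for x
      unfolding \<psi>_def \<psi>'_def using F r(1) by (auto intro!: derivative_eq_intros)
    show "continuous_on UNIV \<psi>'" unfolding \<psi>'_def
      using r(1) by (intro continuous_intros continuous_on_compose2[OF cont]) auto
  qed
  moreover have "\<bar>\<psi> x\<bar> \<le> B" for x using mv[of x] \<phi>(2) by metis
  moreover have "\<bar>\<psi> x - \<phi> x\<bar> \<le> e" for x
  proof -
    obtain z where z: "x < z" "z < x + r" "\<psi> x = \<phi> z" using mv by blast
    have "dist (\<phi> z) (\<phi> x) \<le> L * dist z x" using 1(1) by (rule lipschitz_onD) auto
    also have "\<dots> \<le> L * r" using z L by (intro mult_left_mono) (auto simp: dist_real_def)
    finally show ?thesis using z r(3) by (simp add: dist_real_def)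
  qed
  ultimately show ?thesis by blast
qed

text \<open>The approximation keeps the bound of \<open>q\<close>, as duality arguments with
  \<open>sgn\<close> require. For this the Lipschitz approximation is clipped at \<open>B\<close>
  before smoothing; since \<open>q\<close> itself is bounded by \<open>B\<close>, clipping does not
  increase the distance to \<open>q\<close> at any point.\<close>

lemma testfun_dense:
  assumes M: "finite_borel_measure M" and "a < b" and AE: "AE x in M. x \<in> {a<..<b}"
    and q: "q \<in> borel_measurable borel" "\<And>x. \<bar>q x\<bar> \<le> B" and "0 < \<delta>"
  shows "\<exists>\<phi> \<phi>'. testfun a b \<phi> \<phi>' \<and> (\<forall>x. \<bar>\<phi> x\<bar> \<le> B) \<and> (\<integral>x. \<bar>\<phi> x - q x\<bar> \<partial>M) < \<delta>"
proof -
  interpret finite_borel_measure M by fact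
  note [measurable_cong] = M_is_borel
  have B: "0 \<le> B" using q(2)[of 0] by simp
  have qi: "integrable M q" using M q by (rule integrable_finite_borel_bounded)
  obtain f where f: "lip_test a b f" "(\<integral>x. \<bar>f x - q x\<bar> \<partial>M) < \<delta>/2"
    using lip_test_dense[OF M \<open>a < b\<close> AE qi] \<open>0 < \<delta>\<close> by (metis half_gt_zero)
  define r where "r x = max (- B) (min B x)" for x :: real
  have r: "lip_test a b (\<lambda>x. r (f x))"
    by (rule lip_test_comp[OF f(1), of 1]) (use B in \<open>auto intro!: lipschitz_onI simp: r_def dist_real_def\<close>)
  have rB: "\<bar>r (f x)\<bar> \<le> B" for x using B by (auto simp: r_def)
  define m where "m = measure M (space M)"
  have m: "0 \<le> m" by (simp add: m_def)
  define e where "e = \<delta> / (2 * (m + 1))"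
  have e: "0 < e" "e * m \<le> \<delta> / 2"
    using \<open>0 < \<delta>\<close> m by (auto simp: e_def field_simps)
  obtain \<phi> \<phi>' where \<phi>: "testfun a b \<phi> \<phi>'" "\<And>x. \<bar>\<phi> x\<bar> \<le> B" "\<And>x. \<bar>\<phi> x - r (f x)\<bar> \<le> e"
    using lip_test_mollify[OF r rB e(1)] by blast
  have "continuous_on UNIV \<phi>"
    using \<phi>(1) by (auto simp: testfun_def intro!: continuous_at_imp_continuous_on intro: DERIV_isCont)
  then have "\<phi> \<in> borel_measurable borel" by (rule borel_measurable_continuous_onI)
  then have i: "integrable M \<phi>" using M \<phi>(2) by (intro integrable_finite_borel_bounded)
  have fi: "integrable M f" using M f(1) by (rule lip_test_integrable)
  have "(\<integral>x. \<bar>\<phi> x - q x\<bar> \<partial>M) \<le> (\<integral>x. \<bar>f x - q x\<bar> + e \<partial>M)"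
  proof (rule integral_mono)
    fix x
    have "\<bar>r (f x) - q x\<bar> \<le> \<bar>f x - q x\<bar>" using q(2)[of x] by (auto simp: r_def)
    then show "\<bar>\<phi> x - q x\<bar> \<le> \<bar>f x - q x\<bar> + e" using \<phi>(3)[of x] by linarith
  qed (use i fi qi in auto)
  also have "\<dots> = (\<integral>x. \<bar>f x - q x\<bar> \<partial>M) + e * m"
    using fi qi by (simp add: m_def)
  also have "\<dots> < \<delta>" using f(2) e(2) by simp
  finally show ?thesis using \<phi> by blast
qed

lemma testfun_props:
  assumes "testfun a b \<phi> \<phi>'"
  shows "\<phi> \<in> borel_measurable borel" "\<phi>' \<in> borel_measurable borel"
    "\<exists>B>0. (\<forall>x. \<bar>\<phi> x\<bar> \<le> B) \<and> (\<forall>x. \<bar>\<phi>' x\<bar> \<le> B)"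
    "x \<notin> {a<..<b} \<Longrightarrow> \<phi> x = 0"
    "x \<notin> {a<..<b} \<Longrightarrow> \<phi>' x = 0"
proof -
  obtain c d where cd: "a < c" "c \<le> d" "d < b" "\<And>x. x \<notin> {c..d} \<Longrightarrow> \<phi> x = 0"
    and der: "\<And>x. (\<phi> has_real_derivative \<phi>' x) (at x)" and cont': "continuous_on UNIV \<phi>'"
    using assms unfolding testfun_def by blast
  have cont: "continuous_on UNIV \<phi>"
    by (intro continuous_at_imp_continuous_on ballI DERIV_isCont[OF der])
  show "\<phi> \<in> borel_measurable borel" "\<phi>' \<in> borel_measurable borel"
    using cont cont' by (auto intro: borel_measurable_continuous_onI)
  have z: "\<phi>' x = 0" if "x \<notin> {c..d}" for x
  proof -
    have "((\<lambda>x. 0) has_real_derivative \<phi>' x) (at x)"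
      by (rule has_field_derivative_transform_within_open[OF der, where S="- {c..d}"]) (use that cd(4) in auto)
    then show ?thesis using DERIV_unique[OF _ DERIV_const] by blast
  qed
  have bd: "\<exists>B>0. \<forall>x. \<bar>f x\<bar> \<le> B" if "continuous_on UNIV f" "\<And>x. x \<notin> {c..d} \<Longrightarrow> f x = 0" for f :: "real \<Rightarrow> real"
  proof -
    have "bounded (f ` {c..d})"
      using that(1) by (intro compact_imp_bounded compact_continuous_image continuous_on_subset[OF that(1)]) auto
    then obtain B where "\<And>x. x \<in> {c..d} \<Longrightarrow> \<bar>f x\<bar> \<le> B" unfolding bounded_iff by force
    then show ?thesis using that(2) by (intro exI[of _ "max B 1"]) (metis abs_zero le_max_iff_disj less_max_iff_disj zero_less_one zero_le_one)
  qed
  obtain B1 B2 where B: "B1 > 0" "\<And>x. \<bar>\<phi> x\<bar> \<le> B1" "B2 > 0" "\<And>x. \<bar>\<phi>' x\<bar> \<le> B2"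
    using bd[OF cont cd(4)] bd[OF cont' z] by blast
  show "\<exists>B>0. (\<forall>x. \<bar>\<phi> x\<bar> \<le> B) \<and> (\<forall>x. \<bar>\<phi>' x\<bar> \<le> B)"
    by (intro exI[of _ "max B1 B2"]) (use B in \<open>auto simp: le_max_iff_disj\<close>)
  show "x \<notin> {a<..<b} \<Longrightarrow> \<phi> x = 0" "x \<notin> {a<..<b} \<Longrightarrow> \<phi>' x = 0"
    using cd z[of x] by auto
qed

text \<open>This is density for the finite measure \<open>|k| dx\<close>: the error is controlled
  after multiplication by a function that is merely integrable.\<close>

lemma testfun_dense_weighted:
  assumes "a < b" and k: "set_integrable lborel {a<..<b} k"
    and q: "q \<in> borel_measurable borel" "\<And>x. \<bar>q x\<bar> \<le> B" and "0 < \<delta>"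
  shows "\<exists>\<phi> \<phi>'. testfun a b \<phi> \<phi>' \<and> (\<forall>x. \<bar>\<phi> x\<bar> \<le> B) \<and>
    (LINT x:{a<..<b}|lborel. \<bar>k x\<bar> * \<bar>\<phi> x - q x\<bar>) < \<delta>"
proof -
  have k': "set_integrable lborel {a<..<b} (\<lambda>x. \<bar>k x\<bar>)" using k by (rule set_integrable_abs)
  define M where "M = density lborel (\<lambda>x. ennreal \<bar>k x\<bar> * indicator {a<..<b} x)"
  note M = set_integrable_density[OF k', folded M_def]
  have fb: "finite_borel_measure M"
    using M by (auto simp: finite_borel_measure_def finite_borel_measure_axioms_def)
  have "space M = UNIV" by (simp add: M_def)
  then have AE: "AE x in M. x \<in> {a<..<b}"
    using M(1,3) by (intro AE_I[of _ _ "UNIV - {a<..<b}"]) auto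
  obtain \<phi> \<phi>' where \<phi>: "testfun a b \<phi> \<phi>'" "\<And>x. \<bar>\<phi> x\<bar> \<le> B" "(\<integral>x. \<bar>\<phi> x - q x\<bar> \<partial>M) < \<delta>"
    using testfun_dense[OF fb \<open>a < b\<close> AE q \<open>0 < \<delta>\<close>] by blast
  have "(\<integral>x. \<bar>\<phi> x - q x\<bar> \<partial>M) = (LINT x:{a<..<b}|lborel. \<bar>k x\<bar> * \<bar>\<phi> x - q x\<bar>)"
    using M(4)[of "\<lambda>x. \<bar>\<phi> x - q x\<bar>"] testfun_props(1)[OF \<phi>(1)] q(1) by (simp add: max_def)
  then show ?thesis using \<phi> by auto
qed

section \<open>One-dimensional functions of bounded variation\<close>

lemma set_integrable_Ioo_const: "set_integrable lborel {p<..<q} (\<lambda>t. c::real)" for p q :: real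
proof -
  have "emeasure lborel {p<..<q} < \<infinity>" by (cases "p \<le> q") auto
  then show ?thesis by (simp add: set_integrable_def)
qed

lemma testfun_integrable:
  assumes "testfun a b \<phi> \<phi>'"
  shows "integrable lborel \<phi>" "integrable lborel \<phi>'"
    "set_integrable lborel {a<..<b} \<phi>" "set_integrable lborel {a<..<b} \<phi>'"
proof -
  note p = testfun_props[OF assms]
  note [measurable] = p(1,2)
  obtain B where B: "\<And>x. \<bar>\<phi> x\<bar> \<le> B" "\<And>x. \<bar>\<phi>' x\<bar> \<le> B" using p(3) by blast
  have *: "integrable lborel f \<and> set_integrable lborel {a<..<b} f"
    if [measurable]: "f \<in> borel_measurable borel" and f: "\<And>x. \<bar>f x\<bar> \<le> B" "\<And>x. x \<notin> {a<..<b} \<Longrightarrow> f x = 0"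
    for f :: "real \<Rightarrow> real"
  proof -
    have "integrable lborel (\<lambda>x. indicator {a<..<b} x * B)"
      using set_integrable_Ioo_const[of a b B] by (simp add: set_integrable_def)
    then have "integrable lborel f"
    proof (rule Bochner_Integration.integrable_bound)
      show "AE x in lborel. norm (f x) \<le> norm (indicator {a<..<b} x * B)"
        using f by (intro AE_I2) (auto simp: indicator_def intro: order_trans[OF _ abs_ge_self])
    qed simp
    moreover have "(\<lambda>x. indicator {a<..<b} x *\<^sub>R f x) = f"
      using f(2) by (auto simp: indicator_def fun_eq_iff)
    ultimately show ?thesis by (simp add: set_integrable_def)
  qed
  show "integrable lborel \<phi>" "integrable lborel \<phi>'"
    "set_integrable lborel {a<..<b} \<phi>" "set_integrable lborel {a<..<b} \<phi>'"
    using *[OF p(1) B(1) p(4)] *[OF p(2) B(2) p(5)] by auto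
qed

lemma set_integral_testfun:
  assumes "testfun a b \<phi> \<phi>'"
  shows "(LINT x:{a<..<b}|lborel. \<phi> x) = (LINT x|lborel. \<phi> x)"
  unfolding set_lebesgue_integral_def
  using testfun_props(4)[OF assms] by (intro Bochner_Integration.integral_cong) (auto simp: indicator_def)

section \<open>The lemma of du Bois-Reymond\<close>

lemma testfun_lincomb:
  assumes "testfun a b \<phi> \<phi>'" "testfun a b \<psi> \<psi>'"
  shows "testfun a b (\<lambda>x. \<phi> x - r * \<psi> x) (\<lambda>x. \<phi>' x - r * \<psi>' x)"
proof -
  obtain c1 d1 where 1: "a < c1" "c1 \<le> d1" "d1 < b" "\<And>x. x \<notin> {c1..d1} \<Longrightarrow> \<phi> x = 0"
    using assms(1) unfolding testfun_def by blast
  obtain c2 d2 where 2: "a < c2" "c2 \<le> d2" "d2 < b" "\<And>x. x \<notin> {c2..d2} \<Longrightarrow> \<psi> x = 0"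
    using assms(2) unfolding testfun_def by blast
  have "\<phi> x - r * \<psi> x = 0" if "x \<notin> {min c1 c2..max d1 d2}" for x
    using that 1(4)[of x] 2(4)[of x] by (auto simp: min_def max_def split: if_splits)
  moreover have "a < min c1 c2" "min c1 c2 \<le> max d1 d2" "max d1 d2 < b"
    using 1 2 by auto
  ultimately have "\<exists>c d. a < c \<and> c \<le> d \<and> d < b \<and> (\<forall>x. x \<notin> {c..d} \<longrightarrow> \<phi> x - r * \<psi> x = 0)"
    by blast
  then show ?thesis
    using assms unfolding testfun_def
    by (auto intro!: derivative_eq_intros continuous_intros)
qed

text \<open>An antiderivative is constant on each side of the support. Vanishing mean makes the two
  constants agree, so subtracting \<open>F a\<close> removes both.\<close>

lemma testfun_antiderivative:
  assumes "a < b" "testfun a b \<psi> \<psi>'" "(LINT x|lborel. \<psi> x) = 0"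
  shows "\<exists>\<phi>. testfun a b \<phi> \<psi>"
proof -
  obtain c d where cd: "a < c" "c \<le> d" "d < b" "\<And>x. x \<notin> {c..d} \<Longrightarrow> \<psi> x = 0"
    using assms(2) unfolding testfun_def by blast
  have cont: "continuous_on UNIV \<psi>"
    using assms(2) by (auto simp: testfun_def intro!: continuous_at_imp_continuous_on intro: DERIV_isCont)
  obtain F where F: "\<And>x. (F has_real_derivative \<psi> x) (at x)"
    using antiderivative_exists[OF cont] by blast
  have FTC: "(LINT x|lborel. \<psi> x * indicator {p..q} x) = F q - F p" if "p \<le> q" for p q
    using that F cont by (intro integral_FTC_Icc_real) (auto simp: continuous_on_eq_continuous_at)
  define \<phi> where "\<phi> x = F x - F a" for x
  have "\<phi> x = 0" if "x \<notin> {c..d}" for x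
  proof (cases "x < c")
    case True
    have z: "(\<lambda>t. \<psi> t * indicator {min x a..max x a} t) = (\<lambda>t. 0)"
      using cd True by (auto simp: fun_eq_iff indicator_def max_def)
    have "F (max x a) - F (min x a) = 0"
      using FTC[of "min x a" "max x a"] unfolding z by simp
    then show ?thesis by (auto simp: \<phi>_def max_def min_def split: if_splits)
  next
    case False
    then have "d < x" using that by auto
    have z: "(\<lambda>t. \<psi> t * indicator {a..x} t) = \<psi>"
    proof
      show "\<psi> t * indicator {a..x} t = \<psi> t" for t
        using cd \<open>d < x\<close> by (cases "t \<in> {c..d}") auto
    qed
    show ?thesis
      using FTC[of a x] \<open>d < x\<close> cd assms(3) unfolding z by (simp add: \<phi>_def)
  qed
  then have "\<exists>c d. a < c \<and> c \<le> d \<and> d < b \<and> (\<forall>x. x \<notin> {c..d} \<longrightarrow> \<phi> x = 0)"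
    using cd by blast
  then have "testfun a b \<phi> \<psi>"
    using cont F unfolding testfun_def \<phi>_def
    by (auto intro!: derivative_eq_intros)
  then show ?thesis by blast
qed

text \<open>Testing with a bounded approximation of \<open>sgn v\<close> in the space weighted by
  \<open>|v|\<close> makes the integral of \<open>|v|\<close> smaller than any
  \<open>\<delta>\<close>.\<close>

lemma AE_zero_of_testfun_integral_zero:
  assumes "a < b" and v: "set_integrable lborel {a<..<b} v"
    and zero: "\<And>\<phi> \<phi>'. testfun a b \<phi> \<phi>' \<Longrightarrow> (LINT x:{a<..<b}|lborel. v x * \<phi> x) = 0"
  shows "AE x in lborel. x \<in> {a<..<b} \<longrightarrow> v x = 0"
proof -
  define q where "q x = sgn (indicator {a<..<b} x * v x)" for x
  have vm [measurable]: "(\<lambda>x. indicator {a<..<b} x * v x) \<in> borel_measurable borel"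
    using v by (auto simp: set_integrable_def)
  have "q \<in> borel_measurable borel" unfolding q_def by measurable
  moreover have "\<bar>q x\<bar> \<le> 1" for x by (auto simp: q_def sgn_real_def)
  ultimately have q: "q \<in> borel_measurable borel" "\<And>x. \<bar>q x\<bar> \<le> 1" by blast+
  define I where "I = (LINT x:{a<..<b}|lborel. \<bar>v x\<bar>)"
  have "I \<le> \<delta>" if \<delta>: "0 < \<delta>" for \<delta>
  proof -
    obtain \<phi> \<phi>' where \<phi>: "testfun a b \<phi> \<phi>'" "\<And>x. \<bar>\<phi> x\<bar> \<le> 1"
      and d: "(LINT x:{a<..<b}|lborel. \<bar>v x\<bar> * \<bar>\<phi> x - q x\<bar>) < \<delta>"
      using testfun_dense_weighted[OF \<open>a < b\<close> v q \<delta>] by blast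
    note pm = testfun_props(1)[OF \<phi>(1)]
    have i1: "set_integrable lborel {a<..<b} (\<lambda>x. v x * q x)"
      and i2: "set_integrable lborel {a<..<b} (\<lambda>x. v x * \<phi> x)"
      using v q pm \<phi>(2) by (auto intro!: set_integrable_mult_bounded)
    have i3: "set_integrable lborel {a<..<b} (\<lambda>x. \<bar>v x\<bar> * \<bar>\<phi> x - q x\<bar>)"
    proof (rule set_integrable_mult_bounded[where B=2])
      show "\<bar>\<bar>\<phi> x - q x\<bar>\<bar> \<le> 2" for x using q(2)[of x] \<phi>(2)[of x] by linarith
    qed (use v q pm in \<open>auto intro!: set_integrable_abs\<close>)
    have "I = (LINT x:{a<..<b}|lborel. v x * q x)"
      unfolding I_def by (intro set_lebesgue_integral_cong) (auto simp: q_def sgn_real_def)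
    also have "\<dots> = (LINT x:{a<..<b}|lborel. v x * q x - v x * \<phi> x)"
      using i1 i2 zero[OF \<phi>(1)] by (simp add: set_integral_diff)
    also have "\<dots> \<le> (LINT x:{a<..<b}|lborel. \<bar>v x\<bar> * \<bar>\<phi> x - q x\<bar>)"
    proof (rule set_integral_mono)
      fix x
      have "v x * q x - v x * \<phi> x \<le> \<bar>v x * (\<phi> x - q x)\<bar>" by (simp add: algebra_simps)
      then show "v x * q x - v x * \<phi> x \<le> \<bar>v x\<bar> * \<bar>\<phi> x - q x\<bar>" by (simp add: abs_mult)
    qed (use i1 i2 i3 in auto)
    finally show ?thesis using d by simp
  qed
  then have "I \<le> 0" by (rule field_le_epsilon) simp
  moreover have "integrable lborel (\<lambda>x. indicator {a<..<b} x *\<^sub>R \<bar>v x\<bar>)"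
    using set_integrable_abs[OF v] by (simp add: set_integrable_def)
  moreover have "0 \<le> I" unfolding I_def set_lebesgue_integral_def
    by (intro integral_nonneg_AE AE_I2) (auto simp: indicator_def)
  ultimately have "AE x in lborel. indicator {a<..<b} x *\<^sub>R \<bar>v x\<bar> = 0"
    using integral_nonneg_eq_0_iff_AE[of lborel "\<lambda>x. indicator {a<..<b} x *\<^sub>R \<bar>v x\<bar>"]
    unfolding I_def set_lebesgue_integral_def by (simp add: order.eq_iff del: AE_conj_iff)
  then show ?thesis by eventually_elim (auto simp: indicator_def)
qed

text \<open>Only derivatives of test functions may be tested, that is, test functions of mean zero.
  Subtracting the multiple \<open>r * \<rho>\<close> of a fixed test function with nonzero integral
  gives every \<open>\<psi>\<close> mean zero, and the correction amounts to subtracting the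
  constant \<open>c\<close> from \<open>w\<close>.\<close>

lemma du_Bois_Reymond:
  assumes "a < b" and w: "set_integrable lborel {a<..<b} w"
    and zero: "\<And>\<phi> \<phi>'. testfun a b \<phi> \<phi>' \<Longrightarrow> (LINT x:{a<..<b}|lborel. w x * \<phi>' x) = 0"
  shows "\<exists>c. AE x in lborel. x \<in> {a<..<b} \<longrightarrow> w x = c"
proof -
  note one = set_integrable_Ioo_const[of a b 1]
  have ba: "0 < (b - a)" using \<open>a < b\<close> by simp
  \<comment> \<open>The constant 1 has integral \<open>b - a\<close>, so an approximation with error
    below \<open>b - a\<close> has nonzero integral.\<close>
  obtain \<rho> \<rho>' where \<rho>: "testfun a b \<rho> \<rho>'"
    and d: "(LINT x:{a<..<b}|lborel. \<bar>1\<bar> * \<bar>\<rho> x - 1\<bar>) < b - a"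
    using testfun_dense_weighted[OF \<open>a < b\<close> one _ _ ba, of "\<lambda>x. 1" 1] by auto
  have "(LINT x:{a<..<b}|lborel. 1 - \<rho> x) \<le> (LINT x:{a<..<b}|lborel. \<bar>\<rho> x - 1\<bar>)"
    using one testfun_integrable(3)[OF \<rho>] by (intro set_integral_mono set_integral_diff set_integrable_abs) auto
  moreover have "(LINT x:{a<..<b}|lborel. 1 - \<rho> x) = (b - a) - (LINT x|lborel. \<rho> x)"
    using one testfun_integrable(3)[OF \<rho>] \<open>a < b\<close>
    by (simp add: set_integral_diff set_integral_testfun[OF \<rho>]) (simp add: set_lebesgue_integral_def)
  ultimately have r0: "(LINT x|lborel. \<rho> x) \<noteq> 0" using d by auto
  define c where "c = (LINT x:{a<..<b}|lborel. w x * \<rho> x) / (LINT x|lborel. \<rho> x)"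
  have "(LINT x:{a<..<b}|lborel. (w x - c) * \<psi> x) = 0" if \<psi>: "testfun a b \<psi> \<psi>'" for \<psi> \<psi>'
  proof -
    define r where "r = (LINT x|lborel. \<psi> x) / (LINT x|lborel. \<rho> x)"
    have t: "testfun a b (\<lambda>x. \<psi> x - r * \<rho> x) (\<lambda>x. \<psi>' x - r * \<rho>' x)"
      using \<psi> \<rho> by (rule testfun_lincomb)
    have "(LINT x|lborel. \<psi> x - r * \<rho> x) = 0"
      using testfun_integrable(1)[OF \<psi>] testfun_integrable(1)[OF \<rho>] r0 by (simp add: r_def)
    then obtain \<phi> where "testfun a b \<phi> (\<lambda>x. \<psi> x - r * \<rho> x)"
      using testfun_antiderivative[OF \<open>a < b\<close> t] by blast
    from zero[OF this] have z: "(LINT x:{a<..<b}|lborel. w x * \<psi> x - r * (w x * \<rho> x)) = 0"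
      by (simp add: algebra_simps)
    have iw: "set_integrable lborel {a<..<b} (\<lambda>x. w x * \<psi> x)" "set_integrable lborel {a<..<b} (\<lambda>x. w x * \<rho> x)"
      using testfun_props[OF \<psi>] testfun_props[OF \<rho>] w by (auto intro!: set_integrable_mult_bounded)
    have "(LINT x:{a<..<b}|lborel. (w x - c) * \<psi> x) = (LINT x:{a<..<b}|lborel. w x * \<psi> x - c * \<psi> x)"
      by (simp add: algebra_simps)
    also have "\<dots> = (LINT x:{a<..<b}|lborel. w x * \<psi> x) - c * (LINT x|lborel. \<psi> x)"
      using iw testfun_integrable(3)[OF \<psi>] by (simp add: set_integral_diff set_integral_testfun[OF \<psi>])
    also have "(LINT x:{a<..<b}|lborel. w x * \<psi> x) = r * (LINT x:{a<..<b}|lborel. w x * \<rho> x)"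
      using z iw by (simp add: set_integral_diff)
    finally show ?thesis using r0 by (simp add: r_def c_def)
  qed
  moreover have "set_integrable lborel {a<..<b} (\<lambda>x. w x - c)"
    using w set_integrable_Ioo_const by (rule set_integral_diff(1))
  ultimately have "AE x in lborel. x \<in> {a<..<b} \<longrightarrow> w x - c = 0"
    using AE_zero_of_testfun_integral_zero[OF \<open>a < b\<close>] by blast
  then show ?thesis by auto
qed

section \<open>Representation of BV functions by distribution functions\<close>

lemma borel_measurable_cdf:
  assumes "finite_borel_measure P"
  shows "cdf P \<in> borel_measurable borel"
  using finite_borel_measure.cdf_nondecreasing[OF assms]
  by (intro borel_measurable_mono monoI)

text \<open>Fubini on the region \<open>t \<le> x\<close>: for fixed \<open>t\<close> the inner
  integral is that of \<open>\<phi>'\<close> over \<open>{t..b}\<close>, which is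
  \<open>- \<phi> t\<close> because \<open>\<phi> b = 0\<close>.\<close>

lemma integral_cdf_testfun:
  assumes P: "finite_borel_measure P" and AE: "AE x in P. x \<in> {a<..<b}" and \<phi>: "testfun a b \<phi> \<phi>'"
  shows "(LINT x:{a<..<b}|lborel. cdf P x * \<phi>' x) = - (LINT x|P. \<phi> x)"
proof -
  interpret P: finite_borel_measure P by fact
  note [measurable_cong] = P.M_is_borel
  interpret pair_sigma_finite lborel P ..
  note p = testfun_props[OF \<phi>]
  note [measurable] = p(1,2) borel_measurable_cdf[OF P]
  define f where "f x t = \<phi>' x * indicator {..x} t" for x t
  have fm: "case_prod f \<in> borel_measurable (lborel \<Otimes>\<^sub>M P)"
  proof -
    have eq: "case_prod f = (\<lambda>z. \<phi>' (fst z) * (if snd z \<le> fst z then 1 else 0))"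
      by (auto simp: f_def fun_eq_iff indicator_def)
    show ?thesis unfolding eq by measurable
  qed
  have inner: "(\<integral>t. \<bar>f x t\<bar> \<partial>P) = \<bar>\<phi>' x\<bar> * cdf P x" "(\<integral>t. f x t \<partial>P) = \<phi>' x * cdf P x" for x
    by (auto simp: f_def abs_mult cdf_def P.borel_UNIV)
  have "integrable (lborel \<Otimes>\<^sub>M P) (case_prod f)"
  proof (rule Fubini_integrable[OF fm])
    have "set_integrable lborel UNIV (\<lambda>x. \<bar>\<phi>' x\<bar> * cdf P x)"
      by (rule set_integrable_mult_bounded[where B="measure P (space P)"])
        (use testfun_integrable(2)[OF \<phi>] P.cdf_bounded P.cdf_nonneg in \<open>auto simp: set_integrable_def\<close>)
    then show "integrable lborel (\<lambda>x. \<integral>y. norm (case_prod f (x, y)) \<partial>P)"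
      by (simp add: inner set_integrable_def)
    show "AE x in lborel. integrable P (\<lambda>y. case_prod f (x, y))"
      by (auto simp: f_def P.emeasure_eq_measure)
  qed
  from Fubini_integral[OF this]
  have eq: "(\<integral>t. (\<integral>x. f x t \<partial>lborel) \<partial>P) = (\<integral>x. \<phi>' x * cdf P x \<partial>lborel)"
    by (simp add: inner)
  have in2: "(\<integral>x. f x t \<partial>lborel) = - \<phi> t" if "t \<in> {a<..<b}" for t
  proof -
    have "(\<lambda>x. f x t) = (\<lambda>x. \<phi>' x * indicator {t..b} x)"
      using that p(5) by (auto simp: f_def fun_eq_iff indicator_def)
    moreover have "(\<integral>x. \<phi>' x * indicator {t..b} x \<partial>lborel) = \<phi> b - \<phi> t"
      using that \<phi> by (intro integral_FTC_Icc_real) (auto simp: testfun_def continuous_on_eq_continuous_at)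
    ultimately show ?thesis using p(4)[of b] by simp
  qed
  have "(\<lambda>x. indicator {a<..<b} x *\<^sub>R (cdf P x * \<phi>' x)) = (\<lambda>x. \<phi>' x * cdf P x)"
    using p(5) by (auto simp: fun_eq_iff indicator_def)
  then have "(LINT x:{a<..<b}|lborel. cdf P x * \<phi>' x) = (\<integral>t. (\<integral>x. f x t \<partial>lborel) \<partial>P)"
    by (simp add: set_lebesgue_integral_def eq)
  also have "\<dots> = (\<integral>t. - \<phi> t \<partial>P)"
  proof (rule integral_cong_AE)
    show "AE t in P. (\<integral>x. f x t \<partial>lborel) = - \<phi> t"
      using AE by eventually_elim (rule in2)
    show "(\<lambda>t. \<integral>x. f x t \<partial>lborel) \<in> borel_measurable P"
    proof (rule lborel.borel_measurable_lebesgue_integral)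
      have eq: "(\<lambda>(t, x). f x t) = (\<lambda>z. \<phi>' (snd z) * (if fst z \<le> snd z then 1 else 0))"
        by (auto simp: f_def fun_eq_iff indicator_def)
      show "(\<lambda>(t, x). f x t) \<in> borel_measurable (P \<Otimes>\<^sub>M lborel)" unfolding eq by measurable
    qed
  qed simp
  finally show ?thesis by simp
qed

text \<open>After subtracting the two distribution functions, \<open>u\<close> has vanishing weak
  derivative and is therefore constant almost everywhere.\<close>

lemma BV_representation:
  assumes "a < b" and Du: "BV_deriv a b u Du"
  shows "\<exists>c. AE x in lborel. x \<in> {a<..<b} \<longrightarrow> u x = c + cdf (fst Du) x - cdf (snd Du) x"
proof -
  have u: "set_integrable lborel {a<..<b} u" and sm: "sm a b Du"
    and D: "\<And>\<phi> \<phi>'. testfun a b \<phi> \<phi>' \<Longrightarrow> (LINT x:{a<..<b}|lborel. u x * \<phi>' x) = - sm_int Du \<phi>"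
    using Du unfolding BV_deriv_def by auto
  note s = smD[OF sm]
  have c: "set_integrable lborel {a<..<b} (cdf P)" if P: "finite_borel_measure P" for P
  proof -
    have "set_integrable lborel {a<..<b} (\<lambda>x. 1 * cdf P x)"
      using finite_borel_measure.cdf_bounded[OF P] finite_borel_measure.cdf_nonneg[OF P] borel_measurable_cdf[OF P] \<open>a < b\<close>
      by (intro set_integrable_mult_bounded[where B="measure P (space P)"]) (auto simp: set_integrable_def)
    then show ?thesis by simp
  qed
  define w where "w x = u x - (cdf (fst Du) x - cdf (snd Du) x)" for x
  have w: "set_integrable lborel {a<..<b} w"
    unfolding w_def using u c[OF s(1)] c[OF s(2)] by (intro set_integral_diff)
  have "(LINT x:{a<..<b}|lborel. w x * \<phi>' x) = 0" if \<phi>: "testfun a b \<phi> \<phi>'" for \<phi> \<phi>'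
  proof -
    obtain B where B: "\<And>x. \<bar>\<phi>' x\<bar> \<le> B" using testfun_props(3)[OF \<phi>] by blast
    have i: "set_integrable lborel {a<..<b} (\<lambda>x. k x * \<phi>' x)" if "set_integrable lborel {a<..<b} k" for k
      using that testfun_props(2)[OF \<phi>] B by (rule set_integrable_mult_bounded)
    have "(LINT x:{a<..<b}|lborel. w x * \<phi>' x) = (LINT x:{a<..<b}|lborel. u x * \<phi>' x - (cdf (fst Du) x * \<phi>' x - cdf (snd Du) x * \<phi>' x))"
      by (simp add: w_def algebra_simps)
    also have "\<dots> = (LINT x:{a<..<b}|lborel. u x * \<phi>' x) - ((LINT x:{a<..<b}|lborel. cdf (fst Du) x * \<phi>' x) - (LINT x:{a<..<b}|lborel. cdf (snd Du) x * \<phi>' x))"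
      using i[OF u] i[OF c[OF s(1)]] i[OF c[OF s(2)]] by (simp add: set_integral_diff)
    also have "\<dots> = 0"
      by (simp add: D[OF \<phi>] integral_cdf_testfun[OF s(1,3) \<phi>] integral_cdf_testfun[OF s(2,4) \<phi>] sm_int_def)
    finally show ?thesis .
  qed
  then obtain c where "AE x in lborel. x \<in> {a<..<b} \<longrightarrow> w x = c"
    using du_Bois_Reymond[OF \<open>a < b\<close> w] by blast
  then have "AE x in lborel. x \<in> {a<..<b} \<longrightarrow> u x = c + cdf (fst Du) x - cdf (snd Du) x"
    by eventually_elim (auto simp: w_def)
  then show ?thesis by blast
qed

section \<open>One-sided approximate limits and jumps\<close>

lemma set_integral_abs_le_of_AE:
  fixes p q e :: real and f :: "real \<Rightarrow> real"
  assumes "p \<le> q" "0 \<le> e" "AE t in lborel. t \<in> {p<..<q} \<longrightarrow> \<bar>f t\<bar> \<le> e"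
  shows "(LINT t:{p<..<q}|lborel. \<bar>f t\<bar>) \<le> e * (q - p)"
proof (cases "set_integrable lborel {p<..<q} (\<lambda>t. \<bar>f t\<bar>)")
  case True
  have "(LINT t:{p<..<q}|lborel. \<bar>f t\<bar>) \<le> (LINT t:{p<..<q}|lborel. e)"
    unfolding set_lebesgue_integral_def
  proof (rule Bochner_Integration.integral_mono_AE)
    show "AE x in lborel. indicator {p<..<q} x *\<^sub>R \<bar>f x\<bar> \<le> indicator {p<..<q} x *\<^sub>R e"
      using assms(3) by eventually_elim (auto simp: indicator_def)
  qed (use True set_integrable_Ioo_const[of p q e] in \<open>auto simp: set_integrable_def\<close>)
  also have "\<dots> = e * (q - p)" using assms(1) by (simp add: set_lebesgue_integral_def)
  finally show ?thesis .
next
  case False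
  \<comment> \<open>A non-integrable function has integral 0 by convention, so the bound holds by
    sign alone.\<close>
  then show ?thesis using assms(1,2)
    by (simp add: set_integrable_def set_lebesgue_integral_def not_integrable_integral_eq)
qed

lemma right_alimI:
  assumes x: "x \<in> {a<..<b}" and AE: "AE t in lborel. t \<in> {a<..<b} \<longrightarrow> u t = V t"
    and V: "(V \<longlongrightarrow> L) (at_right x)"
  shows "right_alim u x L"
  unfolding right_alim_def
proof (rule tendstoI)
  fix e :: real assume "0 < e"
  then have "\<forall>\<^sub>F t in at_right x. dist (V t) L < e / 2" using V by (intro tendstoD) auto
  then obtain y where y: "x < y" "\<And>t. x < t \<Longrightarrow> t < y \<Longrightarrow> dist (V t) L < e / 2"
    unfolding eventually_at_right_field by blast
  have "\<forall>\<^sub>F r in at_right 0. r < min (y - x) (b - x)"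
    using y(1) x by (intro eventually_at_rightI[of 0 "min (y - x) (b - x)"]) auto
  moreover have "\<forall>\<^sub>F r in at_right (0::real). 0 < r" by (rule eventually_at_right_less)
  ultimately show "\<forall>\<^sub>F r in at_right 0. dist ((LINT t:{x<..<x+r}|lborel. \<bar>u t - L\<bar>) / r) 0 < e"
  proof eventually_elim
    case (elim r)
    have "(LINT t:{x<..<x+r}|lborel. \<bar>u t - L\<bar>) \<le> e / 2 * (x + r - x)"
    proof (rule set_integral_abs_le_of_AE)
      show "AE t in lborel. t \<in> {x<..<x+r} \<longrightarrow> \<bar>u t - L\<bar> \<le> e / 2"
        using AE
      proof eventually_elim
        case (elim t)
        then show ?case using y(2)[of t] \<open>r < _\<close> x by (auto simp: dist_real_def)
      qed
    qed (use elim \<open>0 < e\<close> in auto)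
    moreover have "0 \<le> (LINT t:{x<..<x+r}|lborel. \<bar>u t - L\<bar>)"
      unfolding set_lebesgue_integral_def by (intro integral_nonneg_AE AE_I2) auto
    ultimately have "(LINT t:{x<..<x+r}|lborel. \<bar>u t - L\<bar>) / r \<le> e / 2" "0 \<le> (LINT t:{x<..<x+r}|lborel. \<bar>u t - L\<bar>) / r"
      using elim by (auto simp: field_simps)
    then show ?case using \<open>0 < e\<close> unfolding dist_real_def diff_0_right by (subst abs_of_nonneg) linarith+
  qed
qed

lemma left_alimI:
  assumes x: "x \<in> {a<..<b}" and AE: "AE t in lborel. t \<in> {a<..<b} \<longrightarrow> u t = V t"
    and V: "(V \<longlongrightarrow> L) (at_left x)"
  shows "left_alim u x L"
  unfolding left_alim_def
proof (rule tendstoI)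
  fix e :: real assume "0 < e"
  then have "\<forall>\<^sub>F t in at_left x. dist (V t) L < e / 2" using V by (intro tendstoD) auto
  then obtain y where y: "y < x" "\<And>t. y < t \<Longrightarrow> t < x \<Longrightarrow> dist (V t) L < e / 2"
    unfolding eventually_at_left_field by blast
  have "\<forall>\<^sub>F r in at_right 0. r < min (x - y) (x - a)"
    using y(1) x by (intro eventually_at_rightI[of 0 "min (x - y) (x - a)"]) auto
  moreover have "\<forall>\<^sub>F r in at_right (0::real). 0 < r" by (rule eventually_at_right_less)
  ultimately show "\<forall>\<^sub>F r in at_right 0. dist ((LINT t:{x-r<..<x}|lborel. \<bar>u t - L\<bar>) / r) 0 < e"
  proof eventually_elim
    case (elim r)
    have "(LINT t:{x-r<..<x}|lborel. \<bar>u t - L\<bar>) \<le> e / 2 * (x - (x - r))"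
    proof (rule set_integral_abs_le_of_AE)
      show "AE t in lborel. t \<in> {x-r<..<x} \<longrightarrow> \<bar>u t - L\<bar> \<le> e / 2"
        using AE
      proof eventually_elim
        case (elim t)
        then show ?case using y(2)[of t] \<open>r < _\<close> x by (auto simp: dist_real_def)
      qed
    qed (use elim \<open>0 < e\<close> in auto)
    moreover have "0 \<le> (LINT t:{x-r<..<x}|lborel. \<bar>u t - L\<bar>)"
      unfolding set_lebesgue_integral_def by (intro integral_nonneg_AE AE_I2) auto
    ultimately have "(LINT t:{x-r<..<x}|lborel. \<bar>u t - L\<bar>) / r \<le> e / 2" "0 \<le> (LINT t:{x-r<..<x}|lborel. \<bar>u t - L\<bar>) / r"
      using elim by (auto simp: field_simps)
    then show ?case using \<open>0 < e\<close> unfolding dist_real_def diff_0_right by (subst abs_of_nonneg) linarith+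
  qed
qed

text \<open>This is the triangle inequality through \<open>u t\<close>, integrated. Divided by the
  length it bounds \<open>|L - L'|\<close> by two averages that tend to 0, hence approximate limits
  are unique.\<close>

lemma alim_gap:
  fixes p q :: real
  assumes u: "set_integrable lborel {p<..<q} u" and "p < q"
  shows "\<bar>L - L'\<bar> * (q - p) \<le> (LINT t:{p<..<q}|lborel. \<bar>u t - L\<bar>) + (LINT t:{p<..<q}|lborel. \<bar>u t - L'\<bar>)"
proof -
  note c = set_integrable_Ioo_const[of p q]
  have i: "set_integrable lborel {p<..<q} (\<lambda>t. \<bar>u t - L\<bar>)" for L
    using u c by (intro set_integrable_abs set_integral_diff)
  have "\<bar>L - L'\<bar> * (q - p) = (LINT t:{p<..<q}|lborel. \<bar>L - L'\<bar>)"
    using \<open>p < q\<close> by (simp add: set_lebesgue_integral_def)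
  also have "\<dots> \<le> (LINT t:{p<..<q}|lborel. \<bar>u t - L\<bar> + \<bar>u t - L'\<bar>)"
    using c i by (intro set_integral_mono set_integral_add) auto
  also have "\<dots> = (LINT t:{p<..<q}|lborel. \<bar>u t - L\<bar>) + (LINT t:{p<..<q}|lborel. \<bar>u t - L'\<bar>)"
    using i by (simp add: set_integral_add)
  finally show ?thesis .
qed

lemma right_alim_unique:
  assumes x: "x \<in> {a<..<b}" and u: "set_integrable lborel {a<..<b} u"
    and "right_alim u x L" "right_alim u x L'"
  shows "L = L'"
proof -
  have "((\<lambda>r. (LINT t:{x<..<x+r}|lborel. \<bar>u t - L\<bar>) / r + (LINT t:{x<..<x+r}|lborel. \<bar>u t - L'\<bar>) / r) \<longlongrightarrow> 0 + 0) (at_right 0)"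
    using assms(3,4) unfolding right_alim_def by (rule tendsto_add)
  moreover have "\<forall>\<^sub>F r in at_right 0. \<bar>L - L'\<bar> \<le> (LINT t:{x<..<x+r}|lborel. \<bar>u t - L\<bar>) / r + (LINT t:{x<..<x+r}|lborel. \<bar>u t - L'\<bar>) / r"
  proof (rule eventually_at_rightI[of 0 "b - x"])
    fix r assume r: "r \<in> {0<..<b - x}"
    have "set_integrable lborel {x<..<x+r} u"
      using u by (rule set_integrable_subset) (use x r in auto)
    from alim_gap[OF this, of L L'] r
    show "\<bar>L - L'\<bar> \<le> (LINT t:{x<..<x+r}|lborel. \<bar>u t - L\<bar>) / r + (LINT t:{x<..<x+r}|lborel. \<bar>u t - L'\<bar>) / r"
      by (simp add: field_simps)
  qed (use x in auto)
  ultimately have "\<bar>L - L'\<bar> \<le> 0 + 0" by (rule tendsto_lowerbound) simp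
  then show ?thesis by simp
qed

lemma left_alim_unique:
  assumes x: "x \<in> {a<..<b}" and u: "set_integrable lborel {a<..<b} u"
    and "left_alim u x L" "left_alim u x L'"
  shows "L = L'"
proof -
  have "((\<lambda>r. (LINT t:{x-r<..<x}|lborel. \<bar>u t - L\<bar>) / r + (LINT t:{x-r<..<x}|lborel. \<bar>u t - L'\<bar>) / r) \<longlongrightarrow> 0 + 0) (at_right 0)"
    using assms(3,4) unfolding left_alim_def by (rule tendsto_add)
  moreover have "\<forall>\<^sub>F r in at_right 0. \<bar>L - L'\<bar> \<le> (LINT t:{x-r<..<x}|lborel. \<bar>u t - L\<bar>) / r + (LINT t:{x-r<..<x}|lborel. \<bar>u t - L'\<bar>) / r"
  proof (rule eventually_at_rightI[of 0 "x - a"])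
    fix r assume r: "r \<in> {0<..<x - a}"
    have "set_integrable lborel {x-r<..<x} u"
      using u by (rule set_integrable_subset) (use x r in auto)
    from alim_gap[OF this, of L L'] r
    show "\<bar>L - L'\<bar> \<le> (LINT t:{x-r<..<x}|lborel. \<bar>u t - L\<bar>) / r + (LINT t:{x-r<..<x}|lborel. \<bar>u t - L'\<bar>) / r"
      by (simp add: field_simps)
  qed (use x in auto)
  ultimately have "\<bar>L - L'\<bar> \<le> 0 + 0" by (rule tendsto_lowerbound) simp
  then show ?thesis by simp
qed

text \<open>The representing function is right continuous at \<open>x\<close>, and its left limit
  there uses the masses of \<open>{..<x}\<close>; the two differ by the mass of \<open>{x}\<close>.
  Uniqueness of approximate limits identifies them with the values selected by \<open>THE\<close> in
  \<open>jump\<close>.\<close>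

lemma
  assumes "a < b" and Du: "BV_deriv a b u Du" and x: "x \<in> {a<..<b}"
  shows jump_eq_sm_val: "jump u x = sm_val Du {x}"
    and jump_set_iff_sm_val: "x \<in> jump_set a b u \<longleftrightarrow> sm_val Du {x} \<noteq> 0"
proof -
  have u: "set_integrable lborel {a<..<b} u" and sm: "sm a b Du"
    using Du unfolding BV_deriv_def by auto
  interpret P: finite_borel_measure "fst Du" by (rule smD(1)[OF sm])
  interpret N: finite_borel_measure "snd Du" by (rule smD(2)[OF sm])
  obtain c where AE: "AE t in lborel. t \<in> {a<..<b} \<longrightarrow> u t = c + cdf (fst Du) t - cdf (snd Du) t"
    using BV_representation[OF \<open>a < b\<close> Du] by blast
  define R where "R = c + cdf (fst Du) x - cdf (snd Du) x"
  define L where "L = c + measure (fst Du) {..<x} - measure (snd Du) {..<x}"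
  have "((\<lambda>t. c + cdf (fst Du) t - cdf (snd Du) t) \<longlongrightarrow> R) (at_right x)"
    unfolding R_def
    by (intro tendsto_add tendsto_diff tendsto_const
        P.cdf_is_right_cont[unfolded continuous_within] N.cdf_is_right_cont[unfolded continuous_within])
  with x AE have R: "right_alim u x R" by (rule right_alimI)
  have "((\<lambda>t. c + cdf (fst Du) t - cdf (snd Du) t) \<longlongrightarrow> L) (at_left x)"
    unfolding L_def by (intro tendsto_add tendsto_diff tendsto_const P.cdf_at_left N.cdf_at_left)
  with x AE have L: "left_alim u x L" by (rule left_alimI)
  have split: "measure M {..x} = measure M {..<x} + measure M {x}" if "finite_borel_measure M" for M
  proof -
    interpret finite_borel_measure M by fact
    have "{..<x} \<union> {x} = {..x}" by auto
    then show ?thesis using finite_measure_Union[of "{..<x}" "{x}"] M_is_borel by simp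
  qed
  have RL: "R - L = sm_val Du {x}"
    using split[OF P.finite_borel_measure_axioms] split[OF N.finite_borel_measure_axioms]
    by (simp add: R_def L_def sm_val_def cdf_def)
  have "(THE L. right_alim u x L) = R" using R right_alim_unique[OF x u _ R] by blast
  moreover have "(THE R. left_alim u x R) = L" using L left_alim_unique[OF x u _ L] by blast
  ultimately show "jump u x = sm_val Du {x}" using RL by (simp add: jump_def)
  show "x \<in> jump_set a b u \<longleftrightarrow> sm_val Du {x} \<noteq> 0"
  proof
    assume "x \<in> jump_set a b u"
    then obtain L1 L2 where "left_alim u x L1" "right_alim u x L2" "L1 \<noteq> L2"
      by (auto simp: jump_set_def)
    then have "L \<noteq> R" using right_alim_unique[OF x u R] left_alim_unique[OF x u L] by blast
    then show "sm_val Du {x} \<noteq> 0" using RL by simp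
  next
    assume "sm_val Du {x} \<noteq> 0"
    then have "L \<noteq> R" using RL by simp
    then show "x \<in> jump_set a b u" using x R L unfolding jump_set_def by blast
  qed
qed

section \<open>The nonlocal term\<close>

text \<open>By Tonelli, the point \<open>t\<close> is counted for all \<open>x\<close> within
  distance \<open>\<epsilon>\<close>, a set of length \<open>2 * \<epsilon>\<close>. The support
  condition ensures that this whole set lies in \<open>{\<alpha><..<\<beta>}\<close>, so no mass is
  lost at the boundary.\<close>

lemma nn_integral_window:
  fixes k :: "real \<Rightarrow> ennreal"
  assumes [measurable]: "k \<in> borel_measurable borel" and "0 < \<epsilon>"
    and supp: "\<And>t. k t \<noteq> 0 \<Longrightarrow> \<alpha> + \<epsilon> \<le> t \<and> t \<le> \<beta> - \<epsilon>"
  shows "(\<integral>\<^sup>+x\<in>{\<alpha><..<\<beta>}. (\<integral>\<^sup>+t. k t * indicator {x-\<epsilon><..<x+\<epsilon>} t \<partial>lborel) \<partial>lborel) =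
    ennreal (2 * \<epsilon>) * (\<integral>\<^sup>+t. k t \<partial>lborel)"
proof -
  define f where "f x t = k t * indicator {x-\<epsilon><..<x+\<epsilon>} t * indicator {\<alpha><..<\<beta>} x" for x t
  have eq: "case_prod f = (\<lambda>z. k (snd z) * (if fst z - \<epsilon> < snd z \<and> snd z < fst z + \<epsilon> then 1 else 0) * (if \<alpha> < fst z \<and> fst z < \<beta> then 1 else 0))"
    by (auto simp: f_def fun_eq_iff indicator_def)
  have fm: "case_prod f \<in> borel_measurable (lborel \<Otimes>\<^sub>M lborel)"
    unfolding eq by measurable
  have "(\<integral>\<^sup>+x\<in>{\<alpha><..<\<beta>}. (\<integral>\<^sup>+t. k t * indicator {x-\<epsilon><..<x+\<epsilon>} t \<partial>lborel) \<partial>lborel) = (\<integral>\<^sup>+x. \<integral>\<^sup>+t. f x t \<partial>lborel \<partial>lborel)"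
    unfolding f_def by (intro nn_integral_cong nn_integral_multc[symmetric]) simp
  also have "\<dots> = (\<integral>\<^sup>+t. \<integral>\<^sup>+x. f x t \<partial>lborel \<partial>lborel)"
    using lborel_pair.Fubini'[OF fm] by simp
  also have "\<dots> = (\<integral>\<^sup>+t. ennreal (2 * \<epsilon>) * k t \<partial>lborel)"
  proof (rule nn_integral_cong)
    fix t
    show "(\<integral>\<^sup>+x. f x t \<partial>lborel) = ennreal (2 * \<epsilon>) * k t"
    proof (cases "k t = 0")
      case False
      then have "f x t = k t * indicator {t-\<epsilon><..<t+\<epsilon>} x" for x
        using supp[OF False] by (auto simp: f_def indicator_def)
      then show ?thesis using \<open>0 < \<epsilon>\<close> by (simp add: nn_integral_cmult mult.commute)
    qed (simp add: f_def)
  qed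
  also have "\<dots> = ennreal (2 * \<epsilon>) * (\<integral>\<^sup>+t. k t \<partial>lborel)"
    by (intro nn_integral_cmult) simp
  finally show ?thesis .
qed

lemma borel_measurable_window:
  fixes k :: "real \<Rightarrow> real"
  assumes [measurable]: "k \<in> borel_measurable borel"
  shows "(\<lambda>x. LINT t:{x-\<epsilon><..<x+\<epsilon>}|lborel. k t) \<in> borel_measurable borel"
  unfolding set_lebesgue_integral_def
proof -
  have "(\<lambda>x. LINT t|lborel. indicator {x-\<epsilon><..<x+\<epsilon>} t *\<^sub>R k t) \<in> borel_measurable lborel"
  proof (rule lborel.borel_measurable_lebesgue_integral)
    have eq: "(\<lambda>(x, t). indicator {x-\<epsilon><..<x+\<epsilon>} t *\<^sub>R k t) =
        (\<lambda>z. (if fst z - \<epsilon> < snd z \<and> snd z < fst z + \<epsilon> then 1 else 0) * k (snd z))"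
      by (auto simp: fun_eq_iff indicator_def)
    show "(\<lambda>(x, t). indicator {x-\<epsilon><..<x+\<epsilon>} t *\<^sub>R k t) \<in> borel_measurable (lborel \<Otimes>\<^sub>M lborel)"
      unfolding eq by measurable
  qed
  then show "(\<lambda>x. LINT t|lborel. indicator {x-\<epsilon><..<x+\<epsilon>} t *\<^sub>R k t) \<in> borel_measurable borel" by simp
qed

text \<open>A minorant \<open>k'\<close> whose window masses stay below 2 never meets the
  truncation: half of its window mass is below the integrand. The factors
  \<open>1 / \<epsilon>\<close>, \<open>1 / 2\<close> and the window length
  \<open>2 * \<epsilon>\<close> then cancel, leaving the total mass of \<open>k'\<close>.\<close>

lemma truncated_window_ge:
  fixes k k' :: "real \<Rightarrow> real"
  assumes k: "integrable lborel k" and [measurable]: "k' \<in> borel_measurable borel"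
    and k': "\<And>t. 0 \<le> k' t" "\<And>t. k' t \<le> k t" and "0 < \<epsilon>"
    and supp: "\<And>t. k' t \<noteq> 0 \<Longrightarrow> \<alpha> + \<epsilon> \<le> t \<and> t \<le> \<beta> - \<epsilon>"
    and le2: "\<And>x. (LINT t:{x-\<epsilon><..<x+\<epsilon>}|lborel. k' t) \<le> 2"
  shows "ennreal (LINT t|lborel. k' t) \<le>
    ennreal (1 / \<epsilon>) * (\<integral>\<^sup>+x\<in>{\<alpha><..<\<beta>}. ennreal (min ((LINT t:{x-\<epsilon><..<x+\<epsilon>}|lborel. k t) / 2) 1) \<partial>lborel)"
proof -
  have ki': "integrable lborel k'"
    by (rule Bochner_Integration.integrable_bound[OF k]) (use k' in \<open>auto intro!: AE_I2 intro: order_trans[OF _ abs_ge_self]\<close>)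
  have si: "set_integrable lborel {x-\<epsilon><..<x+\<epsilon>} k" "set_integrable lborel {x-\<epsilon><..<x+\<epsilon>} k'" for x
    using integrable_mult_indicator[OF _ k] integrable_mult_indicator[OF _ ki'] by (auto simp: set_integrable_def)
  have w: "(\<integral>\<^sup>+t. ennreal (k' t) * indicator {x-\<epsilon><..<x+\<epsilon>} t \<partial>lborel) = ennreal (LINT t:{x-\<epsilon><..<x+\<epsilon>}|lborel. k' t)" for x
  proof -
    have "(\<integral>\<^sup>+t. ennreal (k' t) * indicator {x-\<epsilon><..<x+\<epsilon>} t \<partial>lborel) = (\<integral>\<^sup>+t. ennreal (indicator {x-\<epsilon><..<x+\<epsilon>} t *\<^sub>R k' t) \<partial>lborel)"
      by (intro nn_integral_cong) (auto simp: indicator_def)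
    also have "\<dots> = ennreal (LINT t:{x-\<epsilon><..<x+\<epsilon>}|lborel. k' t)"
      unfolding set_lebesgue_integral_def
      using si(2)[of x] k'(1) by (intro nn_integral_eq_integral) (auto simp: set_integrable_def)
    finally show ?thesis .
  qed
  have int: "(\<integral>\<^sup>+t. ennreal (k' t) \<partial>lborel) = ennreal (LINT t|lborel. k' t)"
    using ki' k'(1) by (intro nn_integral_eq_integral) auto
  have *: "(\<integral>\<^sup>+x\<in>{\<alpha><..<\<beta>}. ennreal (LINT t:{x-\<epsilon><..<x+\<epsilon>}|lborel. k' t) \<partial>lborel) = ennreal (2 * \<epsilon>) * ennreal (LINT t|lborel. k' t)"
    using nn_integral_window[of "\<lambda>t. ennreal (k' t)" \<epsilon> \<alpha> \<beta>] supp \<open>0 < \<epsilon>\<close> k'(1)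
    by (simp add: w int)
  have eq: "ennreal (LINT t|lborel. k' t) = ennreal (1 / \<epsilon>) * (ennreal (1/2) * (\<integral>\<^sup>+x\<in>{\<alpha><..<\<beta>}. ennreal (LINT t:{x-\<epsilon><..<x+\<epsilon>}|lborel. k' t) \<partial>lborel))"
  proof -
    have "ennreal (LINT t|lborel. k' t) = ennreal ((1 / \<epsilon>) * ((1/2) * ((2 * \<epsilon>) * (LINT t|lborel. k' t))))"
      using \<open>0 < \<epsilon>\<close> by simp
    also have "\<dots> = ennreal (1 / \<epsilon>) * (ennreal (1/2) * (ennreal (2 * \<epsilon>) * ennreal (LINT t|lborel. k' t)))"
      using \<open>0 < \<epsilon>\<close> ennreal_mult' by (metis divide_nonneg_nonneg less_imp_le mult_nonneg_nonneg zero_le_numeral zero_le_one)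
    finally show ?thesis using * by simp
  qed
  have "ennreal (1/2) * (\<integral>\<^sup>+x\<in>{\<alpha><..<\<beta>}. ennreal (LINT t:{x-\<epsilon><..<x+\<epsilon>}|lborel. k' t) \<partial>lborel) =
      (\<integral>\<^sup>+x. ennreal (1/2) * (ennreal (LINT t:{x-\<epsilon><..<x+\<epsilon>}|lborel. k' t) * indicator {\<alpha><..<\<beta>} x) \<partial>lborel)"
    using borel_measurable_window[of k' \<epsilon>] by (intro nn_integral_cmult[symmetric]) simp
  also have "\<dots> \<le> (\<integral>\<^sup>+x\<in>{\<alpha><..<\<beta>}. ennreal (min ((LINT t:{x-\<epsilon><..<x+\<epsilon>}|lborel. k t) / 2) 1) \<partial>lborel)"
  proof (rule nn_integral_mono)
    fix x
    have 1: "(LINT t:{x-\<epsilon><..<x+\<epsilon>}|lborel. k' t) \<le> (LINT t:{x-\<epsilon><..<x+\<epsilon>}|lborel. k t)"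
      using si k' by (intro set_integral_mono) auto
    have 2: "0 \<le> (LINT t:{x-\<epsilon><..<x+\<epsilon>}|lborel. k' t)"
      unfolding set_lebesgue_integral_def using k'(1) by (intro integral_nonneg_AE AE_I2) auto
    show "ennreal (1/2) * (ennreal (LINT t:{x-\<epsilon><..<x+\<epsilon>}|lborel. k' t) * indicator {\<alpha><..<\<beta>} x)
      \<le> ennreal (min ((LINT t:{x-\<epsilon><..<x+\<epsilon>}|lborel. k t) / 2) 1) * indicator {\<alpha><..<\<beta>} x"
    proof -
      have "ennreal (1/2) * ennreal (LINT t:{x-\<epsilon><..<x+\<epsilon>}|lborel. k' t) = ennreal ((LINT t:{x-\<epsilon><..<x+\<epsilon>}|lborel. k' t) / 2)"
        by (subst ennreal_mult'[symmetric]) auto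
      also have "\<dots> \<le> ennreal (min ((LINT t:{x-\<epsilon><..<x+\<epsilon>}|lborel. k t) / 2) 1)"
        using 1 le2[of x] by (intro ennreal_leI) auto
      finally show ?thesis unfolding mult.assoc[symmetric] by (rule mult_right_mono) simp
    qed
  qed
  finally show ?thesis unfolding eq by (rule mult_left_mono) simp
qed

text \<open>Either some window carries mass at least 2, and then the part of the mass in that window
  alone already produces the value 2, or the truncation is inactive away from the boundary.\<close>

lemma min_mass_le_truncated_window:
  fixes k :: "real \<Rightarrow> real"
  assumes k: "integrable lborel k" "\<And>t. 0 \<le> k t" and "0 < \<epsilon>"
  shows "ennreal (min 2 (LINT t:{\<alpha>+3*\<epsilon>..\<beta>-3*\<epsilon>}|lborel. k t)) \<le>
    ennreal (1 / \<epsilon>) * (\<integral>\<^sup>+x\<in>{\<alpha><..<\<beta>}. ennreal (min ((LINT t:{x-\<epsilon><..<x+\<epsilon>}|lborel. k t) / 2) 1) \<partial>lborel)"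
    (is "_ \<le> ?R")
proof -
  define m where "m x = (LINT t:{x-\<epsilon><..<x+\<epsilon>}|lborel. k t)" for x
  have [measurable]: "k \<in> borel_measurable borel" using k(1) by auto
  have si: "set_integrable lborel A k" if "A \<in> sets borel" for A
    using integrable_mult_indicator[OF _ k(1)] that by (auto simp: set_integrable_def)
  show ?thesis
  \<comment> \<open>The windows of such centres lie between \<open>\<alpha> + \<epsilon>\<close> and
    \<open>\<beta> - \<epsilon>\<close>, as the support condition of
    \<open>truncated_window_ge\<close> demands.\<close>
  proof (cases "\<exists>x\<in>{\<alpha>+2*\<epsilon>..\<beta>-2*\<epsilon>}. 2 \<le> m x")
    case True
    then obtain y where y: "y \<in> {\<alpha>+2*\<epsilon>..\<beta>-2*\<epsilon>}" "2 \<le> m y" by blast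
    \<comment> \<open>Rescaling to total mass exactly 2 bounds the mass in every window by 2 and
      keeps \<open>k'\<close> below \<open>k\<close>, since \<open>m y\<close> is at least
      2.\<close>
    define k' where "k' t = (2 / m y) * (indicator {y-\<epsilon><..<y+\<epsilon>} t * k t)" for t
    have ki': "integrable lborel k'"
      unfolding k'_def using si[of "{y-\<epsilon><..<y+\<epsilon>}"] by (auto simp: set_integrable_def)
    have 2: "(LINT t|lborel. k' t) = 2"
      using y(2) by (simp add: k'_def m_def set_lebesgue_integral_def)
    have k'0: "0 \<le> k' t" for t using k(2) y(2) by (simp add: k'_def)
    have "ennreal (LINT t|lborel. k' t) \<le> ?R"
    proof (rule truncated_window_ge[OF k(1)])
      show "k' t \<le> k t" for t
      proof -
        have "2 / m y * k t \<le> 1 * k t" using y(2) k(2) by (intro mult_right_mono) auto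
        then show ?thesis using k(2)[of t] by (auto simp: k'_def indicator_def)
      qed
      show "\<alpha> + \<epsilon> \<le> t \<and> t \<le> \<beta> - \<epsilon>" if "k' t \<noteq> 0" for t
        using that y(1) by (auto simp: k'_def indicator_def split: if_splits)
      show "(LINT t:{x-\<epsilon><..<x+\<epsilon>}|lborel. k' t) \<le> 2" for x
        unfolding 2[symmetric] set_lebesgue_integral_def using ki' k'0
        by (intro integral_mono integrable_mult_indicator) (auto simp: indicator_def)
    qed (use k'0 \<open>0 < \<epsilon>\<close> in \<open>auto simp: k'_def\<close>)
    moreover have "ennreal (min 2 (LINT t:{\<alpha>+3*\<epsilon>..\<beta>-3*\<epsilon>}|lborel. k t)) \<le> ennreal 2"
      by (intro ennreal_leI) simp
    ultimately show ?thesis by (simp add: 2)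
  next
    case False
    define k' where "k' t = indicator {\<alpha>+3*\<epsilon>..\<beta>-3*\<epsilon>} t * k t" for t
    have k'0: "0 \<le> k' t" "k' t \<le> k t" for t using k(2)[of t] by (auto simp: k'_def indicator_def)
    have ki': "integrable lborel k'"
      unfolding k'_def using si[of "{\<alpha>+3*\<epsilon>..\<beta>-3*\<epsilon>}"] by (auto simp: set_integrable_def)
    have "ennreal (LINT t|lborel. k' t) \<le> ?R"
    proof (rule truncated_window_ge[OF k(1)])
      show "\<alpha> + \<epsilon> \<le> t \<and> t \<le> \<beta> - \<epsilon>" if "k' t \<noteq> 0" for t
        using that \<open>0 < \<epsilon>\<close> by (auto simp: k'_def indicator_def split: if_splits)
      show "(LINT t:{x-\<epsilon><..<x+\<epsilon>}|lborel. k' t) \<le> 2" for x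
      \<comment> \<open>A window that meets
        \<open>{\<alpha>+3*\<epsilon>..\<beta>-3*\<epsilon>}\<close> has its centre in this range,
        where the case assumption applies; every other window has no \<open>k'\<close> mass. This is
        where the margin \<open>3 * \<epsilon>\<close> comes from.\<close>
      proof (cases "x \<in> {\<alpha>+2*\<epsilon>..\<beta>-2*\<epsilon>}")
        case True
        have "(LINT t:{x-\<epsilon><..<x+\<epsilon>}|lborel. k' t) \<le> m x"
          unfolding m_def using integrable_mult_indicator[OF _ ki'] k'0 si
          by (intro set_integral_mono) (auto simp: set_integrable_def)
        moreover have "m x < 2" using False True by (auto simp: not_le)
        ultimately show ?thesis by linarith
      next
        case x: False
        have "(\<lambda>t. indicator {x-\<epsilon><..<x+\<epsilon>} t *\<^sub>R k' t) = (\<lambda>t. 0)"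
          using x by (auto simp: k'_def fun_eq_iff indicator_def)
        then show ?thesis by (simp add: set_lebesgue_integral_def)
      qed
    qed (use k'0 \<open>0 < \<epsilon>\<close> in \<open>auto simp: k'_def\<close>)
    moreover have "ennreal (min 2 (LINT t:{\<alpha>+3*\<epsilon>..\<beta>-3*\<epsilon>}|lborel. k t)) \<le> ennreal (LINT t|lborel. k' t)"
      by (intro ennreal_leI) (simp add: k'_def set_lebesgue_integral_def)
    ultimately show ?thesis by simp
  qed
qed

text \<open>A minorant of the nonlocal energy divided by \<open>c0\<close>: \<open>g\<close> is
  extended by zero and every window is normalised by the full length \<open>2 * \<epsilon>\<close>,
  even where \<open>(a,b)\<close> cuts it off. This removes the dependence on the end
  points.\<close>

definition nonlocal :: "real \<Rightarrow> real \<Rightarrow> real \<Rightarrow> (real \<Rightarrow> real) \<Rightarrow> ennreal" where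
  "nonlocal a b \<epsilon> g = ennreal (1 / \<epsilon>) * (\<integral>\<^sup>+x\<in>{a<..<b}.
     ennreal (min ((LINT t:{x-\<epsilon><..<x+\<epsilon>}|lborel. indicator {a<..<b} t * \<bar>g t\<bar>) / 2) 1) \<partial>lborel)"

text \<open>A window cut off by an end point is shorter than \<open>2 * \<epsilon>\<close>, so
  dividing by its actual length can only increase the value.\<close>

lemma fpot_avg_ge:
  assumes g: "set_integrable lborel {a<..<b} g" and "0 < \<epsilon>" "x \<in> {a<..<b}" "0 \<le> c0"
  shows "c0 * min ((LINT t:{x-\<epsilon><..<x+\<epsilon>}|lborel. indicator {a<..<b} t * \<bar>g t\<bar>) / 2) 1
    \<le> fpot c0 (\<epsilon> * avg_abs a b \<epsilon> g x)"
proof -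
  define I where "I = (LINT t:({x-\<epsilon><..<x+\<epsilon>} \<inter> {a<..<b})|lborel. \<bar>g t\<bar>)"
  define l where "l = measure lborel ({x-\<epsilon><..<x+\<epsilon>} \<inter> {a<..<b})"
  have I: "(LINT t:{x-\<epsilon><..<x+\<epsilon>}|lborel. indicator {a<..<b} t * \<bar>g t\<bar>) = I"
    unfolding I_def set_lebesgue_integral_def
    by (intro Bochner_Integration.integral_cong) (auto simp: indicator_def)
  have "0 \<le> I" unfolding I_def set_lebesgue_integral_def
    by (intro integral_nonneg_AE AE_I2) (auto simp: indicator_def)
  have set: "{x-\<epsilon><..<x+\<epsilon>} \<inter> {a<..<b} = {max (x-\<epsilon>) a<..<min (x+\<epsilon>) b}" by auto
  have l: "l = min (x+\<epsilon>) b - max (x-\<epsilon>) a"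
    unfolding l_def set using assms by (intro measure_lborel_Ioo) auto
  then have "0 < l" "l \<le> 2 * \<epsilon>" using assms by auto
  then have "I / 2 \<le> \<epsilon> * (I / l)" using \<open>0 \<le> I\<close> \<open>0 < \<epsilon>\<close>
    using mult_right_mono[of l "2*\<epsilon>" I] by (simp add: field_simps)
  then have "min (I / 2) 1 \<le> min (\<epsilon> * avg_abs a b \<epsilon> g x) 1"
    unfolding avg_abs_def I_def[symmetric] l_def[symmetric] by linarith
  then show ?thesis unfolding I fpot_def using \<open>0 \<le> c0\<close> by (rule mult_left_mono)
qed

lemma nonlocal_le_energy:
  assumes g: "set_integrable lborel {a<..<b} g" and "0 < \<epsilon>" "0 \<le> c0"
  shows "ennreal c0 * nonlocal a b \<epsilon> g \<le>
    ennreal (1 / \<epsilon>) * (\<integral>\<^sup>+ x\<in>{a<..<b}. ennreal (fpot c0 (\<epsilon> * avg_abs a b \<epsilon> g x)) \<partial>lborel)"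
proof -
  have [measurable]: "(\<lambda>t. indicator {a<..<b} t * \<bar>g t\<bar>) \<in> borel_measurable borel"
    using set_integrable_abs[OF g] by (auto simp: set_integrable_def)
  note [measurable] = borel_measurable_window
  define F where "F x = min ((LINT t:{x-\<epsilon><..<x+\<epsilon>}|lborel. indicator {a<..<b} t * \<bar>g t\<bar>) / 2) 1" for x
  have [measurable]: "F \<in> borel_measurable borel" unfolding F_def by measurable
  have "ennreal c0 * (\<integral>\<^sup>+x\<in>{a<..<b}. ennreal (F x) \<partial>lborel) = (\<integral>\<^sup>+x. ennreal c0 * (ennreal (F x) * indicator {a<..<b} x) \<partial>lborel)"
    by (intro nn_integral_cmult[symmetric]) measurable
  also have "\<dots> \<le> (\<integral>\<^sup>+ x\<in>{a<..<b}. ennreal (fpot c0 (\<epsilon> * avg_abs a b \<epsilon> g x)) \<partial>lborel)"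
    using fpot_avg_ge[OF g \<open>0 < \<epsilon>\<close> _ \<open>0 \<le> c0\<close>] \<open>0 \<le> c0\<close>
    by (intro nn_integral_mono) (auto simp: indicator_def F_def ennreal_mult'[symmetric] intro!: ennreal_leI)
  finally have "ennreal (1 / \<epsilon>) * (ennreal c0 * (\<integral>\<^sup>+x\<in>{a<..<b}. ennreal (F x) \<partial>lborel)) \<le>
    ennreal (1 / \<epsilon>) * (\<integral>\<^sup>+ x\<in>{a<..<b}. ennreal (fpot c0 (\<epsilon> * avg_abs a b \<epsilon> g x)) \<partial>lborel)"
    by (rule mult_left_mono) simp
  then show ?thesis unfolding nonlocal_def F_def by (simp add: ac_simps)
qed

lemma nonlocal_superadditive:
  fixes \<alpha> \<beta> :: "'i \<Rightarrow> real"
  assumes g: "set_integrable lborel {a<..<b} g" and "finite I"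
    and disj: "disjoint_family_on (\<lambda>i. {\<alpha> i<..<\<beta> i}) I" and sub: "\<And>i. i \<in> I \<Longrightarrow> {\<alpha> i<..<\<beta> i} \<subseteq> {a<..<b}"
  shows "(\<Sum>i\<in>I. ennreal (1 / \<epsilon>) * (\<integral>\<^sup>+x\<in>{\<alpha> i<..<\<beta> i}.
     ennreal (min ((LINT t:{x-\<epsilon><..<x+\<epsilon>}|lborel. indicator {a<..<b} t * \<bar>g t\<bar>) / 2) 1) \<partial>lborel)) \<le> nonlocal a b \<epsilon> g"
proof -
  have [measurable]: "(\<lambda>t. indicator {a<..<b} t * \<bar>g t\<bar>) \<in> borel_measurable borel"
    using set_integrable_abs[OF g] by (auto simp: set_integrable_def)
  note [measurable] = borel_measurable_window
  define F where "F x = min ((LINT t:{x-\<epsilon><..<x+\<epsilon>}|lborel. indicator {a<..<b} t * \<bar>g t\<bar>) / 2) 1" for x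
  have [measurable]: "F \<in> borel_measurable borel" unfolding F_def by measurable
  have "(\<Sum>i\<in>I. (\<integral>\<^sup>+x\<in>{\<alpha> i<..<\<beta> i}. ennreal (F x) \<partial>lborel)) = (\<integral>\<^sup>+x. (\<Sum>i\<in>I. ennreal (F x) * indicator {\<alpha> i<..<\<beta> i} x) \<partial>lborel)"
    by (intro nn_integral_sum[symmetric]) measurable
  also have "\<dots> \<le> (\<integral>\<^sup>+x\<in>{a<..<b}. ennreal (F x) \<partial>lborel)"
  proof (rule nn_integral_mono)
    fix x
    have "(\<Sum>i\<in>I. ennreal (F x) * indicator {\<alpha> i<..<\<beta> i} x) = ennreal (F x) * indicator (\<Union>i\<in>I. {\<alpha> i<..<\<beta> i}) x"
      unfolding sum_distrib_left[symmetric]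
      using disj \<open>finite I\<close> by (simp add: indicator_UN_disjoint)
    also have "\<dots> \<le> ennreal (F x) * indicator {a<..<b} x"
      using sub by (intro mult_left_mono indicator_leI) (blast, simp)
    finally show "(\<Sum>i\<in>I. ennreal (F x) * indicator {\<alpha> i<..<\<beta> i} x) \<le> ennreal (F x) * indicator {a<..<b} x" .
  qed
  finally have "ennreal (1 / \<epsilon>) * (\<Sum>i\<in>I. (\<integral>\<^sup>+x\<in>{\<alpha> i<..<\<beta> i}. ennreal (F x) \<partial>lborel)) \<le> ennreal (1 / \<epsilon>) * (\<integral>\<^sup>+x\<in>{a<..<b}. ennreal (F x) \<partial>lborel)"
    by (rule mult_left_mono) simp
  then show ?thesis by (simp add: sum_distrib_left nonlocal_def F_def)
qed

text \<open>Each \<open>\<phi> i\<close> has compact support in its open cell and there are finitely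
  many cells, so for large \<open>j\<close> all supports lie in the cells shrunk by
  \<open>3 * \<epsilon> j\<close>. Since the test functions are bounded by 1, the pairing with
  \<open>g j\<close> is then at most the mass of \<open>|g j|\<close> in the shrunk cell, and the
  estimate for one interval applies to each cell.\<close>

lemma nonlocal_eventually_ge:
  fixes \<alpha> \<beta> :: "'i \<Rightarrow> real"
  assumes eps: "\<And>j::nat. 0 < \<epsilon> j" "\<epsilon> \<longlonglongrightarrow> 0"
    and g: "\<And>j. set_integrable lborel {a<..<b} (g j)" and "finite I"
    and disj: "disjoint_family_on (\<lambda>i. {\<alpha> i<..<\<beta> i}) I" and sub: "\<And>i. i \<in> I \<Longrightarrow> {\<alpha> i<..<\<beta> i} \<subseteq> {a<..<b}"
    and \<phi>: "\<And>i. i \<in> I \<Longrightarrow> testfun (\<alpha> i) (\<beta> i) (\<phi> i) (\<phi>' i)" "\<And>i x. i \<in> I \<Longrightarrow> \<bar>\<phi> i x\<bar> \<le> 1"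
    and lim: "\<And>i. i \<in> I \<Longrightarrow> (\<lambda>j. LINT x:{a<..<b}|lborel. g j x * \<phi> i x) \<longlonglongrightarrow> l i"
    and C: "C < (\<Sum>i\<in>I. min 2 (l i))"
  shows "\<forall>\<^sub>F j in sequentially. ennreal C \<le> nonlocal a b (\<epsilon> j) (g j)"
proof -
  have "(\<lambda>j. \<Sum>i\<in>I. min 2 (LINT x:{a<..<b}|lborel. g j x * \<phi> i x)) \<longlonglongrightarrow> (\<Sum>i\<in>I. min 2 (l i))"
    using lim by (intro tendsto_sum tendsto_min tendsto_const)
  then have "\<forall>\<^sub>F j in sequentially. C < (\<Sum>i\<in>I. min 2 (LINT x:{a<..<b}|lborel. g j x * \<phi> i x))"
    using C by (rule order_tendstoD(1))
  moreover have "\<forall>\<^sub>F j in sequentially. \<forall>i\<in>I. \<forall>x. x \<notin> {\<alpha> i + 3 * \<epsilon> j..\<beta> i - 3 * \<epsilon> j} \<longrightarrow> \<phi> i x = 0"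
  proof (rule eventually_ball_finite[OF \<open>finite I\<close>], rule ballI)
    fix i assume "i \<in> I"
    then obtain c d where cd: "\<alpha> i < c" "c \<le> d" "d < \<beta> i" "\<And>x. x \<notin> {c..d} \<Longrightarrow> \<phi> i x = 0"
      using \<phi>(1) unfolding testfun_def by metis
    have "\<forall>\<^sub>F j in sequentially. \<epsilon> j < min (c - \<alpha> i) (\<beta> i - d) / 3"
      using cd by (intro order_tendstoD(2)[OF eps(2)]) auto
    then show "\<forall>\<^sub>F j in sequentially. \<forall>x. x \<notin> {\<alpha> i + 3 * \<epsilon> j..\<beta> i - 3 * \<epsilon> j} \<longrightarrow> \<phi> i x = 0"
    proof eventually_elim
      case (elim j)
      then have "{c..d} \<subseteq> {\<alpha> i + 3 * \<epsilon> j..\<beta> i - 3 * \<epsilon> j}" by auto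
      then show ?case using cd(4) by blast
    qed
  qed
  ultimately show ?thesis
  proof eventually_elim
    case (elim j)
    note gj = g[of j]
    define k where "k t = indicator {a<..<b} t * \<bar>g j t\<bar>" for t
    have k: "integrable lborel k" "\<And>t. 0 \<le> k t"
      using set_integrable_abs[OF gj] unfolding k_def by (auto simp: set_integrable_def)
    \<comment> \<open>Individual pairings may be negative, and \<open>ennreal\<close> would cut them
      off term by term; taking positive parts first only enlarges the sum and makes
      \<open>ennreal\<close> additive.\<close>
    have "ennreal C \<le> ennreal (\<Sum>i\<in>I. max 0 (min 2 (LINT x:{a<..<b}|lborel. g j x * \<phi> i x)))"
      using elim(1) by (intro ennreal_leI order_trans[OF less_imp_le[OF elim(1)]] sum_mono) auto
    also have "\<dots> = (\<Sum>i\<in>I. ennreal (min 2 (LINT x:{a<..<b}|lborel. g j x * \<phi> i x)))"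
    proof -
      have "ennreal (max 0 x) = ennreal x" for x by (simp add: max_def ennreal_neg)
      then show ?thesis by (subst sum_ennreal[symmetric]) (simp_all only: max.cobounded1)
    qed
    also have "\<dots> \<le> (\<Sum>i\<in>I. ennreal (1 / \<epsilon> j) * (\<integral>\<^sup>+x\<in>{\<alpha> i<..<\<beta> i}.
        ennreal (min ((LINT t:{x-\<epsilon> j<..<x+\<epsilon> j}|lborel. k t) / 2) 1) \<partial>lborel))"
    proof (rule sum_mono)
      fix i assume i: "i \<in> I"
      have "(LINT x:{a<..<b}|lborel. g j x * \<phi> i x) \<le> (LINT t:{\<alpha> i+3*\<epsilon> j..\<beta> i-3*\<epsilon> j}|lborel. k t)"
        unfolding set_lebesgue_integral_def
      proof (rule integral_mono)
        show "integrable lborel (\<lambda>x. indicator {a<..<b} x *\<^sub>R (g j x * \<phi> i x))"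
          using set_integrable_mult_bounded[OF gj testfun_props(1)[OF \<phi>(1)[OF i]] \<phi>(2)[OF i]]
          by (simp add: set_integrable_def)
        show "integrable lborel (\<lambda>x. indicator {\<alpha> i+3*\<epsilon> j..\<beta> i-3*\<epsilon> j} x *\<^sub>R k x)"
          using k(1) by (intro integrable_mult_indicator) auto
        fix x
        have "g j x * \<phi> i x \<le> \<bar>g j x\<bar> * \<bar>\<phi> i x\<bar>" by (simp flip: abs_mult)
        also have "\<dots> \<le> \<bar>g j x\<bar> * 1" using \<phi>(2)[OF i] by (intro mult_left_mono) auto
        finally have le: "g j x * \<phi> i x \<le> \<bar>g j x\<bar>" by simp
        show "indicator {a<..<b} x *\<^sub>R (g j x * \<phi> i x) \<le> indicator {\<alpha> i+3*\<epsilon> j..\<beta> i-3*\<epsilon> j} x *\<^sub>R k x"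
        proof (cases "x \<in> {\<alpha> i+3*\<epsilon> j..\<beta> i-3*\<epsilon> j}")
          case True
          then show ?thesis using le by (auto simp: k_def indicator_def)
        next
          case False
          then have "\<phi> i x = 0" using elim(2) i by blast
          then show ?thesis using k(2)[of x] by (simp add: indicator_def)
        qed
      qed
      then have "ennreal (min 2 (LINT x:{a<..<b}|lborel. g j x * \<phi> i x)) \<le> ennreal (min 2 (LINT t:{\<alpha> i+3*\<epsilon> j..\<beta> i-3*\<epsilon> j}|lborel. k t))"
        by (intro ennreal_leI) auto
      also have "\<dots> \<le> ennreal (1 / \<epsilon> j) * (\<integral>\<^sup>+x\<in>{\<alpha> i<..<\<beta> i}.
        ennreal (min ((LINT t:{x-\<epsilon> j<..<x+\<epsilon> j}|lborel. k t) / 2) 1) \<partial>lborel)"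
        using k eps(1) by (rule min_mass_le_truncated_window)
      finally show "ennreal (min 2 (LINT x:{a<..<b}|lborel. g j x * \<phi> i x)) \<le> ennreal (1 / \<epsilon> j) * (\<integral>\<^sup>+x\<in>{\<alpha> i<..<\<beta> i}.
        ennreal (min ((LINT t:{x-\<epsilon> j<..<x+\<epsilon> j}|lborel. k t) / 2) 1) \<partial>lborel)" .
    qed
    also have "\<dots> \<le> nonlocal a b (\<epsilon> j) (g j)"
      unfolding k_def using nonlocal_superadditive[OF gj \<open>finite I\<close> disj sub] .
    finally show ?case .
  qed
qed

section \<open>Weak convergence and lower semicontinuity\<close>

lemma liminf_add_ennreal:
  fixes x y :: "nat \<Rightarrow> ennreal"
  shows "liminf x + liminf y \<le> liminf (\<lambda>n. x n + y n)"
proof -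
  have inc: "incseq (\<lambda>n. INF m\<in>{n..}. z m)" for z :: "nat \<Rightarrow> ennreal"
    by (intro incseq_SucI INF_superset_mono) auto
  have "liminf x + liminf y = (SUP n. (INF m\<in>{n..}. x m) + (INF m\<in>{n..}. y m))"
    unfolding liminf_SUP_INF by (rule ennreal_SUP_add[symmetric]) (use inc in auto)
  also have "\<dots> \<le> liminf (\<lambda>n. x n + y n)"
    unfolding liminf_SUP_INF
    by (intro SUP_mono' INF_greatest add_mono INF_lower)
  finally show ?thesis .
qed

section \<open>Weak lower semicontinuity of the quadratic term\<close>

lemma set_integrable_mult_testfun:
  assumes "set_integrable lborel {a<..<b} v" "testfun c d \<phi> \<phi>'"
  shows "set_integrable lborel {a<..<b} (\<lambda>x. v x * \<phi> x)" "set_integrable lborel {a<..<b} (\<lambda>x. v x * \<phi>' x)"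
proof -
  obtain B where B: "\<And>x. \<bar>\<phi> x\<bar> \<le> B" "\<And>x. \<bar>\<phi>' x\<bar> \<le> B" using testfun_props(3)[OF assms(2)] by blast
  show "set_integrable lborel {a<..<b} (\<lambda>x. v x * \<phi> x)" "set_integrable lborel {a<..<b} (\<lambda>x. v x * \<phi>' x)"
    using assms(1) testfun_props[OF assms(2)] B by (auto intro!: set_integrable_mult_bounded)
qed

text \<open>From \<open>(w - \<phi>)^2 \<ge> 0\<close> one gets
  \<open>2 w \<phi> - \<phi>^2 \<le> w^2\<close>, whose left side is affine in \<open>w\<close> and
  passes to the limit for a fixed test function. For the limit \<open>v\<close> and
  \<open>\<phi> = q\<close> the left side is at least \<open>q^2\<close>, because
  \<open>q^2 \<le> v q\<close>; truncations of \<open>v\<close> have this property. Since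
  \<open>q\<close> is bounded it can be approximated by test functions with the same bound.\<close>

lemma L2_truncated_le_liminf:
  assumes "a < b" and v: "set_integrable lborel {a<..<b} v"
    and vj: "\<And>j::nat. L2 a b (vv j)" "\<And>j. set_integrable lborel {a<..<b} (vv j)"
    and lim: "\<And>\<phi> \<phi>'. testfun a b \<phi> \<phi>' \<Longrightarrow>
       (\<lambda>j. LINT x:{a<..<b}|lborel. vv j x * \<phi> x) \<longlonglongrightarrow> (LINT x:{a<..<b}|lborel. v x * \<phi> x)"
    and q: "q \<in> borel_measurable borel" "\<And>x. \<bar>q x\<bar> \<le> B" "\<And>x. x \<in> {a<..<b} \<Longrightarrow> (q x)\<^sup>2 \<le> v x * q x"
  shows "(\<integral>\<^sup>+x\<in>{a<..<b}. ennreal ((q x)\<^sup>2) \<partial>lborel) \<le> liminf (\<lambda>j. \<integral>\<^sup>+x\<in>{a<..<b}. ennreal ((vv j x)\<^sup>2) \<partial>lborel)"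
    (is "_ \<le> ?L")
proof -
  have B: "0 \<le> B" using q(2)[of 0] by simp
  have qi: "set_integrable lborel {a<..<b} (\<lambda>x. (q x)\<^sup>2)"
    using set_integrable_mult_bounded[OF set_integrable_mult_bounded[OF set_integrable_Ioo_const[of a b 1] q(1,2)] q(1,2)]
    by (simp add: power2_eq_square)
  have eq: "(\<integral>\<^sup>+x\<in>{a<..<b}. ennreal ((q x)\<^sup>2) \<partial>lborel) = ennreal (LINT x:{a<..<b}|lborel. (q x)\<^sup>2)"
  proof -
    have "(\<integral>\<^sup>+x\<in>{a<..<b}. ennreal ((q x)\<^sup>2) \<partial>lborel) = (\<integral>\<^sup>+x. ennreal (indicator {a<..<b} x *\<^sub>R (q x)\<^sup>2) \<partial>lborel)"
      by (intro nn_integral_cong) (auto simp: indicator_def)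
    also have "\<dots> = ennreal (LINT x:{a<..<b}|lborel. (q x)\<^sup>2)"
      unfolding set_lebesgue_integral_def using qi
      by (intro nn_integral_eq_integral) (auto simp: set_integrable_def)
    finally show ?thesis .
  qed
  have "ennreal (LINT x:{a<..<b}|lborel. (q x)\<^sup>2) \<le> ?L + ennreal \<delta>" if \<delta>: "0 < \<delta>" for \<delta>
  proof -
    \<comment> \<open>Replacing \<open>q\<close> by \<open>\<phi>\<close> changes
      \<open>2 v q - q^2\<close> by at most \<open>(2 * |v| + 2 * B) * |\<phi> - q|\<close>, which
      is below \<open>(2 + 2 * B) * k * |\<phi> - q|\<close>. This dictates the weight
      \<open>k\<close> and the error \<open>d\<close>.\<close>
    define k where "k x = 1 + \<bar>v x\<bar>" for x
    have k: "set_integrable lborel {a<..<b} k"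
      unfolding k_def by (intro set_integral_add set_integrable_Ioo_const set_integrable_abs v)
    define d where "d = \<delta> / (2 + 2 * B)"
    have d: "0 < d" "(2 + 2 * B) * d = \<delta>" using \<delta> B by (auto simp: d_def)
    obtain \<phi> \<phi>' where \<phi>: "testfun a b \<phi> \<phi>'" "\<And>x. \<bar>\<phi> x\<bar> \<le> B"
      and small: "(LINT x:{a<..<b}|lborel. \<bar>k x\<bar> * \<bar>\<phi> x - q x\<bar>) < d"
      using testfun_dense_weighted[OF \<open>a < b\<close> k q(1,2) d(1)] by blast
    note pm = testfun_props(1)[OF \<phi>(1)]
    have \<phi>2: "set_integrable lborel {a<..<b} (\<lambda>x. (\<phi> x)\<^sup>2)"
      using set_integrable_mult_bounded[OF testfun_integrable(3)[OF \<phi>(1)] pm \<phi>(2)]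
      by (simp add: power2_eq_square)
    have i: "set_integrable lborel {a<..<b} (\<lambda>x. 2 * (w x * \<phi> x) - (\<phi> x)\<^sup>2)"
      if "set_integrable lborel {a<..<b} w" for w
      using set_integrable_mult_testfun(1)[OF that \<phi>(1)] \<phi>2 by (intro set_integral_diff set_integrable_mult_right) auto
    have I: "(LINT x:{a<..<b}|lborel. 2 * (w x * \<phi> x) - (\<phi> x)\<^sup>2) =
        2 * (LINT x:{a<..<b}|lborel. w x * \<phi> x) - (LINT x:{a<..<b}|lborel. (\<phi> x)\<^sup>2)"
      if "set_integrable lborel {a<..<b} w" for w
      using set_integrable_mult_testfun(1)[OF that \<phi>(1)] \<phi>2 by (simp add: set_integral_diff)
    have kq: "set_integrable lborel {a<..<b} (\<lambda>x. \<bar>k x\<bar> * \<bar>\<phi> x - q x\<bar>)"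
    proof (rule set_integrable_mult_bounded[where B="2 * B"])
      show "\<bar>\<bar>\<phi> x - q x\<bar>\<bar> \<le> 2 * B" for x using q(2)[of x] \<phi>(2)[of x] by linarith
    qed (use set_integrable_abs[OF k] pm q in auto)
    have "(LINT x:{a<..<b}|lborel. (q x)\<^sup>2 - (2 + 2 * B) * (\<bar>k x\<bar> * \<bar>\<phi> x - q x\<bar>)) \<le> (LINT x:{a<..<b}|lborel. 2 * (v x * \<phi> x) - (\<phi> x)\<^sup>2)"
    proof (rule set_integral_mono)
      fix x assume x: "x \<in> {a<..<b}"
      define t where "t = \<phi> x - q x"
      have "- (2 * (v x * t)) \<le> 2 * \<bar>v x\<bar> * \<bar>t\<bar>" using abs_ge_minus_self[of "v x * t"] unfolding abs_mult by linarith
      moreover have "t * (\<phi> x + q x) \<le> \<bar>t\<bar> * (2 * B)"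
      proof -
        have "t * (\<phi> x + q x) \<le> \<bar>t\<bar> * \<bar>\<phi> x + q x\<bar>" using abs_ge_self[of "t * (\<phi> x + q x)"] by (simp add: abs_mult)
        also have "\<dots> \<le> \<bar>t\<bar> * (2 * B)" using q(2)[of x] \<phi>(2)[of x] by (intro mult_left_mono) linarith+
        finally show ?thesis .
      qed
      moreover have "2 * (v x * \<phi> x) - (\<phi> x)\<^sup>2 = 2 * (v x * q x) - (q x)\<^sup>2 + 2 * (v x * t) - t * (\<phi> x + q x)"
        by (simp add: t_def algebra_simps power2_eq_square)
      moreover have "2 * \<bar>v x\<bar> * \<bar>t\<bar> + \<bar>t\<bar> * (2 * B) \<le> (2 + 2 * B) * (\<bar>k x\<bar> * \<bar>t\<bar>)"
      proof -
        have "2 * \<bar>v x\<bar> + 2 * B \<le> (2 + 2 * B) * \<bar>k x\<bar>" using B by (simp add: k_def algebra_simps)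
        then have "(2 * \<bar>v x\<bar> + 2 * B) * \<bar>t\<bar> \<le> ((2 + 2 * B) * \<bar>k x\<bar>) * \<bar>t\<bar>" by (rule mult_right_mono) simp
        then show ?thesis by (simp add: algebra_simps)
      qed
      ultimately show "(q x)\<^sup>2 - (2 + 2 * B) * (\<bar>k x\<bar> * \<bar>\<phi> x - q x\<bar>) \<le> 2 * (v x * \<phi> x) - (\<phi> x)\<^sup>2"
        using q(3)[OF x] unfolding t_def[symmetric] by linarith
    next
      show "set_integrable lborel {a<..<b} (\<lambda>x. (q x)\<^sup>2 - (2 + 2 * B) * (\<bar>k x\<bar> * \<bar>\<phi> x - q x\<bar>))"
        using qi kq by (intro set_integral_diff(1) set_integrable_mult_right) auto
    qed (rule i[OF v])
    moreover have "(LINT x:{a<..<b}|lborel. (q x)\<^sup>2 - (2 + 2 * B) * (\<bar>k x\<bar> * \<bar>\<phi> x - q x\<bar>)) =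
        (LINT x:{a<..<b}|lborel. (q x)\<^sup>2) - (2 + 2 * B) * (LINT x:{a<..<b}|lborel. \<bar>k x\<bar> * \<bar>\<phi> x - q x\<bar>)"
      using qi kq by (subst set_integral_diff(2)) auto
    moreover have "(2 + 2 * B) * (LINT x:{a<..<b}|lborel. \<bar>k x\<bar> * \<bar>\<phi> x - q x\<bar>) < \<delta>"
      using small B unfolding d(2)[symmetric] by (intro mult_strict_left_mono) auto
    ultimately have gt: "(LINT x:{a<..<b}|lborel. (q x)\<^sup>2) - \<delta> < (LINT x:{a<..<b}|lborel. 2 * (v x * \<phi> x) - (\<phi> x)\<^sup>2)"
      by linarith
    have "(\<lambda>j. LINT x:{a<..<b}|lborel. 2 * (vv j x * \<phi> x) - (\<phi> x)\<^sup>2) \<longlonglongrightarrow> (LINT x:{a<..<b}|lborel. 2 * (v x * \<phi> x) - (\<phi> x)\<^sup>2)"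
      unfolding I[OF v] I[OF vj(2)] by (intro tendsto_intros lim[OF \<phi>(1)])
    then have "\<forall>\<^sub>F j in sequentially. (LINT x:{a<..<b}|lborel. (q x)\<^sup>2) - \<delta> < (LINT x:{a<..<b}|lborel. 2 * (vv j x * \<phi> x) - (\<phi> x)\<^sup>2)"
      using gt by (rule order_tendstoD(1))
    then have "\<forall>\<^sub>F j in sequentially. ennreal ((LINT x:{a<..<b}|lborel. (q x)\<^sup>2) - \<delta>) \<le> (\<integral>\<^sup>+x\<in>{a<..<b}. ennreal ((vv j x)\<^sup>2) \<partial>lborel)"
    proof eventually_elim
      case (elim j)
      have v2: "set_integrable lborel {a<..<b} (\<lambda>x. (vv j x)\<^sup>2)" using vj(1)[of j] by (simp add: L2_def)
      have "(LINT x:{a<..<b}|lborel. 2 * (vv j x * \<phi> x) - (\<phi> x)\<^sup>2) \<le> (LINT x:{a<..<b}|lborel. (vv j x)\<^sup>2)"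
      proof (rule set_integral_mono[OF i[OF vj(2)] v2])
        fix x
        have "0 \<le> (vv j x - \<phi> x)\<^sup>2" by simp
        then show "2 * (vv j x * \<phi> x) - (\<phi> x)\<^sup>2 \<le> (vv j x)\<^sup>2" by (simp add: power2_eq_square algebra_simps)
      qed
      with elim have "ennreal ((LINT x:{a<..<b}|lborel. (q x)\<^sup>2) - \<delta>) \<le> ennreal (LINT x:{a<..<b}|lborel. (vv j x)\<^sup>2)"
        by (intro ennreal_leI) linarith
      also have "\<dots> = (\<integral>\<^sup>+x. ennreal (indicator {a<..<b} x *\<^sub>R (vv j x)\<^sup>2) \<partial>lborel)"
        unfolding set_lebesgue_integral_def using v2
        by (intro nn_integral_eq_integral[symmetric]) (auto simp: set_integrable_def)
      also have "\<dots> = (\<integral>\<^sup>+x\<in>{a<..<b}. ennreal ((vv j x)\<^sup>2) \<partial>lborel)"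
        by (intro nn_integral_cong) (auto simp: indicator_def)
      finally show ?case .
    qed
    then have "ennreal ((LINT x:{a<..<b}|lborel. (q x)\<^sup>2) - \<delta>) \<le> ?L" by (rule Liminf_bounded)
    then have "ennreal ((LINT x:{a<..<b}|lborel. (q x)\<^sup>2) - \<delta>) + ennreal \<delta> \<le> ?L + ennreal \<delta>" by (rule add_right_mono)
    \<comment> \<open>If the difference is negative, \<open>ennreal\<close> makes it 0, but then the
      integral itself is below \<open>\<delta>\<close>.\<close>
    moreover have "ennreal (LINT x:{a<..<b}|lborel. (q x)\<^sup>2) \<le> ennreal ((LINT x:{a<..<b}|lborel. (q x)\<^sup>2) - \<delta>) + ennreal \<delta>"
      using \<delta> by (cases "\<delta> \<le> (LINT x:{a<..<b}|lborel. (q x)\<^sup>2)")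
        (auto simp: ennreal_neg ennreal_plus[symmetric] simp del: ennreal_plus intro!: ennreal_leI)
    ultimately show ?thesis by (rule order_trans[rotated])
  qed
  then show ?thesis unfolding eq by (rule ennreal_le_epsilon)
qed

text \<open>The truncations of \<open>v\<close> at height \<open>n\<close> agree with
  \<open>v\<close> at each point for large \<open>n\<close>, so the bound for bounded functions
  extends by Fatou.\<close>

lemma L2_norm_le_liminf:
  assumes "a < b" and v: "set_integrable lborel {a<..<b} v"
    and vj: "\<And>j::nat. L2 a b (vv j)" "\<And>j. set_integrable lborel {a<..<b} (vv j)"
    and lim: "\<And>\<phi> \<phi>'. testfun a b \<phi> \<phi>' \<Longrightarrow>
       (\<lambda>j. LINT x:{a<..<b}|lborel. vv j x * \<phi> x) \<longlonglongrightarrow> (LINT x:{a<..<b}|lborel. v x * \<phi> x)"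
  shows "(\<integral>\<^sup>+x\<in>{a<..<b}. ennreal ((v x)\<^sup>2) \<partial>lborel) \<le> liminf (\<lambda>j. \<integral>\<^sup>+x\<in>{a<..<b}. ennreal ((vv j x)\<^sup>2) \<partial>lborel)"
proof -
  have vm [measurable]: "(\<lambda>x. indicator {a<..<b} x * v x) \<in> borel_measurable borel"
    using v by (auto simp: set_integrable_def)
  define q where "q n x = max (- real n) (min (real n) (indicator {a<..<b} x * v x))" for n x
  have [measurable]: "q n \<in> borel_measurable borel" for n unfolding q_def by measurable
  have le: "(\<integral>\<^sup>+x\<in>{a<..<b}. ennreal ((q n x)\<^sup>2) \<partial>lborel) \<le> liminf (\<lambda>j. \<integral>\<^sup>+x\<in>{a<..<b}. ennreal ((vv j x)\<^sup>2) \<partial>lborel)" for n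
  proof (rule L2_truncated_le_liminf[OF \<open>a < b\<close> v vj lim])
    show "\<bar>q n x\<bar> \<le> real n" for x by (auto simp: q_def)
    show "(q n x)\<^sup>2 \<le> v x * q n x" if "x \<in> {a<..<b}" for x
    proof (cases "0 \<le> v x")
      case True
      then have "0 \<le> q n x" "q n x \<le> v x" using that by (auto simp: q_def)
      then show ?thesis by (simp add: power2_eq_square mult_right_mono)
    next
      case False
      then have "q n x \<le> 0" "v x \<le> q n x" using that by (auto simp: q_def)
      then show ?thesis by (simp add: power2_eq_square mult_right_mono_neg)
    qed
  qed auto
  have "(\<integral>\<^sup>+x\<in>{a<..<b}. ennreal ((v x)\<^sup>2) \<partial>lborel) = (\<integral>\<^sup>+x. liminf (\<lambda>n. ennreal ((q n x)\<^sup>2) * indicator {a<..<b} x) \<partial>lborel)"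
  proof (rule nn_integral_cong)
    fix x
    have "\<forall>\<^sub>F n in sequentially. \<bar>v x\<bar> \<le> real n"
      using filterlim_real_sequentially by (simp add: filterlim_at_top)
    then have "\<forall>\<^sub>F n in sequentially. ennreal ((q n x)\<^sup>2) * indicator {a<..<b} x = ennreal ((v x)\<^sup>2) * indicator {a<..<b} x"
      by eventually_elim (auto simp: q_def indicator_def)
    then have "(\<lambda>n. ennreal ((q n x)\<^sup>2) * indicator {a<..<b} x) \<longlonglongrightarrow> ennreal ((v x)\<^sup>2) * indicator {a<..<b} x"
      by (rule tendsto_eventually)
    then show "ennreal ((v x)\<^sup>2) * indicator {a<..<b} x = liminf (\<lambda>n. ennreal ((q n x)\<^sup>2) * indicator {a<..<b} x)"
      by (intro lim_imp_Liminf[symmetric]) simp_all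
  qed
  also have "\<dots> \<le> liminf (\<lambda>n. \<integral>\<^sup>+x\<in>{a<..<b}. ennreal ((q n x)\<^sup>2) \<partial>lborel)"
    by (rule nn_integral_liminf) measurable
  also have "\<dots> \<le> liminf (\<lambda>j. \<integral>\<^sup>+x\<in>{a<..<b}. ennreal ((vv j x)\<^sup>2) \<partial>lborel)"
    using le by (intro Liminf_le always_eventually) simp_all
  finally show ?thesis .
qed

section \<open>Convergence of pairings with test functions\<close>

lemma sm_int_cmult: "sm_int \<mu> (\<lambda>x. c * \<phi> x) = c * sm_int \<mu> \<phi>"
  by (simp add: sm_int_def right_diff_distrib)

text \<open>A common bound of \<open>\<phi>\<close> and \<open>\<phi>'\<close> serves as the scaling
  constant. Both signs are needed since \<open>flat_dist\<close> is a supremum of signed differences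
  and only bounds them from above.\<close>

lemma testfun_scaled_flat_test:
  assumes "testfun a b \<phi> \<phi>'"
  shows "\<exists>C>0. \<forall>s\<in>{1, -1}. (\<lambda>x. s / C * \<phi> x) \<in> flat_test a b"
proof -
  obtain C where C: "0 < C" "\<And>x. \<bar>\<phi> x\<bar> \<le> C" "\<And>x. \<bar>\<phi>' x\<bar> \<le> C" using testfun_props(3)[OF assms] by blast
  have "(\<lambda>x. s / C * \<phi> x) \<in> flat_test a b" if s: "s \<in> {1, -1}" for s :: real
  proof -
    have abs_s: "\<bar>s\<bar> = 1" using s by auto
    have der: "(\<phi> has_real_derivative \<phi>' x) (at x)" for x using assms by (simp add: testfun_def)
    have "C-lipschitz_on UNIV \<phi>"
    proof (rule lipschitz_onI)
      show "dist (\<phi> x) (\<phi> y) \<le> C * dist x y" for x y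
      proof -
        have "norm (\<phi> x - \<phi> y) \<le> C * norm (x - y)"
          by (rule field_differentiable_bound[of UNIV \<phi> \<phi>']) (use der C in auto)
        then show ?thesis by (simp add: dist_norm)
      qed
    qed (use C in simp)
    then have "(\<bar>s / C\<bar> * C)-lipschitz_on UNIV (\<lambda>x. s / C * \<phi> x)" by (rule lipschitz_on_cmult_real)
    moreover have "\<bar>s / C * \<phi> x\<bar> \<le> 1" for x
      using C(1) C(2)[of x] abs_s by (simp add: abs_mult)
    ultimately show ?thesis
      using testfun_props(4)[OF assms] C(1) abs_s by (auto simp: flat_test_def)
  qed
  then show ?thesis using C(1) by blast
qed

lemma flat_dist_tendsto_testfun:
  assumes \<phi>: "testfun a b \<phi> \<phi>'" and flat: "(\<lambda>j. flat_dist a b (\<Gamma> j) \<gamma>) \<longlonglongrightarrow> 0"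
  shows "(\<lambda>j. sm_int (\<Gamma> j) \<phi>) \<longlonglongrightarrow> sm_int \<gamma> \<phi>"
proof (rule tendstoI)
  fix e :: real assume "0 < e"
  obtain C where C: "0 < C" "\<And>s. s \<in> {1, -1} \<Longrightarrow> (\<lambda>x. s / C * \<phi> x) \<in> flat_test a b"
    using testfun_scaled_flat_test[OF \<phi>] by blast
  have "\<forall>\<^sub>F j in sequentially. flat_dist a b (\<Gamma> j) \<gamma> < ereal (e / C)"
    using \<open>0 < e\<close> C(1) by (intro order_tendstoD(2)[OF flat]) auto
  then show "\<forall>\<^sub>F j in sequentially. dist (sm_int (\<Gamma> j) \<phi>) (sm_int \<gamma> \<phi>) < e"
  proof eventually_elim
    case (elim j)
    have *: "s * (sm_int (\<Gamma> j) \<phi> - sm_int \<gamma> \<phi>) < e" if "s \<in> {1, -1}" for s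
    proof -
      have "ereal (sm_int (\<Gamma> j) (\<lambda>x. s / C * \<phi> x) - sm_int \<gamma> (\<lambda>x. s / C * \<phi> x)) \<le> flat_dist a b (\<Gamma> j) \<gamma>"
        unfolding flat_dist_def using C(2)[OF that] by (rule SUP_upper)
      then have "sm_int (\<Gamma> j) (\<lambda>x. s / C * \<phi> x) - sm_int \<gamma> (\<lambda>x. s / C * \<phi> x) < e / C"
        using elim le_less_trans by fastforce
      then have "s * (sm_int (\<Gamma> j) \<phi> - sm_int \<gamma> \<phi>) / C < e / C"
        unfolding sm_int_cmult by (simp add: right_diff_distrib diff_divide_distrib)
      then show ?thesis using C(1) by (simp add: divide_less_cancel)
    qed
    show ?case using *[of 1] *[of "-1"] by (simp add: dist_real_def abs_less_iff)
  qed
qed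

lemma L1_tendsto_testfun:
  assumes \<phi>: "testfun a b \<phi> \<phi>'" and u: "set_integrable lborel {a<..<b} u"
    and U: "\<And>j. set_integrable lborel {a<..<b} (U j)"
    and lim: "(\<lambda>j. LINT x:{a<..<b}|lborel. \<bar>U j x - u x\<bar>) \<longlonglongrightarrow> 0"
  shows "(\<lambda>j. LINT x:{a<..<b}|lborel. U j x * \<phi>' x) \<longlonglongrightarrow> (LINT x:{a<..<b}|lborel. u x * \<phi>' x)"
proof -
  obtain B where B: "0 < B" "\<And>x. \<bar>\<phi>' x\<bar> \<le> B" using testfun_props(3)[OF \<phi>] by blast
  note i = set_integrable_mult_testfun(2)[OF _ \<phi>]
  have le: "norm ((LINT x:{a<..<b}|lborel. U j x * \<phi>' x) - (LINT x:{a<..<b}|lborel. u x * \<phi>' x)) \<le>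
      B * (LINT x:{a<..<b}|lborel. \<bar>U j x - u x\<bar>)" for j
  proof -
    have d: "set_integrable lborel {a<..<b} (\<lambda>x. U j x - u x)" using U u by (rule set_integral_diff(1))
    have "(LINT x:{a<..<b}|lborel. U j x * \<phi>' x) - (LINT x:{a<..<b}|lborel. u x * \<phi>' x) = (LINT x:{a<..<b}|lborel. (U j x - u x) * \<phi>' x)"
      using i[OF U] i[OF u] by (simp add: left_diff_distrib set_integral_diff)
    also have "\<bar>\<dots>\<bar> \<le> (LINT x:{a<..<b}|lborel. \<bar>(U j x - u x) * \<phi>' x\<bar>)"
      using set_integral_norm_bound[OF i[OF d]] by simp
    also have "\<dots> \<le> (LINT x:{a<..<b}|lborel. B * \<bar>U j x - u x\<bar>)"
    proof (rule set_integral_mono)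
      show "\<bar>(U j x - u x) * \<phi>' x\<bar> \<le> B * \<bar>U j x - u x\<bar>" for x
        using mult_left_mono[OF B(2)[of x], of "\<bar>U j x - u x\<bar>"] by (simp add: abs_mult mult.commute)
    qed (use set_integrable_abs[OF d] set_integrable_abs[OF i[OF d]] in auto)
    finally show ?thesis by simp
  qed
  have "(\<lambda>j. (LINT x:{a<..<b}|lborel. U j x * \<phi>' x) - (LINT x:{a<..<b}|lborel. u x * \<phi>' x)) \<longlonglongrightarrow> 0"
    by (rule Lim_null_comparison[OF _ tendsto_mult_right_zero[OF lim, of B]])
      (use le in \<open>rule always_eventually[OF allI]\<close>)
  then show ?thesis by (rule LIM_zero_cancel)
qed

section \<open>Total variation and fine grids\<close>

lemma finite_borel_density:
  fixes k :: "real \<Rightarrow> real"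
  assumes M: "finite_borel_measure M" and k: "integrable M k" "\<And>x. 0 \<le> k x"
  shows "finite_borel_measure (density M (\<lambda>x. ennreal (k x)))"
    and "f \<in> borel_measurable borel \<Longrightarrow> (LINT x|density M (\<lambda>x. ennreal (k x)). f x) = (LINT x|M. k x * f x :: real)"
    and "A \<in> sets borel \<Longrightarrow> measure (density M (\<lambda>x. ennreal (k x))) A = (LINT x|M. k x * indicator A x)"
proof -
  interpret finite_borel_measure M by fact
  note [measurable_cong] = M_is_borel
  have km [measurable]: "k \<in> borel_measurable M" using k(1) by auto
  let ?D = "density M (\<lambda>x. ennreal (k x))"
  have "emeasure ?D (space ?D) = (\<integral>\<^sup>+x. ennreal (k x) \<partial>M)"
    by (auto simp: emeasure_density intro!: nn_integral_cong)
  also have "\<dots> < \<infinity>" using k by (simp add: real_integrable_def less_top[symmetric])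
  finally have "finite_measure ?D" by (intro finite_measureI) simp
  then show fb: "finite_borel_measure ?D"
    by (simp add: finite_borel_measure_def finite_borel_measure_axioms_def M_is_borel)
  show int: "(LINT x|?D. f x) = (LINT x|M. k x * f x)" if [measurable]: "f \<in> borel_measurable borel" for f
    using k(2) by (simp add: integral_density)
  show "measure ?D A = (LINT x|M. k x * indicator A x)" if "A \<in> sets borel"
  proof -
    interpret D: finite_borel_measure ?D by fact
    have "(LINT x|?D. indicator A x) = measure ?D A" using that D.borel_UNIV by simp
    then show ?thesis using int[of "indicator A"] that by simp
  qed
qed

lemma RN_real_density:
  assumes M: "finite_borel_measure M" and P: "finite_borel_measure P"
    and le: "\<And>A. A \<in> sets borel \<Longrightarrow> emeasure P A \<le> emeasure M A"
  shows "\<exists>p. p \<in> borel_measurable borel \<and> (\<forall>x. 0 \<le> p x) \<and> integrable M p \<and> P = density M (\<lambda>x. ennreal (p x))"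
proof -
  interpret M: finite_borel_measure M by fact
  interpret P: finite_borel_measure P by fact
  note [measurable_cong] = M.M_is_borel
  have ac: "absolutely_continuous M P"
    unfolding absolutely_continuous_def
  proof
    fix A assume "A \<in> null_sets M"
    then have "A \<in> sets borel" "emeasure M A = 0" using M.M_is_borel by auto
    then show "A \<in> null_sets P" using le[of A] P.M_is_borel by (auto simp: null_sets_def)
  qed
  have s: "sets P = sets M" using M.M_is_borel P.M_is_borel by simp
  obtain p where p [measurable]: "p \<in> borel_measurable M"
    and RN: "AE x in M. RN_deriv M P x = ennreal (p x)" and p0: "\<And>x. 0 \<le> p x"
    using M.real_RN_deriv[OF P.finite_measure_axioms ac s] by blast
  have "P = density M (RN_deriv M P)" using M.density_RN_deriv[OF ac s] by simp
  also have "\<dots> = density M (\<lambda>x. ennreal (p x))" using RN by (intro density_cong) auto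
  finally have eq: "P = density M (\<lambda>x. ennreal (p x))" .
  have "(\<integral>\<^sup>+x. ennreal (p x) \<partial>M) = emeasure P (space P)"
    unfolding eq by (auto simp: emeasure_density intro!: nn_integral_cong)
  also have "\<dots> < \<infinity>" by (simp add: P.emeasure_eq_measure)
  finally have "integrable M p" using p0 by (intro integrableI_nonneg) auto
  moreover have "p \<in> borel_measurable borel" using p M.M_is_borel by (simp cong: measurable_cong_sets)
  ultimately show ?thesis using p0 eq by blast
qed

text \<open>The two parts of \<open>\<gamma>\<close> need not be mutually singular, so their sum
  \<open>M\<close> may exceed the variation. Writing \<open>\<gamma>\<close> as \<open>q\<close>
  times \<open>M\<close> by Radon-Nikodym, the measure \<open>|q| M\<close> accounts for the
  cancellation: it dominates the values of \<open>\<gamma>\<close>, has the right atoms, and on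
  every open interval is almost attained by pairing \<open>\<gamma>\<close> with a test
  function.\<close>

lemma total_variation_exists:
  assumes \<gamma>: "sm a b \<gamma>"
  shows "\<exists>\<tau>. finite_borel_measure \<tau> \<and> (\<forall>A\<in>sets borel. \<bar>sm_val \<gamma> A\<bar> \<le> measure \<tau> A) \<and>
    (\<forall>x. measure \<tau> {x} = \<bar>sm_val \<gamma> {x}\<bar>) \<and>
    (\<forall>c d \<delta>. c < d \<longrightarrow> 0 < \<delta> \<longrightarrow> (\<exists>\<phi> \<phi>'. testfun c d \<phi> \<phi>' \<and> (\<forall>x. \<bar>\<phi> x\<bar> \<le> 1) \<and>
       measure \<tau> {c<..<d} - \<delta> < sm_int \<gamma> \<phi>))"
proof -
  note s = smD[OF \<gamma>]
  define M where "M = sum_measure (fst \<gamma>) (snd \<gamma>)"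
  have M: "finite_borel_measure M"
    using s finite_measure_sum_measure[of "fst \<gamma>" "snd \<gamma>"]
    by (auto simp: M_def finite_borel_measure_def finite_borel_measure_axioms_def)
  interpret finite_borel_measure M by fact
  note [measurable_cong] = M_is_borel
  have le: "emeasure (fst \<gamma>) A \<le> emeasure M A" "emeasure (snd \<gamma>) A \<le> emeasure M A" if "A \<in> sets borel" for A
    using s that by (auto simp: M_def emeasure_sum_measure)
  obtain p where p [measurable]: "p \<in> borel_measurable borel" and p0: "\<And>x. 0 \<le> p x" and pi: "integrable M p"
    and P: "fst \<gamma> = density M (\<lambda>x. ennreal (p x))" using RN_real_density[OF M s(1) le(1)] by blast
  obtain n where n [measurable]: "n \<in> borel_measurable borel" and n0: "\<And>x. 0 \<le> n x" and ni: "integrable M n"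
    and N: "snd \<gamma> = density M (\<lambda>x. ennreal (n x))" using RN_real_density[OF M s(2) le(2)] by blast
  define q where "q x = p x - n x" for x
  have qm [measurable]: "q \<in> borel_measurable borel" unfolding q_def by measurable
  have qi: "integrable M q" unfolding q_def using pi ni by simp
  have bi: "integrable M (\<lambda>x. k x * f x)" if "integrable M k" "f \<in> borel_measurable borel" "\<And>x. \<bar>f x\<bar> \<le> 1" for k f :: "real \<Rightarrow> real"
  proof (rule Bochner_Integration.integrable_bound[OF that(1)])
    show "AE x in M. norm (k x * f x) \<le> norm (k x)"
      using that(3) by (intro AE_I2) (auto simp: abs_mult intro!: mult_left_le)
  qed (use that in measurable)
  have int: "sm_int \<gamma> \<phi> = (LINT x|M. q x * \<phi> x)" if \<phi>: "\<phi> \<in> borel_measurable borel" "\<And>x. \<bar>\<phi> x\<bar> \<le> 1" for \<phi>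
    unfolding sm_int_def P N finite_borel_density(2)[OF M pi p0 \<phi>(1)] finite_borel_density(2)[OF M ni n0 \<phi>(1)]
    using bi[OF pi \<phi>] bi[OF ni \<phi>] by (simp add: q_def left_diff_distrib)
  have val: "sm_val \<gamma> A = (LINT x|M. q x * indicator A x)" if "A \<in> sets borel" for A
    using int[of "indicator A"] sm_int_indicator[OF \<gamma> that] that by (simp add: indicator_def)
  define \<tau> where "\<tau> = density M (\<lambda>x. ennreal \<bar>q x\<bar>)"
  have qa: "integrable M (\<lambda>x. \<bar>q x\<bar>)" using qi by simp
  note \<tau> = finite_borel_density[OF M qa abs_ge_zero, folded \<tau>_def]
  have 1: "\<bar>sm_val \<gamma> A\<bar> \<le> measure \<tau> A" if A: "A \<in> sets borel" for A
  proof -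
    have "\<bar>sm_val \<gamma> A\<bar> \<le> (LINT x|M. \<bar>q x * indicator A x\<bar>)"
      unfolding val[OF A] by (rule integral_abs_bound)
    also have "\<dots> = measure \<tau> A" unfolding \<tau>(3)[OF A] by (simp add: abs_mult)
    finally show ?thesis .
  qed
  have 2: "measure \<tau> {x} = \<bar>sm_val \<gamma> {x}\<bar>" for x
  proof -
    have "(\<lambda>t. f t * indicator {x} t) = (\<lambda>t. f x * indicator {x} t)" for f :: "real \<Rightarrow> real"
      by (auto simp: indicator_def)
    note eq = this[of q] this[of "\<lambda>t. \<bar>q t\<bar>"]
    show ?thesis using \<tau>(3)[of "{x}"] val[of "{x}"] unfolding eq by (simp add: abs_mult borel_UNIV)
  qed
  have 3: "\<exists>\<phi> \<phi>'. testfun c d \<phi> \<phi>' \<and> (\<forall>x. \<bar>\<phi> x\<bar> \<le> 1) \<and> measure \<tau> {c<..<d} - \<delta> < sm_int \<gamma> \<phi>"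
    if cd: "c < d" and \<delta>: "0 < \<delta>" for c d \<delta>
  proof -
    \<comment> \<open>The approximation of \<open>sgn (q x)\<close> is measured by
      \<open>|q| M\<close> restricted to the interval, so its error is exactly the loss in the
      pairing; outside the interval \<open>\<phi>\<close> vanishes.\<close>
    define k where "k x = \<bar>q x\<bar> * indicator {c<..<d} x" for x
    have k0: "0 \<le> k x" for x by (simp add: k_def)
    have ki: "integrable M k" unfolding k_def by (rule bi[OF qa]) (auto simp: indicator_def)
    note K = finite_borel_density[OF M ki k0]
    have AE: "AE x in density M (\<lambda>x. ennreal (k x)). x \<in> {c<..<d}"
      using ki by (subst AE_density) (auto simp: k_def indicator_def)
    have sg: "(\<lambda>x. sgn (q x)) \<in> borel_measurable borel" by measurable
    have sg1: "\<bar>sgn (q x)\<bar> \<le> 1" for x by (simp add: sgn_real_def)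
    obtain \<phi> \<phi>' where \<phi>: "testfun c d \<phi> \<phi>'" "\<And>x. \<bar>\<phi> x\<bar> \<le> 1"
      and small: "(LINT x|density M (\<lambda>x. ennreal (k x)). \<bar>\<phi> x - sgn (q x)\<bar>) < \<delta>"
      using testfun_dense[OF K(1) cd AE sg sg1 \<delta>] by blast
    note pm [measurable] = testfun_props(1)[OF \<phi>(1)]
    have small': "(LINT x|M. k x * \<bar>\<phi> x - sgn (q x)\<bar>) < \<delta>"
      using small K(2)[of "\<lambda>x. \<bar>\<phi> x - sgn (q x)\<bar>"] by simp
    have ik: "integrable M (\<lambda>x. k x * \<bar>\<phi> x - sgn (q x)\<bar>)"
    proof -
      have "\<bar>\<phi> x - sgn (q x)\<bar> \<le> 2" for x using \<phi>(2)[of x] sg1[of x] by linarith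
      then have "integrable M (\<lambda>x. (2 * k x) * (\<bar>\<phi> x - sgn (q x)\<bar> / 2))"
        by (intro bi[where k="\<lambda>x. 2 * k x"]) (use ki in auto)
      then show ?thesis by simp
    qed
    have "measure \<tau> {c<..<d} - (LINT x|M. k x * \<bar>\<phi> x - sgn (q x)\<bar>) = (LINT x|M. k x - k x * \<bar>\<phi> x - sgn (q x)\<bar>)"
      using \<tau>(3)[of "{c<..<d}"] ki ik by (simp flip: k_def)
    also have "\<dots> \<le> (LINT x|M. q x * \<phi> x)"
    proof (rule integral_mono)
      fix x
      show "k x - k x * \<bar>\<phi> x - sgn (q x)\<bar> \<le> q x * \<phi> x"
      proof (cases "x \<in> {c<..<d}")
        case True
        have "\<bar>q x\<bar> - q x * \<phi> x = q x * (sgn (q x) - \<phi> x)" by (simp add: right_diff_distrib abs_sgn)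
        also have "\<dots> \<le> \<bar>q x\<bar> * \<bar>\<phi> x - sgn (q x)\<bar>"
          using abs_ge_self[of "q x * (sgn (q x) - \<phi> x)"] by (simp add: abs_mult abs_minus_commute)
        finally show ?thesis using True by (simp add: k_def)
      next
        case False
        then show ?thesis using testfun_props(4)[OF \<phi>(1) False] by (simp add: k_def)
      qed
    qed (use ki ik bi[OF qi pm \<phi>(2)] in auto)
    also have "\<dots> = sm_int \<gamma> \<phi>" using int[OF pm \<phi>(2)] by simp
    finally show ?thesis using small' \<phi> by (intro exI[of _ \<phi>] exI[of _ \<phi>']) auto
  qed
  show ?thesis using \<tau>(1) 1 2 3 by blast
qed

text \<open>Without atoms the distribution function is continuous, hence uniformly continuous on the
  compact interval, and its increments dominate the masses of open intervals.\<close>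

lemma nonatomic_small_intervals:
  assumes \<rho>: "finite_borel_measure \<rho>" and na: "\<And>x. measure \<rho> {x} = 0" and "0 < e"
  shows "\<exists>r>0. \<forall>x\<in>{p..q}. \<forall>y\<in>{p..q}. x < y \<longrightarrow> y - x < r \<longrightarrow> measure \<rho> {x<..<y} < e"
proof -
  interpret finite_borel_measure \<rho> by fact
  have "continuous_on {p..q} (cdf \<rho>)"
    using isCont_cdf na by (intro continuous_at_imp_continuous_on) auto
  then have "uniformly_continuous_on {p..q} (cdf \<rho>)"
    by (rule compact_uniformly_continuous) simp
  then obtain r where r: "0 < r" "\<And>x y. x \<in> {p..q} \<Longrightarrow> y \<in> {p..q} \<Longrightarrow> dist x y < r \<Longrightarrow> dist (cdf \<rho> x) (cdf \<rho> y) < e"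
    unfolding uniformly_continuous_on_def using \<open>0 < e\<close> by metis
  have "measure \<rho> {x<..<y} < e" if "x \<in> {p..q}" "y \<in> {p..q}" "x < y" "y - x < r" for x y
  proof -
    have "measure \<rho> {x<..<y} \<le> measure \<rho> {x<..y}"
      using M_is_borel by (intro finite_measure_mono) auto
    also have "\<dots> = cdf \<rho> y - cdf \<rho> x" using cdf_diff_eq[OF that(3)] by simp
    also have "\<dots> < e" using r(2)[of x y] that by (auto simp: dist_real_def)
    finally show ?thesis .
  qed
  then show ?thesis using r(1) by blast
qed

lemma finite_separated:
  fixes F :: "real set"
  assumes "finite F"
  shows "\<exists>r>0. \<forall>x\<in>F. \<forall>y\<in>F. x \<noteq> y \<longrightarrow> r \<le> \<bar>x - y\<bar>"
proof -
  have "finite ((\<lambda>(x, y). x - y) ` (F \<times> F))" using assms by auto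
  from finite_set_avoid[OF this, of 0]
  obtain r where "0 < r" "\<forall>z\<in>(\<lambda>(x, y). x - y) ` (F \<times> F). z \<noteq> 0 \<longrightarrow> r \<le> dist 0 z" by blast
  then show ?thesis by (intro exI[of _ r]) (auto simp: dist_real_def)
qed

text \<open>On a grid that is fine enough, no cell contains two points of \<open>F\<close> and the nonatomic part of
  every cell is negligible against 2, so that truncating the mass of the cells at 2 acts only on
  the atoms.\<close>

lemma grid_mass:
  assumes \<tau>: "finite_borel_measure \<tau>" and "a < b" and B: "B \<in> sets borel" "B \<subseteq> {a<..<b}"
    and F: "finite F" "F \<subseteq> {a<..<b}" and na: "\<And>x. x \<in> B \<Longrightarrow> measure \<tau> {x} = 0" and "0 < \<delta>"
  shows "\<exists>(I::nat set) \<alpha> \<beta>. finite I \<and> disjoint_family_on (\<lambda>i. {\<alpha> i<..<\<beta> i}) I \<and>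
    (\<forall>i\<in>I. \<alpha> i < \<beta> i \<and> {\<alpha> i<..<\<beta> i} \<subseteq> {a<..<b}) \<and>
    (\<Sum>x\<in>F. min 2 (measure \<tau> {x})) + measure \<tau> B - \<delta> < (\<Sum>i\<in>I. min 2 (measure \<tau> {\<alpha> i<..<\<beta> i}))"
proof -
  interpret finite_borel_measure \<tau> by fact
  note [measurable_cong] = M_is_borel
  \<comment> \<open>\<open>\<rho>\<close> is the restriction of \<open>\<tau>\<close> to
    \<open>B\<close>. It has no atoms at all, whatever atoms \<open>\<tau>\<close> has outside
    \<open>B\<close>.\<close>
  define \<rho> where "\<rho> = density \<tau> (\<lambda>x. ennreal (indicator B x))"
  have iB: "integrable \<tau> (indicator B :: real \<Rightarrow> real)"
    using B M_is_borel by (simp add: integrable_indicator_iff emeasure_eq_measure)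
  have \<rho>: "finite_borel_measure \<rho>"
    unfolding \<rho>_def using finite_borel_density(1)[OF \<tau> iB] by simp
  have \<rho>m: "measure \<rho> A = measure \<tau> (A \<inter> B)" if "A \<in> sets borel" for A
  proof -
    have "measure \<rho> A = (LINT x|\<tau>. indicator B x * indicator A x)"
      unfolding \<rho>_def using finite_borel_density(3)[OF \<tau> iB _ that] by simp
    also have "(\<lambda>x. indicator B x * indicator A x :: real) = indicator (A \<inter> B)"
      by (auto simp: indicator_def fun_eq_iff)
    finally show ?thesis by (simp add: borel_UNIV)
  qed
  interpret \<rho>: finite_borel_measure \<rho> by fact
  have \<rho>0: "measure \<rho> {x} = 0" for x
    using \<rho>m[of "{x}"] na[of x] by (cases "x \<in> B") auto
  \<comment> \<open>The bound 1 keeps the \<open>\<rho>\<close> mass of every cell below the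
    truncation; the other bound keeps the total loss, one \<open>e\<close> for each point of
    \<open>F\<close>, below \<open>\<delta>\<close>. The summand 1 covers an empty
    \<open>F\<close>.\<close>
  define e where "e = min 1 (\<delta> / (real (card F) + 1))"
  have e: "0 < e" "e \<le> 1" "real (card F) * e < \<delta>"
  proof -
    show "0 < e" using \<open>0 < \<delta>\<close> by (simp add: e_def)
    show "e \<le> 1" by (simp add: e_def)
    have "real (card F) * e \<le> real (card F) * (\<delta> / (real (card F) + 1))"
      by (intro mult_left_mono) (auto simp: e_def)
    also have "\<dots> < \<delta>" using \<open>0 < \<delta>\<close> by (simp add: field_simps)
    finally show "real (card F) * e < \<delta>" .
  qed
  obtain r0 where r0: "0 < r0" "\<And>x y. x \<in> {a..b} \<Longrightarrow> y \<in> {a..b} \<Longrightarrow> x < y \<Longrightarrow> y - x < r0 \<Longrightarrow> measure \<rho> {x<..<y} < e"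
    using nonatomic_small_intervals[OF \<rho> \<rho>0 e(1), of a b] by blast
  obtain r1 where r1: "0 < r1" "\<And>x y. x \<in> F \<Longrightarrow> y \<in> F \<Longrightarrow> x \<noteq> y \<Longrightarrow> r1 \<le> \<bar>x - y\<bar>"
    using finite_separated[OF F(1)] by blast
  \<comment> \<open>The half gives \<open>r < r0\<close>, hence small \<open>\<rho>\<close> mass in
    every cell, and \<open>r \<le> r1\<close> keeps an open cell from containing two points of
    \<open>F\<close>.\<close>
  define r where "r = min (r0 / 2) r1"
  have r: "0 < r" "r < r0" "r \<le> r1" using r0(1) r1(1) by (auto simp: r_def min_def)
  obtain n where n: "(b - a + r) / r < real n" using reals_Archimedean2 by blast
  \<comment> \<open>Only finitely many starting points would put a grid point into \<open>F\<close>,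
    so the grid can be shifted off \<open>F\<close>. An atom on a grid point would be missed by all
    open cells.\<close>
  have "infinite ({a - r<..<a} - (\<lambda>(x, i). x - real i * r) ` (F \<times> {..n}))"
    using r(1) F(1) by (intro Diff_infinite_finite) auto
  then have "{a - r<..<a} - (\<lambda>(x, i). x - real i * r) ` (F \<times> {..n}) \<noteq> {}"
    by (rule infinite_imp_nonempty)
  then obtain t0 where t0': "t0 \<in> {a - r<..<a}" "t0 \<notin> (\<lambda>(x, i). x - real i * r) ` (F \<times> {..n})"
    by blast
  then have t0: "a - r < t0" "t0 < a" "\<And>x i. x \<in> F \<Longrightarrow> i \<le> n \<Longrightarrow> t0 \<noteq> x - real i * r"
    by force+
  define t where "t i = t0 + real i * r" for i
  have tF: "t i \<notin> F" if "i \<le> n" for i using t0(3)[of "t i" i] that by (auto simp: t_def)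
  have tS: "t (Suc i) = t i + r" for i by (simp add: t_def algebra_simps)
  have tn: "b < t n" using n t0(1) r(1) by (simp add: t_def field_simps)
  define \<alpha> where "\<alpha> i = max a (t i)" for i
  define \<beta> where "\<beta> i = min b (t (Suc i))" for i
  define C where "C i = {\<alpha> i<..<\<beta> i}" for i
  have cell: "(\<exists>i<n. x \<in> C i) \<or> (\<exists>i\<le>n. x = t i)" if x: "x \<in> {a<..<b}" for x
  proof -
    define i where "i = nat \<lfloor>(x - t0) / r\<rfloor>"
    have nn: "0 \<le> (x - t0) / r" using x t0(2) r(1) by simp
    have i: "real i \<le> (x - t0) / r" "(x - t0) / r < real i + 1"
      using nn unfolding i_def by (auto simp: of_nat_nat)
    have ti: "t i \<le> x" "x < t (Suc i)" using i r(1) by (auto simp: t_def field_simps)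
    have "i < n"
    proof (rule ccontr)
      assume "\<not> i < n"
      then have "real n * r \<le> real i * r" using r(1) by (intro mult_right_mono) auto
      then show False using ti(1) tn x by (auto simp: t_def)
    qed
    show ?thesis
    proof (cases "x = t i")
      case True
      then show ?thesis using \<open>i < n\<close> by (blast intro: less_imp_le)
    next
      case False
      then have "x \<in> C i" using ti x by (auto simp: C_def \<alpha>_def \<beta>_def)
      then show ?thesis using \<open>i < n\<close> by blast
    qed
  qed
  have mono: "t (Suc i) \<le> t j" if "i < j" for i j
  proof -
    have "real (Suc i) * r \<le> real j * r" using that r(1) by (intro mult_right_mono) auto
    then show ?thesis by (simp add: t_def)
  qed
  have disj: "C i \<inter> C j = {}" if "i \<noteq> j" for i j
    using mono[of i j] mono[of j i] that by (cases "i < j") (auto simp: C_def \<alpha>_def \<beta>_def)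
  have Cb: "C i \<in> sets borel" for i by (simp add: C_def)
  have Csub: "C i \<subseteq> {a<..<b}" for i by (auto simp: C_def \<alpha>_def \<beta>_def)
  have \<rho>e: "measure \<rho> (C i) < e" for i
  proof (cases "\<alpha> i < \<beta> i")
    case True
    then show ?thesis unfolding C_def using r(2) \<open>a < b\<close> tS[of i]
      by (intro r0(2)) (auto simp: \<alpha>_def \<beta>_def)
  next
    case False
    then have "C i = {}" by (simp add: C_def)
    then show ?thesis using e(1) by simp
  qed
  have one: "x = y" if "x \<in> F \<inter> C i" "y \<in> F \<inter> C i" for x y i
  proof (rule ccontr)
    assume "x \<noteq> y"
    then have "r1 \<le> \<bar>x - y\<bar>" using r1(2) that by blast
    then show False using that r(3) tS[of i] by (auto simp: C_def \<alpha>_def \<beta>_def)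
  qed
  \<comment> \<open>A cell with a point of \<open>F\<close> counts only that atom: its
    \<open>\<rho>\<close> mass is below \<open>e\<close> and is offset by the subtracted
    \<open>e\<close>. In any other cell the \<open>\<rho>\<close> mass is below 1, so truncation at
    2 leaves it intact.\<close>
  have cellwise: "measure \<rho> (C i) + (\<Sum>x\<in>F \<inter> C i. min 2 (measure \<tau> {x}) - e) \<le> min 2 (measure \<tau> (C i))" for i
  proof (cases "F \<inter> C i = {}")
    case True
    have "measure \<rho> (C i) \<le> measure \<tau> (C i)"
      unfolding \<rho>m[OF Cb] using Cb B M_is_borel by (intro finite_measure_mono) auto
    then show ?thesis using True \<rho>e[of i] e(2) by simp
  next
    case False
    then obtain x where x: "F \<inter> C i = {x}" using one by blast
    then have "measure \<tau> {x} \<le> measure \<tau> (C i)"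
      using Cb M_is_borel by (intro finite_measure_mono) auto
    then have "min 2 (measure \<tau> {x}) \<le> min 2 (measure \<tau> (C i))" by (rule min.mono[OF order_refl])
    moreover have "(\<Sum>x\<in>F \<inter> C i. min 2 (measure \<tau> {x}) - e) = min 2 (measure \<tau> {x}) - e"
      unfolding x by simp
    ultimately show ?thesis using \<rho>e[of i] by linarith
  qed
  \<comment> \<open>The open cells miss only grid points, which are null for
    \<open>\<rho>\<close>.\<close>
  have "measure \<tau> B \<le> (\<Sum>i<n. measure \<rho> (C i))"
  proof -
    have "measure \<tau> B = measure \<rho> {a<..<b}" using \<rho>m[of "{a<..<b}"] B(2) by (simp add: Int_absorb1)
    also have "\<dots> \<le> measure \<rho> ((\<Union>i<n. C i) \<union> (\<Union>i\<le>n. {t i}))"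
    proof (rule \<rho>.finite_measure_mono)
      show "{a<..<b} \<subseteq> (\<Union>i<n. C i) \<union> (\<Union>i\<le>n. {t i})" using cell by blast
      show "(\<Union>i<n. C i) \<union> (\<Union>i\<le>n. {t i}) \<in> sets \<rho>" using Cb by (auto simp: \<rho>.M_is_borel)
    qed
    also have "\<dots> \<le> measure \<rho> (\<Union>i<n. C i) + measure \<rho> (\<Union>i\<le>n. {t i})"
      using Cb by (intro measure_Un_le) (auto simp: \<rho>.M_is_borel)
    also have "measure \<rho> (\<Union>i<n. C i) \<le> (\<Sum>i<n. measure \<rho> (C i))"
      using Cb by (intro measure_UNION_le) (auto simp: \<rho>.M_is_borel)
    also have "measure \<rho> (\<Union>i\<le>n. {t i}) \<le> (\<Sum>i\<le>n. measure \<rho> {t i})"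
      by (intro measure_UNION_le) (auto simp: \<rho>.M_is_borel)
    finally show ?thesis using \<rho>0 by simp
  qed
  moreover have "(\<Sum>x\<in>F. min 2 (measure \<tau> {x}) - e) = (\<Sum>i<n. \<Sum>x\<in>F \<inter> C i. min 2 (measure \<tau> {x}) - e)"
  proof -
    have "F = (\<Union>i<n. F \<inter> C i)" using F(2) cell tF by blast
    moreover have "(\<Sum>x\<in>(\<Union>i<n. F \<inter> C i). min 2 (measure \<tau> {x}) - e) = (\<Sum>i<n. \<Sum>x\<in>F \<inter> C i. min 2 (measure \<tau> {x}) - e)"
      using F(1) disj by (intro sum.UNION_disjoint) auto
    ultimately show ?thesis by metis
  qed
  moreover have "(\<Sum>x\<in>F. min 2 (measure \<tau> {x}) - e) = (\<Sum>x\<in>F. min 2 (measure \<tau> {x})) - real (card F) * e"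
    by (simp add: sum_subtractf)
  ultimately have "(\<Sum>x\<in>F. min 2 (measure \<tau> {x})) + measure \<tau> B - \<delta> <
      (\<Sum>i<n. measure \<rho> (C i) + (\<Sum>x\<in>F \<inter> C i. min 2 (measure \<tau> {x}) - e))"
    using e(3) by (simp add: sum.distrib)
  also have "\<dots> \<le> (\<Sum>i<n. min 2 (measure \<tau> (C i)))" by (intro sum_mono cellwise)
  \<comment> \<open>Clipping to \<open>{a<..<b}\<close> may leave cells empty. They contribute 0 and
    are dropped, because every remaining cell must be a proper interval to carry a test
    function.\<close>
  also have "\<dots> = (\<Sum>i\<in>{i. i < n \<and> \<alpha> i < \<beta> i}. min 2 (measure \<tau> (C i)))"
  proof (rule sum.mono_neutral_right)
    show "\<forall>i\<in>{..<n} - {i. i < n \<and> \<alpha> i < \<beta> i}. min 2 (measure \<tau> (C i)) = 0"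
    proof
      fix i assume "i \<in> {..<n} - {i. i < n \<and> \<alpha> i < \<beta> i}"
      then have "C i = {}" by (auto simp: C_def)
      then show "min 2 (measure \<tau> (C i)) = 0" by simp
    qed
  qed auto
  finally show ?thesis
    using disj Csub unfolding C_def
    by (intro exI[of _ "{i. i < n \<and> \<alpha> i < \<beta> i}"] exI[of _ \<alpha>] exI[of _ \<beta>]) (auto simp: disjoint_family_on_def)
qed

section \<open>The lower bound\<close>

lemma liminf_cmult_ennreal:
  fixes x :: "nat \<Rightarrow> ennreal"
  shows "c * liminf x \<le> liminf (\<lambda>n. c * x n)"
  unfolding liminf_SUP_INF SUP_mult_left_ennreal
  by (intro SUP_mono' INF_greatest mult_left_mono INF_lower) auto

lemma infsum_measure_singletons:
  assumes M: "finite_borel_measure M" and S: "countable S"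
  shows "(\<lambda>x. measure M {x}) summable_on S" "(\<Sum>\<^sub>\<infinity>x\<in>S. measure M {x}) = measure M S"
proof -
  interpret finite_borel_measure M by fact
  have "emeasure M S = (\<integral>\<^sup>+x. emeasure M {x} \<partial>count_space S)"
    using S M_is_borel by (intro emeasure_countable_singleton) auto
  then have nn: "(\<integral>\<^sup>+x. ennreal (measure M {x}) \<partial>count_space S) = ennreal (measure M S)"
    by (simp add: emeasure_eq_measure)
  have abs: "Infinite_Set_Sum.abs_summable_on (\<lambda>x. measure M {x}) S"
    unfolding Infinite_Set_Sum.abs_summable_on_def
    using nn by (intro integrableI_nonneg) auto
  then have "(\<lambda>x. norm (measure M {x})) summable_on S"
    using abs_summable_equivalent[of "\<lambda>x. measure M {x}" S] by simp
  then show "(\<lambda>x. measure M {x}) summable_on S" by simp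
  show "(\<Sum>\<^sub>\<infinity>x\<in>S. measure M {x}) = measure M S"
    unfolding infsetsum_infsum[OF abs, symmetric]
    by (subst infsetsum_conv_nn_integral) (auto simp: nn)
qed

lemma sm_val_countable:
  assumes \<sigma>: "sm a b \<sigma>" and S: "countable S"
  shows "(\<Sum>\<^sub>\<infinity>x\<in>S. sm_val \<sigma> {x}) = sm_val \<sigma> S"
proof -
  note 1 = infsum_measure_singletons[OF smD(1)[OF \<sigma>] S] and 2 = infsum_measure_singletons[OF smD(2)[OF \<sigma>] S]
  have "(\<Sum>\<^sub>\<infinity>x\<in>S. measure (fst \<sigma>) {x} + - measure (snd \<sigma>) {x}) =
      (\<Sum>\<^sub>\<infinity>x\<in>S. measure (fst \<sigma>) {x}) + (\<Sum>\<^sub>\<infinity>x\<in>S. - measure (snd \<sigma>) {x})"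
    using 1(1) 2(1) by (intro infsum_add) (auto simp: summable_on_uminus)
  then show ?thesis using 1(2) 2(2) by (simp add: sm_val_def infsum_uminus)
qed

text \<open>Enumerating \<open>J\<close> exhausts it by finite sets, and monotone convergence turns
  the integral into a supremum of finite sums. The summand \<open>x\<close> stays inside the
  supremum, so a joint bound on \<open>x\<close> and the finite sums is enough.\<close>

lemma add_nn_integral_count_space_le:
  assumes "countable J" and le: "\<And>F. finite F \<Longrightarrow> F \<subseteq> J \<Longrightarrow> x + (\<Sum>y\<in>F. f y) \<le> (L::ennreal)"
  shows "x + (\<integral>\<^sup>+y. f y \<partial>count_space J) \<le> L"
proof (cases "J = {}")
  case True
  then show ?thesis using le[of "{}"] by (simp add: nn_integral_count_space_finite)
next
  case False
  define F where "F n = from_nat_into J ` {..n}" for n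
  have F: "finite (F n)" "F n \<subseteq> J" for n
    using from_nat_into[OF False] by (auto simp: F_def)
  have "(\<integral>\<^sup>+y. f y \<partial>count_space J) = (\<integral>\<^sup>+y. (SUP n. f y * indicator (F n) y) \<partial>count_space J)"
  proof (rule nn_integral_cong)
    fix y assume "y \<in> space (count_space J)"
    then obtain n where "y = from_nat_into J n"
      using from_nat_into_surj[OF \<open>countable J\<close>] by (metis space_count_space)
    then have "f y \<le> (SUP n. f y * indicator (F n) y)"
      by (intro SUP_upper2[of n]) (auto simp: F_def)
    moreover have "(SUP n. f y * indicator (F n) y) \<le> f y"
      by (intro SUP_least) (auto simp: indicator_def)
    ultimately show "f y = (SUP n. f y * indicator (F n) y)" by (rule antisym)
  qed
  also have "\<dots> = (SUP n. \<integral>\<^sup>+y. f y * indicator (F n) y \<partial>count_space J)"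
  proof (rule nn_integral_monotone_convergence_SUP)
    show "incseq (\<lambda>n y. f y * indicator (F n) y)"
      by (intro incseq_SucI le_funI mult_left_mono indicator_leI) (auto simp: F_def)
  qed simp
  also have "\<dots> = (SUP n. \<Sum>y\<in>F n. f y)"
  proof (rule SUP_cong[OF refl])
    fix n
    have "(\<integral>\<^sup>+y. f y * indicator (F n) y \<partial>count_space J) = (\<Sum>y\<in>F n. f y * indicator (F n) y)"
      using F[of n] by (intro nn_integral_count_space') auto
    also have "\<dots> = (\<Sum>y\<in>F n. f y)" by (intro sum.cong) auto
    finally show "(\<integral>\<^sup>+y. f y * indicator (F n) y \<partial>count_space J) = (\<Sum>y\<in>F n. f y)" .
  qed
  finally have "x + (\<integral>\<^sup>+y. f y \<partial>count_space J) = (SUP n. x + (\<Sum>y\<in>F n. f y))"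
    by (simp add: ennreal_SUP_add_right)
  also have "\<dots> \<le> L" using le F by (intro SUP_least) auto
  finally show ?thesis .
qed

section \<open>Atoms, jumps and the Cantor part\<close>

lemma set_integral_null:
  fixes f :: "real \<Rightarrow> real"
  assumes "A \<in> sets borel" "emeasure lborel A = 0"
  shows "(LINT x:A|lborel. f x) = 0"
proof -
  have "AE x in lborel. x \<notin> A" using assms by (intro AE_not_in) (auto simp: null_sets_def)
  then have "AE x in lborel. indicator A x *\<^sub>R f x = 0" by eventually_elim simp
  then show ?thesis unfolding set_lebesgue_integral_def by (rule integral_eq_zero_AE)
qed

text \<open>Single points are Lebesgue null, so \<open>Du\<close>, \<open>\<sigma>\<close> and
  \<open>\<gamma>\<close> have the same atoms in \<open>(a,b)\<close>, and for \<open>Du\<close>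
  these are the jumps of \<open>u\<close>.\<close>

lemma E_adm_jump:
  assumes "a < b" and adm: "E_adm a b K u \<gamma> (Du, h, \<sigma>, g)" and x: "x \<in> {a<..<b}"
  shows "jump u x = sm_val \<sigma> {x}" "sm_val \<gamma> {x} = sm_val \<sigma> {x}"
    "x \<in> jump_set a b u \<longleftrightarrow> sm_val \<sigma> {x} \<noteq> 0"
proof -
  have Du: "BV_deriv a b u Du"
    and val: "\<forall>A \<in> sets borel. A \<subseteq> {a<..<b} \<longrightarrow> sm_val Du A = (LINT x:A|lborel. h x) + sm_val \<sigma> A"
    and \<gamma>: "\<forall>A \<in> sets borel. A \<subseteq> {a<..<b} \<longrightarrow> sm_val \<gamma> A = sm_val \<sigma> A + (LINT x:A|lborel. g x)"
    using adm by (auto simp: E_adm_def BV_decomp_def)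
  have "sm_val Du {x} = sm_val \<sigma> {x}" using val x by (simp add: set_integral_null)
  then show "jump u x = sm_val \<sigma> {x}" "x \<in> jump_set a b u \<longleftrightarrow> sm_val \<sigma> {x} \<noteq> 0"
    using jump_eq_sm_val[OF \<open>a < b\<close> Du x] jump_set_iff_sm_val[OF \<open>a < b\<close> Du x] by auto
  show "sm_val \<gamma> {x} = sm_val \<sigma> {x}" using \<gamma> x by (simp add: set_integral_null)
qed

lemma countable_jump_set:
  assumes "a < b" and adm: "E_adm a b K u \<gamma> (Du, h, \<sigma>, g)"
  shows "countable (jump_set a b u)"
proof -
  have \<sigma>: "sm a b \<sigma>" using adm by (auto simp: E_adm_def BV_decomp_def sm_singular_def)
  have "jump_set a b u \<subseteq> {x. measure (fst \<sigma>) {x} > 0} \<union> {x. measure (snd \<sigma>) {x} > 0}"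
  proof
    fix x assume x: "x \<in> jump_set a b u"
    then have "x \<in> {a<..<b}" by (auto simp: jump_set_def)
    with E_adm_jump(3)[OF \<open>a < b\<close> adm this] x have "sm_val \<sigma> {x} \<noteq> 0" by simp
    then show "x \<in> {x. measure (fst \<sigma>) {x} > 0} \<union> {x. measure (snd \<sigma>) {x} > 0}"
      by (auto simp: sm_val_def zero_less_measure_iff)
  qed
  moreover have "countable ({x. measure (fst \<sigma>) {x} > 0} \<union> {x. measure (snd \<sigma>) {x} > 0})"
    using finite_borel_measure.countable_atoms[OF smD(1)[OF \<sigma>]] finite_borel_measure.countable_atoms[OF smD(2)[OF \<sigma>]] by simp
  ultimately show ?thesis by (rule countable_subset)
qed

text \<open>A Lebesgue null set \<open>N\<close> carries \<open>\<sigma>\<close> and contains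
  \<open>J\<close>. Off \<open>N\<close> the measure \<open>\<gamma>\<close> acts as
  \<open>g dx\<close>; on \<open>N - J\<close> it acts as \<open>\<sigma>\<close> without its atoms,
  which is the Cantor part. The two carriers are disjoint, so both variations fit side by side into
  the \<open>\<tau>\<close> mass outside \<open>J\<close>.\<close>

lemma singular_part_le_variation:
  assumes "a < b" and adm: "E_adm a b K u \<gamma> (Du, h, \<sigma>, g)"
    and \<tau>: "finite_borel_measure \<tau>" "\<And>A. A \<in> sets borel \<Longrightarrow> \<bar>sm_val \<gamma> A\<bar> \<le> measure \<tau> A"
    and P: "finite P" "disjoint P" "P \<subseteq> sets borel" "\<Union>P \<subseteq> {a<..<b}"
  defines "J \<equiv> jump_set a b u"
  shows "(LINT x:{a<..<b}|lborel. \<bar>g x\<bar>) + (\<Sum>A\<in>P. \<bar>sm_val \<sigma> A - (\<Sum>\<^sub>\<infinity>x\<in>A \<inter> J. jump u x)\<bar>)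
    \<le> measure \<tau> ({a<..<b} - J)"
proof -
  interpret finite_borel_measure \<tau> by fact
  have g: "set_integrable lborel {a<..<b} g" and sing: "sm_singular a b \<sigma>"
    and \<gamma>: "\<And>A. A \<in> sets borel \<Longrightarrow> A \<subseteq> {a<..<b} \<Longrightarrow> sm_val \<gamma> A = sm_val \<sigma> A + (LINT x:A|lborel. g x)"
    using adm by (auto simp: E_adm_def BV_decomp_def)
  have \<sigma>: "sm a b \<sigma>" using sing by (simp add: sm_singular_def)
  interpret \<sigma>1: finite_borel_measure "fst \<sigma>" by (rule smD(1)[OF \<sigma>])
  interpret \<sigma>2: finite_borel_measure "snd \<sigma>" by (rule smD(2)[OF \<sigma>])
  obtain N where N [measurable]: "N \<in> sets borel" and N0: "emeasure lborel N = 0"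
    and N1: "emeasure (fst \<sigma>) (UNIV - N) = 0" "emeasure (snd \<sigma>) (UNIV - N) = 0"
    using sing by (auto simp: sm_singular_def)
  have off: "sm_val \<sigma> A = 0" if "A \<in> sets borel" "A \<inter> N = {}" for A
  proof -
    have "A \<subseteq> UNIV - N" using that by auto
    then have "emeasure (fst \<sigma>) A \<le> 0" "emeasure (snd \<sigma>) A \<le> 0"
      using N1 emeasure_mono[of A "UNIV - N" "fst \<sigma>"] emeasure_mono[of A "UNIV - N" "snd \<sigma>"]
        \<sigma>1.M_is_borel \<sigma>2.M_is_borel N by auto
    then show ?thesis by (simp add: sm_val_def measure_def)
  qed
  have Jc: "countable J" unfolding J_def using \<open>a < b\<close> adm by (rule countable_jump_set)
  have Jsub: "J \<subseteq> {a<..<b}" by (auto simp: J_def jump_set_def)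
  have cb: "S \<in> sets borel" if "countable S" for S :: "real set"
    using that by (rule sets.countable[rotated]) simp
  have Jb [measurable]: "J \<in> sets borel" using Jc by (rule cb)
  \<comment> \<open>Each jump point is charged by \<open>\<sigma>\<close>, which vanishes off
    \<open>N\<close>.\<close>
  have JN: "J \<subseteq> N"
  proof
    fix x assume x: "x \<in> J"
    then have "sm_val \<sigma> {x} \<noteq> 0" using E_adm_jump(3)[OF \<open>a < b\<close> adm, of x] Jsub by (auto simp: J_def)
    then show "x \<in> N" using off[of "{x}"] by auto
  qed
  have ab [measurable]: "{a<..<b} \<in> sets borel" by simp
  have 1: "(LINT x:{a<..<b}|lborel. \<bar>g x\<bar>) \<le> measure \<tau> ({a<..<b} - N)"
  proof -
    have gm [measurable]: "(\<lambda>x. indicator {a<..<b} x * g x) \<in> borel_measurable borel"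
      using g by (auto simp: set_integrable_def)
    \<comment> \<open>These two sets form a Hahn decomposition of \<open>g dx\<close> off
      \<open>N\<close>; on each the integral of \<open>|g|\<close> is the absolute value of a single
      value of \<open>\<gamma>\<close>.\<close>
    define A1 where "A1 = {x. indicator {a<..<b} x * g x > 0} - N"
    define A2 where "A2 = {x \<in> {a<..<b}. indicator {a<..<b} x * g x \<le> 0} - N"
    have [measurable]: "A1 \<in> sets borel" "A2 \<in> sets borel" unfolding A1_def A2_def by measurable
    have sub: "A1 \<subseteq> {a<..<b}" "A2 \<subseteq> {a<..<b}" "A1 \<inter> A2 = {}" "A1 \<union> A2 = {a<..<b} - N"
      by (auto simp: A1_def A2_def indicator_def split: if_splits)
    have val: "sm_val \<gamma> A1 = (LINT x:A1|lborel. g x)" "sm_val \<gamma> A2 = (LINT x:A2|lborel. g x)"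
      using \<gamma>[of A1] \<gamma>[of A2] sub off[of A1] off[of A2] by (auto simp: A1_def A2_def)
    have i: "set_integrable lborel A1 g" "set_integrable lborel A2 g"
      using set_integrable_subset[OF g _ sub(1)] set_integrable_subset[OF g _ sub(2)] by auto
    have "(LINT x:{a<..<b}|lborel. \<bar>g x\<bar>) = (LINT x:A1|lborel. g x) - (LINT x:A2|lborel. g x)"
    proof -
      have "(LINT x:A1|lborel. g x) - (LINT x:A2|lborel. g x) =
          (LINT x|lborel. indicator A1 x *\<^sub>R g x - indicator A2 x *\<^sub>R g x)"
        using i by (simp add: set_lebesgue_integral_def set_integrable_def)
      also have "\<dots> = (LINT x:{a<..<b}|lborel. \<bar>g x\<bar>)"
        unfolding set_lebesgue_integral_def
      proof (rule integral_cong_AE)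
        have "AE x in lborel. x \<notin> N" using N0 by (intro AE_not_in) (auto simp: null_sets_def)
        then show "AE x in lborel. indicator A1 x *\<^sub>R g x - indicator A2 x *\<^sub>R g x = indicator {a<..<b} x *\<^sub>R \<bar>g x\<bar>"
          by eventually_elim (auto simp: A1_def A2_def indicator_def)
        show "(\<lambda>x. indicator {a<..<b} x *\<^sub>R \<bar>g x\<bar>) \<in> borel_measurable lborel"
          using set_integrable_abs[OF g] by (auto simp: set_integrable_def)
        show "(\<lambda>x. indicator A1 x *\<^sub>R g x - indicator A2 x *\<^sub>R g x) \<in> borel_measurable lborel"
          using i unfolding set_integrable_def by (intro borel_measurable_diff borel_measurable_integrable)
      qed
      finally show ?thesis by simp
    qed
    also have "\<dots> \<le> measure \<tau> A1 + measure \<tau> A2"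
      using \<tau>(2)[of A1] \<tau>(2)[of A2] val by simp
    also have "\<dots> = measure \<tau> ({a<..<b} - N)"
      unfolding sub(4)[symmetric] using sub(3) M_is_borel by (intro finite_measure_Union[symmetric]) auto
    finally show ?thesis .
  qed
  have 2: "(\<Sum>A\<in>P. \<bar>sm_val \<sigma> A - (\<Sum>\<^sub>\<infinity>x\<in>A \<inter> J. jump u x)\<bar>) \<le> measure \<tau> ({a<..<b} \<inter> N - J)"
  proof -
    have each: "\<bar>sm_val \<sigma> A - (\<Sum>\<^sub>\<infinity>x\<in>A \<inter> J. jump u x)\<bar> \<le> measure \<tau> (A \<inter> N - J)" if "A \<in> P" for A
    proof -
      have A [measurable]: "A \<in> sets borel" and Asub: "A \<subseteq> {a<..<b}" using that P by auto
      have "(\<Sum>\<^sub>\<infinity>x\<in>A \<inter> J. jump u x) = (\<Sum>\<^sub>\<infinity>x\<in>A \<inter> J. sm_val \<sigma> {x})"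
        using Asub E_adm_jump(1)[OF \<open>a < b\<close> adm] by (intro infsum_cong) auto
      also have "\<dots> = sm_val \<sigma> (A \<inter> J)"
        using Jc by (intro sm_val_countable[OF \<sigma>]) auto
      finally have eq: "(\<Sum>\<^sub>\<infinity>x\<in>A \<inter> J. jump u x) = sm_val \<sigma> (A \<inter> J)" .
      have split: "sm_val \<sigma> S = sm_val \<sigma> (S \<inter> T) + sm_val \<sigma> (S - T)" if "S \<in> sets borel" "T \<in> sets borel" for S T
      proof -
        have "S \<inter> T \<inter> (S - T) = {}" by auto
        then show ?thesis
          using \<sigma>1.finite_measure_Union[of "S \<inter> T" "S - T"] \<sigma>2.finite_measure_Union[of "S \<inter> T" "S - T"] that
            \<sigma>1.M_is_borel \<sigma>2.M_is_borel by (simp add: sm_val_def Int_Diff_Un)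
      qed
      \<comment> \<open>The jump sum over \<open>A\<close> is the value of \<open>\<sigma>\<close>
        on \<open>A \<inter> J\<close>, so subtracting it amounts to removing \<open>J\<close> from
        \<open>A\<close>.\<close>
      have "sm_val \<sigma> A - sm_val \<sigma> (A \<inter> J) = sm_val \<sigma> (A - J)" using split[OF A Jb] by simp
      also have "\<dots> = sm_val \<sigma> ((A - J) \<inter> N)"
        using split[of "A - J" N] off[of "A - J - N"] by auto
      also have "(A - J) \<inter> N = A \<inter> N - J" by auto
      also have "sm_val \<sigma> (A \<inter> N - J) = sm_val \<gamma> (A \<inter> N - J)"
      proof -
        have "emeasure lborel (A \<inter> N - J) \<le> 0"
          using emeasure_mono[of "A \<inter> N - J" N lborel] N0 by auto
        then have "(LINT x:(A \<inter> N - J)|lborel. g x) = 0" by (intro set_integral_null) auto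
        moreover have "A \<inter> N - J \<subseteq> {a<..<b}" using Asub by auto
        ultimately show ?thesis using \<gamma>[of "A \<inter> N - J"] by simp
      qed
      finally show ?thesis unfolding eq using \<tau>(2)[of "A \<inter> N - J"] by auto
    qed
    have "(\<Sum>A\<in>P. \<bar>sm_val \<sigma> A - (\<Sum>\<^sub>\<infinity>x\<in>A \<inter> J. jump u x)\<bar>) \<le> (\<Sum>A\<in>P. measure \<tau> (A \<inter> N - J))"
      by (intro sum_mono each)
    also have "\<dots> = measure \<tau> (\<Union>A\<in>P. A \<inter> N - J)"
    proof (rule finite_measure_finite_Union[symmetric, OF P(1)])
      show "(\<lambda>A. A \<inter> N - J) ` P \<subseteq> sets \<tau>" using P(3) M_is_borel by auto
      show "disjoint_family_on (\<lambda>A. A \<inter> N - J) P"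
        using P(2) unfolding disjoint_def disjoint_family_on_def by blast
    qed
    also have "\<dots> \<le> measure \<tau> ({a<..<b} \<inter> N - J)"
      using P(4) M_is_borel by (intro finite_measure_mono) auto
    finally show ?thesis .
  qed
  have "measure \<tau> ({a<..<b} - N) + measure \<tau> ({a<..<b} \<inter> N - J) = measure \<tau> (({a<..<b} - N) \<union> ({a<..<b} \<inter> N - J))"
    using M_is_borel by (intro finite_measure_Union[symmetric]) auto
  also have "({a<..<b} - N) \<union> ({a<..<b} \<inter> N - J) = {a<..<b} - J" using JN by auto
  finally show ?thesis using 1 2 by linarith
qed

section \<open>Combining the estimates\<close>

lemma testfun_mono:
  assumes "testfun c d \<phi> \<phi>'" "a \<le> c" "d \<le> b"
  shows "testfun a b \<phi> \<phi>'"
  using assms unfolding testfun_def by (meson le_less_trans less_le_trans)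

lemma singular_part_le_liminf_nonlocal:
  assumes "a < b" and sm\<gamma>: "sm a b \<gamma>" and adm: "E_adm a b K u \<gamma> (Du, h, \<sigma>, g)"
    and eps: "\<And>j::nat. 0 < \<epsilon> j" "\<epsilon> \<longlonglongrightarrow> 0" and gg: "\<And>j. set_integrable lborel {a<..<b} (gg j)"
    and lim: "\<And>\<phi> \<phi>'. testfun a b \<phi> \<phi>' \<Longrightarrow> (\<lambda>j. LINT x:{a<..<b}|lborel. gg j x * \<phi> x) \<longlonglongrightarrow> sm_int \<gamma> \<phi>"
  shows "(\<integral>\<^sup>+ x\<in>{a<..<b}. ennreal \<bar>g x\<bar> \<partial>lborel)
     + (\<integral>\<^sup>+ x. ennreal (min 2 \<bar>jump u x\<bar>) \<partial>count_space (jump_set a b u))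
     + tvar a b (\<lambda>A. sm_val \<sigma> A - (\<Sum>\<^sub>\<infinity> x \<in> A \<inter> jump_set a b u. jump u x)) \<le> liminf (\<lambda>j. nonlocal a b (\<epsilon> j) (gg j))"
    (is "?G + ?S + ?V \<le> ?L")
proof -
  obtain \<tau> where \<tau>: "finite_borel_measure \<tau>" and \<tau>1: "\<And>A. A \<in> sets borel \<Longrightarrow> \<bar>sm_val \<gamma> A\<bar> \<le> measure \<tau> A"
    and \<tau>2: "\<And>x. measure \<tau> {x} = \<bar>sm_val \<gamma> {x}\<bar>"
    and \<tau>3: "\<And>c d \<delta>. c < d \<Longrightarrow> 0 < \<delta> \<Longrightarrow> \<exists>\<phi> \<phi>'. testfun c d \<phi> \<phi>' \<and> (\<forall>x. \<bar>\<phi> x\<bar> \<le> 1) \<and>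
       measure \<tau> {c<..<d} - \<delta> < sm_int \<gamma> \<phi>"
    using total_variation_exists[OF sm\<gamma>] by blast
  define J where "J = jump_set a b u"
  have Jsub: "J \<subseteq> {a<..<b}" by (auto simp: J_def jump_set_def)
  have Jc: "countable J" unfolding J_def using \<open>a < b\<close> adm by (rule countable_jump_set)
  have Jb: "J \<in> sets borel" using Jc by (rule sets.countable[rotated]) simp
  have g: "set_integrable lborel {a<..<b} g" using adm by (auto simp: E_adm_def)
  have atoms: "measure \<tau> {x} = \<bar>jump u x\<bar>" if "x \<in> {a<..<b}" for x
    using \<tau>2[of x] E_adm_jump[OF \<open>a < b\<close> adm that] by simp
  define c where "c A = \<bar>sm_val \<sigma> A - (\<Sum>\<^sub>\<infinity>x\<in>A \<inter> J. jump u x)\<bar>" for A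
  define G where "G = (LINT x:{a<..<b}|lborel. \<bar>g x\<bar>)"
  have G0: "0 \<le> G" unfolding G_def set_lebesgue_integral_def
    by (intro integral_nonneg_AE AE_I2) (auto simp: indicator_def)
  \<comment> \<open>Everything is first reduced to finite data: finitely many jumps and one finite
    family for the variation of the Cantor part. The supremum over families and the sum over all
    jumps are taken only afterwards.\<close>
  have bound: "ennreal (G + (\<Sum>x\<in>F. min 2 \<bar>jump u x\<bar>) + (\<Sum>A\<in>P. c A)) \<le> ?L"
    if F: "finite F" "F \<subseteq> J" and P: "finite P" "disjoint P" "P \<subseteq> sets borel" "\<Union>P \<subseteq> {a<..<b}" for F P
  proof -
    define R where "R = G + (\<Sum>x\<in>F. min 2 \<bar>jump u x\<bar>) + (\<Sum>A\<in>P. c A)"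
    have R0: "0 \<le> R" unfolding R_def c_def using G0 by (intro add_nonneg_nonneg sum_nonneg) auto
    have "(\<Sum>x\<in>F. min 2 \<bar>jump u x\<bar>) = (\<Sum>x\<in>F. min 2 (measure \<tau> {x}))"
      using atoms F(2) Jsub by (intro sum.cong) auto
    moreover have "G + (\<Sum>A\<in>P. c A) \<le> measure \<tau> ({a<..<b} - J)"
      unfolding G_def c_def J_def by (rule singular_part_le_variation[OF \<open>a < b\<close> adm \<tau> \<tau>1 P])
    ultimately have R: "R \<le> (\<Sum>x\<in>F. min 2 (measure \<tau> {x})) + measure \<tau> ({a<..<b} - J)"
      by (simp add: R_def)
    have "ennreal (R - e) \<le> ?L" if e: "0 < e" for e
    proof -
      \<comment> \<open>Every atom of \<open>\<tau>\<close> in \<open>(a,b)\<close> is a jump, so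
        the complement of \<open>J\<close> can serve as the nonatomic set of the grid
        construction.\<close>
      have na: "measure \<tau> {x} = 0" if "x \<in> {a<..<b} - J" for x
        using that atoms[of x] E_adm_jump[OF \<open>a < b\<close> adm, of x] by (auto simp: J_def)
      have FJ: "F \<subseteq> {a<..<b}" using F Jsub by auto
      have e2: "0 < e / 2" using e by simp
      have abJ: "{a<..<b} - J \<in> sets borel" "{a<..<b} - J \<subseteq> {a<..<b}" using Jb by auto
      obtain I :: "nat set" and \<alpha> \<beta> where I: "finite I" "disjoint_family_on (\<lambda>i. {\<alpha> i<..<\<beta> i}) I"
        "\<And>i. i \<in> I \<Longrightarrow> \<alpha> i < \<beta> i" "\<And>i. i \<in> I \<Longrightarrow> {\<alpha> i<..<\<beta> i} \<subseteq> {a<..<b}"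
        and gt: "(\<Sum>x\<in>F. min 2 (measure \<tau> {x})) + measure \<tau> ({a<..<b} - J) - e / 2 < (\<Sum>i\<in>I. min 2 (measure \<tau> {\<alpha> i<..<\<beta> i}))"
        using grid_mass[OF \<tau> \<open>a < b\<close> abJ F(1) FJ na e2] by blast
      \<comment> \<open>One half of \<open>e\<close> is spent on the grid, the other on the test
        functions, which lose at most \<open>d\<close> in each of the \<open>card I\<close>
        cells.\<close>
      define d where "d = e / (2 * (real (card I) + 1))"
      have d: "0 < d" "real (card I) * d < e / 2"
        using e by (auto simp: d_def field_simps)
      have "\<forall>i. \<exists>\<phi> \<phi>'. i \<in> I \<longrightarrow> testfun (\<alpha> i) (\<beta> i) \<phi> \<phi>' \<and> (\<forall>x. \<bar>\<phi> x\<bar> \<le> 1) \<and>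
          measure \<tau> {\<alpha> i<..<\<beta> i} - d < sm_int \<gamma> \<phi>"
        using \<tau>3[OF I(3) d(1)] by blast
      then obtain \<phi> \<phi>' where \<phi>: "\<And>i. i \<in> I \<Longrightarrow> testfun (\<alpha> i) (\<beta> i) (\<phi> i) (\<phi>' i)" "\<And>i x. i \<in> I \<Longrightarrow> \<bar>\<phi> i x\<bar> \<le> 1"
        "\<And>i. i \<in> I \<Longrightarrow> measure \<tau> {\<alpha> i<..<\<beta> i} - d < sm_int \<gamma> (\<phi> i)"
        by metis
      have l: "(\<lambda>j. LINT x:{a<..<b}|lborel. gg j x * \<phi> i x) \<longlonglongrightarrow> sm_int \<gamma> (\<phi> i)" if i: "i \<in> I" for i
      proof (rule lim[OF testfun_mono[OF \<phi>(1)[OF i]]])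
        show "a \<le> \<alpha> i" "\<beta> i \<le> b" using I(3,4)[OF i] by (auto simp: greaterThanLessThan_subseteq_greaterThanLessThan)
      qed
      have "(\<Sum>i\<in>I. min 2 (measure \<tau> {\<alpha> i<..<\<beta> i})) - real (card I) * d = (\<Sum>i\<in>I. min 2 (measure \<tau> {\<alpha> i<..<\<beta> i}) - d)"
        by (simp add: sum_subtractf)
      also have "\<dots> \<le> (\<Sum>i\<in>I. min 2 (sm_int \<gamma> (\<phi> i)))"
      proof (rule sum_mono)
        fix i assume "i \<in> I"
        from \<phi>(3)[OF this] d(1) show "min 2 (measure \<tau> {\<alpha> i<..<\<beta> i}) - d \<le> min 2 (sm_int \<gamma> (\<phi> i))"
          unfolding min_def by (auto split: if_splits)
      qed
      finally have "R - e < (\<Sum>i\<in>I. min 2 (sm_int \<gamma> (\<phi> i)))" using R gt d(2) by linarith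
      from nonlocal_eventually_ge[OF eps gg I(1,2,4) \<phi>(1,2) l this]
      have "\<forall>\<^sub>F j in sequentially. ennreal (R - e) \<le> nonlocal a b (\<epsilon> j) (gg j)" by blast
      then show ?thesis by (rule Liminf_bounded)
    qed
    then have "ennreal R \<le> ?L + ennreal e" if "0 < e" for e
    proof -
      have "ennreal R \<le> ennreal (R - e) + ennreal e"
        using that by (cases "e \<le> R") (auto simp: ennreal_neg ennreal_plus[symmetric] simp del: ennreal_plus intro!: ennreal_leI)
      also have "\<dots> \<le> ?L + ennreal e" using \<open>\<And>e. 0 < e \<Longrightarrow> ennreal (R - e) \<le> ?L\<close>[OF that] by (rule add_right_mono)
      finally show ?thesis .
    qed
    then show ?thesis unfolding R_def[symmetric] by (rule ennreal_le_epsilon)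
  qed
  have G: "?G = ennreal G"
  proof -
    have "?G = (\<integral>\<^sup>+ x. ennreal (indicator {a<..<b} x *\<^sub>R \<bar>g x\<bar>) \<partial>lborel)"
      by (intro nn_integral_cong) (auto simp: indicator_def)
    also have "\<dots> = ennreal G" unfolding G_def set_lebesgue_integral_def
      using set_integrable_abs[OF g] by (intro nn_integral_eq_integral) (auto simp: set_integrable_def)
    finally show ?thesis .
  qed
  define Ps where "Ps = {P. finite P \<and> disjoint P \<and> P \<subseteq> sets borel \<and> \<Union>P \<subseteq> {a<..<b}}"
  have V: "?V = (SUP P\<in>Ps. \<Sum>A\<in>P. ennreal (c A))"
    by (simp add: tvar_def Ps_def c_def J_def)
  have ne: "Ps \<noteq> {}" unfolding Ps_def by (auto intro!: exI[of _ "{}"] simp: disjoint_def)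
  have "(?G + ?V) + (\<integral>\<^sup>+ x. ennreal (min 2 \<bar>jump u x\<bar>) \<partial>count_space J) \<le> ?L"
  proof (rule add_nn_integral_count_space_le[OF Jc])
    fix F assume F: "finite F" "F \<subseteq> J"
    have "(?G + ?V) + (\<Sum>x\<in>F. ennreal (min 2 \<bar>jump u x\<bar>)) =
        (ennreal G + (\<Sum>x\<in>F. ennreal (min 2 \<bar>jump u x\<bar>))) + (SUP P\<in>Ps. \<Sum>A\<in>P. ennreal (c A))"
      unfolding G V by (simp add: ac_simps)
    also have "\<dots> = (SUP P\<in>Ps. (ennreal G + (\<Sum>x\<in>F. ennreal (min 2 \<bar>jump u x\<bar>))) + (\<Sum>A\<in>P. ennreal (c A)))"
      by (rule ennreal_SUP_add_right[OF ne])
    also have "\<dots> \<le> ?L"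
    proof (rule SUP_least)
      fix P assume "P \<in> Ps"
      then have P: "finite P" "disjoint P" "P \<subseteq> sets borel" "\<Union>P \<subseteq> {a<..<b}" by (auto simp: Ps_def)
      have "(ennreal G + (\<Sum>x\<in>F. ennreal (min 2 \<bar>jump u x\<bar>))) + (\<Sum>A\<in>P. ennreal (c A)) =
          ennreal (G + (\<Sum>x\<in>F. min 2 \<bar>jump u x\<bar>) + (\<Sum>A\<in>P. c A))"
        using G0 by (simp add: sum_nonneg c_def)
      also have "\<dots> \<le> ?L" using bound[OF F P] .
      finally show "(ennreal G + (\<Sum>x\<in>F. ennreal (min 2 \<bar>jump u x\<bar>))) + (\<Sum>A\<in>P. ennreal (c A)) \<le> ?L" .
    qed
    finally show "(?G + ?V) + (\<Sum>x\<in>F. ennreal (min 2 \<bar>jump u x\<bar>)) \<le> ?L" .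
  qed
  then show ?thesis unfolding J_def by (simp add: ac_simps)
qed

text \<open>The assumption \<open>ex\<close> puts every member of the sequence into the first branch
  of \<open>Eeps\<close>, so the choice made there is admissible. Nothing about this choice enters
  except the identities it satisfies against test functions.\<close>

lemma E_val_le_liminf:
  assumes "a < b" "0 < c0" and sm\<gamma>: "sm a b \<gamma>" and adm: "E_adm a b K u \<gamma> (Du, h, \<sigma>, g)"
    and eps: "\<And>j::nat. 0 < \<epsilon> j" "\<epsilon> \<longlonglongrightarrow> 0"
    and U: "\<And>j. set_integrable lborel {a<..<b} (U j)"
    and U_lim: "(\<lambda>j. LINT x:{a<..<b}|lborel. \<bar>U j x - u x\<bar>) \<longlonglongrightarrow> 0"
    and \<Gamma>: "\<And>j. sm a b (\<Gamma> j)" and flat: "(\<lambda>j. flat_dist a b (\<Gamma> j) \<gamma>) \<longlonglongrightarrow> 0"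
    and ex: "\<And>j. \<exists>wg. Eeps_adm a b K (U j) (\<Gamma> j) wg"
  shows "E_val a b c0 u (Du, h, \<sigma>, g) \<le> liminf (\<lambda>j. Eeps a b c0 K (\<epsilon> j) (U j) (\<Gamma> j))"
proof -
  define ww where "ww j = fst (SOME wg. Eeps_adm a b K (U j) (\<Gamma> j) wg)" for j
  define gg where "gg j = snd (SOME wg. Eeps_adm a b K (U j) (\<Gamma> j) wg)" for j
  define vv where "vv j x = ww j x - gg j x" for j x
  define v where "v x = h x - g x" for x
  have "Eeps_adm a b K (U j) (\<Gamma> j) (ww j, gg j)" for j
    unfolding ww_def gg_def prod.collapse using ex[of j] by (rule someI_ex)
  then have wd: "weak_deriv a b (U j) (ww j)" and gg: "set_integrable lborel {a<..<b} (gg j)"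
    and eq: "sm_eq a b (\<Gamma> j) (ac_sm a b (gg j))" and L2: "L2 a b (vv j)" for j
    unfolding Eeps_adm_def vv_def by auto
  have ww: "set_integrable lborel {a<..<b} (ww j)" for j using wd[of j] by (simp add: weak_deriv_def)
  have vv: "set_integrable lborel {a<..<b} (vv j)" for j
    unfolding vv_def using ww gg by (rule set_integral_diff(1))
  have Du: "BV_deriv a b u Du" and smDu: "sm a b Du" and u: "set_integrable lborel {a<..<b} u"
    and h: "set_integrable lborel {a<..<b} h" and g: "set_integrable lborel {a<..<b} g" and \<sigma>: "sm a b \<sigma>"
    and valDu: "\<And>A. A \<in> sets borel \<Longrightarrow> A \<subseteq> {a<..<b} \<Longrightarrow> sm_val Du A = (LINT x:A|lborel. h x) + sm_val \<sigma> A"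
    and val\<gamma>: "\<And>A. A \<in> sets borel \<Longrightarrow> A \<subseteq> {a<..<b} \<Longrightarrow> sm_val \<gamma> A = sm_val \<sigma> A + (LINT x:A|lborel. g x)"
    using adm by (auto simp: E_adm_def BV_decomp_def BV_deriv_def sm_singular_def)
  have v: "set_integrable lborel {a<..<b} v" unfolding v_def using h g by (rule set_integral_diff(1))
  have lim_g: "(\<lambda>j. LINT x:{a<..<b}|lborel. gg j x * \<phi> x) \<longlonglongrightarrow> sm_int \<gamma> \<phi>" if \<phi>: "testfun a b \<phi> \<phi>'" for \<phi> \<phi>'
  proof -
    obtain B where B: "\<And>x. \<bar>\<phi> x\<bar> \<le> B" using testfun_props(3)[OF \<phi>] by blast
    note pm = testfun_props(1)[OF \<phi>]
    have "sm_int (\<Gamma> j) \<phi> = (LINT x:{a<..<b}|lborel. gg j x * \<phi> x)" for j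
      using sm_int_cong[OF \<Gamma> sm_ac_sm[OF gg] eq pm B] sm_int_ac_sm[OF gg pm B] by simp
    then show ?thesis using flat_dist_tendsto_testfun[OF \<phi> flat] by simp
  qed
  have lim_v: "(\<lambda>j. LINT x:{a<..<b}|lborel. vv j x * \<phi> x) \<longlonglongrightarrow> (LINT x:{a<..<b}|lborel. v x * \<phi> x)"
    if \<phi>: "testfun a b \<phi> \<phi>'" for \<phi> \<phi>'
  proof -
    obtain B where B: "\<And>x. \<bar>\<phi> x\<bar> \<le> B" using testfun_props(3)[OF \<phi>] by blast
    note pm = testfun_props(1)[OF \<phi>]
    note i = set_integrable_mult_testfun(1)[OF _ \<phi>]
    have j: "(LINT x:{a<..<b}|lborel. vv j x * \<phi> x) = - (LINT x:{a<..<b}|lborel. U j x * \<phi>' x) - (LINT x:{a<..<b}|lborel. gg j x * \<phi> x)" for j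
    proof -
      have "(LINT x:{a<..<b}|lborel. vv j x * \<phi> x) = (LINT x:{a<..<b}|lborel. ww j x * \<phi> x) - (LINT x:{a<..<b}|lborel. gg j x * \<phi> x)"
        using i[OF ww] i[OF gg] by (simp add: vv_def left_diff_distrib set_integral_diff)
      then show ?thesis using wd[of j] \<phi> by (simp add: weak_deriv_def)
    qed
    \<comment> \<open>The decompositions of \<open>Du\<close> and \<open>\<gamma>\<close> are given
      as identities of values on sets; \<open>sm_int_cong\<close> converts them into identities of
      integrals. In the difference of the two the singular part \<open>\<sigma>\<close> cancels and
      only \<open>v = h - g\<close> remains.\<close>
    have "sm_eq a b Du (sm_add (ac_sm a b h) \<sigma>)"
      using valDu sm_val_sm_add[OF sm_ac_sm[OF h] \<sigma>] sm_val_ac_sm[OF h] by (simp add: sm_eq_def)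
    from sm_int_cong[OF smDu sm_sm_add[OF sm_ac_sm[OF h] \<sigma>] this pm B]
    have Du\<phi>: "sm_int Du \<phi> = (LINT x:{a<..<b}|lborel. h x * \<phi> x) + sm_int \<sigma> \<phi>"
      using sm_int_sm_add[OF sm_ac_sm[OF h] \<sigma> pm B] sm_int_ac_sm[OF h pm B] by simp
    have "sm_eq a b \<gamma> (sm_add \<sigma> (ac_sm a b g))"
      using val\<gamma> sm_val_sm_add[OF \<sigma> sm_ac_sm[OF g]] sm_val_ac_sm[OF g] by (simp add: sm_eq_def)
    from sm_int_cong[OF sm\<gamma> sm_sm_add[OF \<sigma> sm_ac_sm[OF g]] this pm B]
    have \<gamma>\<phi>: "sm_int \<gamma> \<phi> = sm_int \<sigma> \<phi> + (LINT x:{a<..<b}|lborel. g x * \<phi> x)"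
      using sm_int_sm_add[OF \<sigma> sm_ac_sm[OF g] pm B] sm_int_ac_sm[OF g pm B] by simp
    have "(LINT x:{a<..<b}|lborel. v x * \<phi> x) = - (LINT x:{a<..<b}|lborel. u x * \<phi>' x) - sm_int \<gamma> \<phi>"
    proof -
      have "(LINT x:{a<..<b}|lborel. v x * \<phi> x) = (LINT x:{a<..<b}|lborel. h x * \<phi> x) - (LINT x:{a<..<b}|lborel. g x * \<phi> x)"
        using i[OF h] i[OF g] by (simp add: v_def left_diff_distrib set_integral_diff)
      moreover have "(LINT x:{a<..<b}|lborel. u x * \<phi>' x) = - sm_int Du \<phi>" using Du \<phi> by (simp add: BV_deriv_def)
      ultimately show ?thesis using Du\<phi> \<gamma>\<phi> by simp
    qed
    then show ?thesis unfolding j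
      using tendsto_diff[OF tendsto_minus[OF L1_tendsto_testfun[OF \<phi> u U U_lim]] lim_g[OF \<phi>]] by simp
  qed
  have c0: "0 \<le> c0" using \<open>0 < c0\<close> by simp
  have Ej: "(\<integral>\<^sup>+x\<in>{a<..<b}. ennreal ((vv j x)\<^sup>2) \<partial>lborel) + ennreal c0 * nonlocal a b (\<epsilon> j) (gg j)
      \<le> Eeps a b c0 K (\<epsilon> j) (U j) (\<Gamma> j)" for j
  proof -
    have "Eeps a b c0 K (\<epsilon> j) (U j) (\<Gamma> j) = (\<integral>\<^sup>+x\<in>{a<..<b}. ennreal ((vv j x)\<^sup>2) \<partial>lborel) +
        ennreal (1 / \<epsilon> j) * (\<integral>\<^sup>+ x\<in>{a<..<b}. ennreal (fpot c0 (\<epsilon> j * avg_abs a b (\<epsilon> j) (gg j) x)) \<partial>lborel)"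
      using ex[of j] by (simp add: Eeps_def Let_def vv_def ww_def gg_def)
    then show ?thesis using nonlocal_le_energy[OF gg eps(1) c0] by (simp add: add_left_mono)
  qed
  define S where "S = (\<integral>\<^sup>+ x\<in>{a<..<b}. ennreal \<bar>g x\<bar> \<partial>lborel)
     + (\<integral>\<^sup>+ x. ennreal (min 2 \<bar>jump u x\<bar>) \<partial>count_space (jump_set a b u))
     + tvar a b (\<lambda>A. sm_val \<sigma> A - (\<Sum>\<^sub>\<infinity> x \<in> A \<inter> jump_set a b u. jump u x))"
  have "2 * (\<integral>\<^sup>+ x. ennreal (fpot c0 (\<bar>jump u x\<bar> / 2)) \<partial>count_space (jump_set a b u)) =
      ennreal c0 * (\<integral>\<^sup>+ x. ennreal (min 2 \<bar>jump u x\<bar>) \<partial>count_space (jump_set a b u))"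
  proof -
    have "2 * ennreal (fpot c0 (\<bar>y\<bar> / 2)) = ennreal c0 * ennreal (min 2 \<bar>y\<bar>)" for y
    proof -
      have "2 * ennreal (fpot c0 (\<bar>y\<bar> / 2)) = ennreal (2 * fpot c0 (\<bar>y\<bar> / 2))"
        by (subst ennreal_mult') auto
      also have "2 * fpot c0 (\<bar>y\<bar> / 2) = c0 * min 2 \<bar>y\<bar>" by (auto simp: fpot_def min_def)
      also have "ennreal \<dots> = ennreal c0 * ennreal (min 2 \<bar>y\<bar>)" using c0 by (rule ennreal_mult')
      finally show ?thesis .
    qed
    then show ?thesis by (simp flip: nn_integral_cmult)
  qed
  then have "E_val a b c0 u (Du, h, \<sigma>, g) = (\<integral>\<^sup>+x\<in>{a<..<b}. ennreal ((v x)\<^sup>2) \<partial>lborel) + ennreal c0 * S"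
    by (simp add: E_val_def S_def v_def distrib_left add.assoc)
  also have "\<dots> \<le> liminf (\<lambda>j. \<integral>\<^sup>+x\<in>{a<..<b}. ennreal ((vv j x)\<^sup>2) \<partial>lborel) + ennreal c0 * liminf (\<lambda>j. nonlocal a b (\<epsilon> j) (gg j))"
  proof (intro add_mono mult_left_mono)
    show "(\<integral>\<^sup>+x\<in>{a<..<b}. ennreal ((v x)\<^sup>2) \<partial>lborel) \<le> liminf (\<lambda>j. \<integral>\<^sup>+x\<in>{a<..<b}. ennreal ((vv j x)\<^sup>2) \<partial>lborel)"
      using \<open>a < b\<close> v L2 vv lim_v by (rule L2_norm_le_liminf)
    show "S \<le> liminf (\<lambda>j. nonlocal a b (\<epsilon> j) (gg j))"
      unfolding S_def using \<open>a < b\<close> sm\<gamma> adm eps gg lim_g by (rule singular_part_le_liminf_nonlocal)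
  qed simp
  also have "\<dots> \<le> liminf (\<lambda>j. \<integral>\<^sup>+x\<in>{a<..<b}. ennreal ((vv j x)\<^sup>2) \<partial>lborel) + liminf (\<lambda>j. ennreal c0 * nonlocal a b (\<epsilon> j) (gg j))"
    by (intro add_left_mono liminf_cmult_ennreal)
  also have "\<dots> \<le> liminf (\<lambda>j. (\<integral>\<^sup>+x\<in>{a<..<b}. ennreal ((vv j x)\<^sup>2) \<partial>lborel) + ennreal c0 * nonlocal a b (\<epsilon> j) (gg j))"
    by (rule liminf_add_ennreal)
  also have "\<dots> \<le> liminf (\<lambda>j. Eeps a b c0 K (\<epsilon> j) (U j) (\<Gamma> j))"
    using Ej by (intro Liminf_mono always_eventually) simp
  finally show ?thesis .
qed

theorem mainTheorem11:
  fixes a b c0 K :: real and u h g :: "real \<Rightarrow> real" and \<gamma> Du \<sigma> :: smeasure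
  assumes "0 < a" and "a < b" and "0 < c0" and "0 < K"
    and "sm a b \<gamma>"
    and "BV_deriv a b u Du"
    and "Linf_le a b u K"
    and "BV_decomp a b Du h \<sigma>"
    and "set_integrable lborel {a<..<b} g"
    and "\<forall>A \<in> sets borel. A \<subseteq> {a<..<b} \<longrightarrow> sm_val \<gamma> A = sm_val \<sigma> A + (LINT x:A|lborel. g x)"
    and "L2 a b (\<lambda>x. h x - g x)"
  shows "Eprime a b c0 K u \<gamma> \<ge> E a b c0 K u \<gamma>"
proof -
  have "E_adm a b K u \<gamma> (Du, h, \<sigma>, g)" using assms by (simp add: E_adm_def)
  then have ex: "\<exists>X. E_adm a b K u \<gamma> X" by blast
  \<comment> \<open>The representation chosen by \<open>E\<close> may differ from the given one, so
    the estimate is run with the chosen one.\<close>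
  obtain Du' h' \<sigma>' g' where X: "(SOME X. E_adm a b K u \<gamma> X) = (Du', h', \<sigma>', g')"
    by (cases "SOME X. E_adm a b K u \<gamma> X") auto
  have adm: "E_adm a b K u \<gamma> (Du', h', \<sigma>', g')"
    using someI_ex[OF ex] unfolding X .
  have E: "E a b c0 K u \<gamma> = E_val a b c0 u (Du', h', \<sigma>', g')"
    using ex X by (simp add: E_def)
  have "E_val a b c0 u (Du', h', \<sigma>', g') \<le> liminf (\<lambda>j. Eeps a b c0 K (\<epsilon> j) (U j) (\<Gamma> j))"
    if eps: "\<And>j. \<epsilon> j > 0" "\<epsilon> \<longlonglongrightarrow> 0" and U: "\<And>j. set_integrable lborel {a<..<b} (U j)"
      "(\<lambda>j. LINT x:{a<..<b}|lborel. \<bar>U j x - u x\<bar>) \<longlonglongrightarrow> 0"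
      and \<Gamma>: "\<And>j. sm a b (\<Gamma> j)" "(\<lambda>j. flat_dist a b (\<Gamma> j) \<gamma>) \<longlonglongrightarrow> 0" for \<epsilon> U \<Gamma>
    unfolding le_Liminf_iff
  proof (intro allI impI)
    fix y assume y: "y < E_val a b c0 u (Du', h', \<sigma>', g')"
    let ?e = "\<lambda>j. Eeps a b c0 K (\<epsilon> j) (U j) (\<Gamma> j)"
    show "\<forall>\<^sub>F j in sequentially. y < ?e j"
    proof (rule ccontr)
      assume "\<not> (\<forall>\<^sub>F j in sequentially. y < ?e j)"
      then have "\<exists>\<^sub>F j in sequentially. ?e j \<le> y" by (simp add: frequently_def not_le)
      then have inf: "infinite {j. ?e j \<le> y}"
        by (simp add: frequently_cofinite cofinite_eq_sequentially[symmetric])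
      \<comment> \<open>These indices form a subsequence on which the energies stay at most
        \<open>y\<close>, hence finite, so every pair on it is admissible. The lower bound along
        this subsequence then contradicts the choice of \<open>y\<close>.\<close>
      define r where "r = enumerate {j. ?e j \<le> y}"
      have r: "strict_mono r" "\<And>j. ?e (r j) \<le> y"
        using strict_mono_enumerate[OF inf] enumerate_in_set[OF inf] by (auto simp: r_def)
      have fin: "\<exists>wg. Eeps_adm a b K (U (r j)) (\<Gamma> (r j)) wg" for j
      proof (rule ccontr)
        assume "\<nexists>wg. Eeps_adm a b K (U (r j)) (\<Gamma> (r j)) wg"
        then have "?e (r j) = top" by (simp add: Eeps_def)
        then show False using r(2)[of j] y by (simp add: top_unique)
      qed
      have "E_val a b c0 u (Du', h', \<sigma>', g') \<le> liminf (\<lambda>j. ?e (r j))"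
      proof (rule E_val_le_liminf[OF \<open>a < b\<close> \<open>0 < c0\<close> \<open>sm a b \<gamma>\<close> adm])
        show "(\<lambda>j. \<epsilon> (r j)) \<longlonglongrightarrow> 0" "(\<lambda>j. LINT x:{a<..<b}|lborel. \<bar>U (r j) x - u x\<bar>) \<longlonglongrightarrow> 0"
          "(\<lambda>j. flat_dist a b (\<Gamma> (r j)) \<gamma>) \<longlonglongrightarrow> 0"
          using LIMSEQ_subseq_LIMSEQ[OF eps(2) r(1)] LIMSEQ_subseq_LIMSEQ[OF U(2) r(1)] LIMSEQ_subseq_LIMSEQ[OF \<Gamma>(2) r(1)]
          by (simp_all add: o_def)
      qed (use eps(1) U(1) \<Gamma>(1) fin in auto)
      also have "\<dots> \<le> y" using r(2) by (intro Liminf_le always_eventually) auto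
      finally show False using y by simp
    qed
  qed
  then show ?thesis
    unfolding E Eprime_def by (intro INF_greatest) auto
qed

end
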